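(* Let $1<p<2$ and let $(X_i,Y_i)_{i\ge 1}$ be i.i.d. random vectors in $\mathbb{R}^2$ with joint c.d.f. $H$ whose two marginal c.d.f.s are equal: $F=G$. Assume that $F$ has support $\mathbb{R}$, is twice continuously differentiable with positive density $f=F'$ on $\mathbb{R}$, and that $\log F(x)$ and $\log(1-F(x))$ are regularly varying as $|x|\to\infty$, i.e. the functions $x\mapsto -\log(1-F(x))$ and $x\mapsto-\log F(-x)$ are regularly varying as $x\to+\infty$ in the sense given in the context. Assume moreover that there are $\varepsilon>0$ and $C>0$ such that, for all $|x|$ large enough, $$F(x)(1-F(x))\le C|x|^{-\left(\frac{2(p+2)}{2-p}+\varepsilon\right)}.$$ Then, as $n\to\infty$, $$n^{p/2}\,W_p^p(\mathbb{F}_n,\mathbb{G}_n)\ \longrightarrow_{weak}\ \int_0^1|\mathbb{B}(u)|^p\,du,$$ and the limiting random variable is positive and finite.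
   Context: $\mathbb{F}_n$ and $\mathbb{G}_n$ are the empirical c.d.f.s of $X_1,\dots,X_n$ and $Y_1,\dots,Y_n$. $F^{-1}$ denotes the generalized inverse (quantile function), and $W_p^p(\mathbb{F}_n,\mathbb{G}_n)=\int_0^1|\mathbb{F}_n^{-1}(u)-\mathbb{G}_n^{-1}(u)|^p du=\frac1n\sum_{i=1}^n|X_{(i)}-Y_{(i)}|^p$, with $X_{(i)},Y_{(i)}$ the order statistics. Regular variation: a function $\psi$ is called regularly varying at $+\infty$ here if for some $\gamma\ge0$ and $y_0>0$ it is $C^2$ on $(y_0,+\infty)$ with $\psi''$ monotone there, and: if $\gamma>0$, $\psi(y)=y^\gamma L(y)$ with $L'(y)=\varepsilon(y)L(y)/y$ and $\varepsilon(y)\to0$ as $y\to+\infty$; if $\gamma=0$, $\psi=L$ is slowly varying with $L'(y)=\varepsilon(y)L(y)/y$, $\varepsilon(y)\to0$, and $L'(y)\ge l_1/y$ for $y\ge y_0$ with some $l_1\ge1$. Limit process: let $h_X=F'\circ F^{-1}$, $h_Y=G'\circ G^{-1}$, let $(B^X,B^Y)$ be a jointly centered Gaussian process on $(0,1)$ such that $B^X$, $B^Y$ are standard Brownian bridges and $\mathrm{cov}(B^X(u),B^Y(v))=H(F^{-1}(u),G^{-1}(v))-uv$, and set $\mathbb{B}(u)=B^X(u)/h_X(u)-B^Y(u)/h_Y(u)$. $\to_{weak}$ is convergence in distribution.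
   Formalization: Strict positivity of the limiting random variable is asserted (almost surely) only when X and Y are not almost surely equal; if X = Y almost surely, the limit is 0 and that claim fails. Convergence and almost sure finiteness are asserted in all cases. *)

theory Defs
  imports "HOL-Probability.Probability"
begin

definition joint_cdf :: "(real \<times> real) measure \<Rightarrow> real \<Rightarrow> real \<Rightarrow> real" where
  "joint_cdf \<mu> x y = measure \<mu> ({..x} \<times> {..y})"

definition measure_support :: "real measure \<Rightarrow> real set" where
  "measure_support \<mu> = {x. \<forall>U. open U \<and> x \<in> U \<longrightarrow> 0 < emeasure \<mu> U}"

definition quantile :: "(real \<Rightarrow> real) \<Rightarrow> real \<Rightarrow> real" where
  "quantile F u = Inf {x. u \<le> F x}"

text \<open>The sample of size \<open>n\<close> consists of \<open>x 0, \<dots>, x (n - 1)\<close>.\<close>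

definition empirical_cdf :: "nat \<Rightarrow> (nat \<Rightarrow> real) \<Rightarrow> real \<Rightarrow> real" where
  "empirical_cdf n x t = real (card {i. i < n \<and> x i \<le> t}) / real n"

text \<open>The \<open>p\<close>-th power of the \<open>p\<close>-Wasserstein distance between the laws on the real line
  with distribution functions \<open>F\<close> and \<open>G\<close>.\<close>

definition wasserstein_pow :: "real \<Rightarrow> (real \<Rightarrow> real) \<Rightarrow> (real \<Rightarrow> real) \<Rightarrow> real" where
  "wasserstein_pow p F G = (LBINT u:{0<..<1}. \<bar>quantile F u - quantile G u\<bar> powr p)"

text \<open>To be used for open sets \<open>S\<close>.\<close>

definition C2_on :: "real set \<Rightarrow> (real \<Rightarrow> real) \<Rightarrow> bool" where
  "C2_on S g \<longleftrightarrow>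
     (\<forall>x\<in>S. g field_differentiable at x) \<and>
     (\<forall>x\<in>S. deriv g field_differentiable at x) \<and>
     continuous_on S (deriv (deriv g))"

definition slowly_varying :: "(real \<Rightarrow> real) \<Rightarrow> bool" where
  "slowly_varying L \<longleftrightarrow> (\<forall>t>0. ((\<lambda>y. L (t * y) / L y) \<longlongrightarrow> 1) at_top)"

text \<open>Regular variation at \<open>+\<infinity>\<close> with smoothness. For \<open>\<gamma> = 0\<close> the factor \<open>y powr \<gamma>\<close> is \<open>1\<close>,
  so that \<open>\<psi> = L\<close> on the half line \<open>y > y0\<close>. All conditions are imposed on the open half line;
  passing to a larger \<open>y0\<close> gives them on the closed one.\<close>

definition regularly_varying :: "(real \<Rightarrow> real) \<Rightarrow> bool" where
  "regularly_varying \<psi> \<longleftrightarrow>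
     (\<exists>\<gamma>\<ge>0. \<exists>y0>0.
        C2_on {y0<..} \<psi> \<and>
        (mono_on {y0<..} (deriv (deriv \<psi>)) \<or> antimono_on {y0<..} (deriv (deriv \<psi>))) \<and>
        (\<exists>L \<epsilon>.
           (\<forall>y>y0. \<psi> y = y powr \<gamma> * L y) \<and>
           (\<forall>y>y0. (L has_real_derivative \<epsilon> y * L y / y) (at y)) \<and>
           (\<epsilon> \<longlongrightarrow> 0) at_top \<and>
           (\<gamma> = 0 \<longrightarrow> slowly_varying L \<and> (\<exists>l1\<ge>1. \<forall>y>y0. l1 / y \<le> deriv L y))))"

text \<open>The point mass at \<open>0\<close> is the centered Gaussian law with variance \<open>0\<close>.\<close>

definition centered_gaussian_law :: "real measure \<Rightarrow> bool" where
  "centered_gaussian_law \<mu> \<longleftrightarrow>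
     \<mu> = return borel 0 \<or> (\<exists>\<sigma>>0. \<mu> = density lborel (normal_density 0 \<sigma>))"

definition centered_gaussian_process :: "'b measure \<Rightarrow> 't set \<Rightarrow> ('t \<Rightarrow> 'b \<Rightarrow> real) \<Rightarrow> bool" where
  "centered_gaussian_process N T Z \<longleftrightarrow>
     (\<forall>t\<in>T. Z t \<in> borel_measurable N) \<and>
     (\<forall>J c. finite J \<and> J \<subseteq> T \<longrightarrow>
        centered_gaussian_law (distr N borel (\<lambda>\<omega>. \<Sum>t\<in>J. c t * Z t \<omega>)))"

definition covariance :: "'b measure \<Rightarrow> ('b \<Rightarrow> real) \<Rightarrow> ('b \<Rightarrow> real) \<Rightarrow> real" where
  "covariance N X Y =
     (LINT \<omega>|N. (X \<omega> - (LINT \<omega>'|N. X \<omega>')) * (Y \<omega> - (LINT \<omega>'|N. Y \<omega>')))"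

text \<open>The bridge restricted to the open unit interval; its value at both endpoints is \<open>0\<close>.\<close>

definition brownian_bridge :: "'b measure \<Rightarrow> (real \<Rightarrow> 'b \<Rightarrow> real) \<Rightarrow> bool" where
  "brownian_bridge N B \<longleftrightarrow>
     centered_gaussian_process N {0<..<1} B \<and>
     (\<forall>s\<in>{0<..<1}. \<forall>t\<in>{0<..<1}. covariance N (B s) (B t) = min s t - s * t) \<and>
     (\<forall>\<omega>\<in>space N. continuous_on {0<..<1} (\<lambda>u. B u \<omega>))"

definition converges_in_distribution ::
    "'a measure \<Rightarrow> (nat \<Rightarrow> 'a \<Rightarrow> real) \<Rightarrow> 'b measure \<Rightarrow> ('b \<Rightarrow> real) \<Rightarrow> bool" where
  "converges_in_distribution M Z N W \<longleftrightarrow>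
     (\<forall>n. Z n \<in> borel_measurable M) \<and> W \<in> borel_measurable N \<and>
     weak_conv_m (\<lambda>n. distr M borel (Z n)) (distr N borel W)"

definition limit_process ::
    "(real \<Rightarrow> real) \<Rightarrow> (real \<Rightarrow> real) \<Rightarrow> (real \<Rightarrow> 'b \<Rightarrow> real) \<Rightarrow> (real \<Rightarrow> 'b \<Rightarrow> real)
      \<Rightarrow> real \<Rightarrow> 'b \<Rightarrow> real" where
  "limit_process F G BX BY u \<omega> =
     BX u \<omega> / deriv F (quantile F u) - BY u \<omega> / deriv G (quantile G u)"

text \<open>The integral of \<open>\<bar>B u\<bar> powr p\<close> over \<open>0 < u < 1\<close>, as an element of \<open>[0, \<infinity>]\<close>.\<close>

definition power_integral :: "real \<Rightarrow> (real \<Rightarrow> 'b \<Rightarrow> real) \<Rightarrow> 'b \<Rightarrow> ennreal" where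
  "power_integral p B \<omega> = (\<integral>\<^sup>+u\<in>{0<..<1}. ennreal (\<bar>B u \<omega>\<bar> powr p) \<partial>lborel)"

end

theory Submission
  imports Defs
begin

text \<open>For \<open>0 < p < 2\<close> the function \<open>\<bar>z\<bar>\<^sup>p\<close> is a constant multiple of
  \<open>\<integral> (1 - cos (t z)) t\<^sup>-\<^sup>1\<^sup>-\<^sup>p dt\<close> over \<open>t > 0\<close>. Cutting off \<open>t < 1/m\<close> costs at most
  \<open>r\<^sub>m \<bar>z\<bar>\<^sup>q\<close> with \<open>r\<^sub>m \<rightarrow> 0\<close>, for any \<open>p < q < 2\<close>, and leaves a bounded functional whose moments are
  integrals of characteristic functions of linear combinations of the process. Hence
  \<open>\<integral> \<bar>Z\<^sub>n\<bar>\<^sup>p\<close> converges weakly as soon as the one-dimensional characteristic functions of linear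
  combinations converge and \<open>E \<integral> \<bar>Z\<^sub>n\<bar>\<^sup>q\<close> is bounded; no tightness in a function space is needed.

  The moment bound follows from the Hardy-type inequality
  \<open>\<integral> \<bar>K\<^sup>-\<^sup>1 - F\<^sup>-\<^sup>1\<bar>\<^sup>q du \<le> c \<integral> \<bar>K - F\<bar>\<^sup>q / f\<^sup>q\<^sup>-\<^sup>1 dx\<close> applied to empirical distribution functions \<open>K\<close>,
  where regular variation enters only through the hazard rate bound \<open>f \<ge> (1 - F) / x\<close>.
  The characteristic functions are handled by the Bahadur representation of the empirical
  quantiles and the central limit theorem.\<close>

section \<open>Weak convergence from moments of cosine integrals\<close>

text \<open>The obstacle is the factor \<open>1 / f (Q u)\<close>, which is unbounded near the
  endpoints of (0,1): finite-dimensional limits alone do not control an integral over the whole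
  interval. The exponent \<open>q > p\<close> pays for this, since the truncation error is then a
  null sequence in \<open>m\<close> times the \<open>q\<close>-th moment, uniformly in
  \<open>n\<close>. The function \<open>1 - cos\<close> is used because multiplying an exponential
  by a cosine gives exponentials again, and because the truncated functional is bounded, so that its
  characteristic function is a convergent series of moments.

  Origin of the tail exponent: the moments of the empirical and of the Gaussian process are both
  bounded by \<open>J_integral q\<close>. If \<open>S\<close> is a tail of the law and
  \<open>f \<ge> S / x\<close>, the integrand is at most \<open>S^(1 - q/2) * x^(q - 1)\<close>; for
  \<open>S = O(x^(-a))\<close> this is integrable when \<open>a > 2 q / (2 - q)\<close>. At
  \<open>q = (p + 2) / 2\<close>, halfway between \<open>p\<close> and 2, the right-hand side equals
  \<open>2 (p + 2) / (2 - p)\<close>, which leaves room for some \<open>q > p\<close>.\<close>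

definition lin_comb :: "('e \<Rightarrow> 'a \<Rightarrow> real) \<Rightarrow> (real \<times> 'e) list \<Rightarrow> 'a \<Rightarrow> real" where
  "lin_comb \<theta> l w = (\<Sum>(s, e)\<leftarrow>l. s * \<theta> e w)"

text \<open>With index pairs \<open>(u, t)\<close> and the cut-off kernel this becomes the
  truncation of the power integral, up to the factor \<open>kernel_const p\<close>; see
  \<open>field\<close>.\<close>

definition cos_mean :: "'e measure \<Rightarrow> ('e \<Rightarrow> 'a \<Rightarrow> real) \<Rightarrow> 'a \<Rightarrow> real" where
  "cos_mean \<nu> \<theta> w = (LINT e|\<nu>. 1 - cos (\<theta> e w))"

text \<open>Carrying the exponential along closes the family under the recursion
  \<open>trig_moment_Suc\<close>. A list may repeat an index, so enlarging the linear combination is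
  a plain cons.\<close>

definition trig_moment ::
    "'a measure \<Rightarrow> 'e measure \<Rightarrow> ('e \<Rightarrow> 'a \<Rightarrow> real) \<Rightarrow> nat \<Rightarrow> (real \<times> 'e) list \<Rightarrow> complex" where
  "trig_moment M \<nu> \<theta> k l =
     (CLINT w|M. iexp (lin_comb \<theta> l w) * complex_of_real (cos_mean \<nu> \<theta> w ^ k))"

lemma lin_comb_Nil [simp]: "lin_comb \<theta> [] w = 0"
  by (simp add: lin_comb_def)

lemma lin_comb_Cons [simp]: "lin_comb \<theta> ((s, e) # l) w = s * \<theta> e w + lin_comb \<theta> l w"
  by (simp add: lin_comb_def)

lemma lin_comb_measurable_set:
  assumes "\<And>e. e \<in> S \<Longrightarrow> \<theta> e \<in> borel_measurable M" "set l \<subseteq> UNIV \<times> S"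
  shows "lin_comb \<theta> l \<in> borel_measurable M"
  using assms(2) by (induction l) (auto simp: lin_comb_def [abs_def] intro!: assms(1) borel_measurable_add borel_measurable_times)

lemma abs_one_minus_cos_le_2: "\<bar>1 - cos t\<bar> \<le> 2" for t :: real
  using cos_ge_minus_one [of t] cos_le_one [of t] by linarith

lemma integral_diff_half:
  fixes f g h :: "'a \<Rightarrow> complex"
  assumes "integrable M f" "integrable M g" "integrable M h"
  shows "(CLINT x|M. f x - (g x + h x) / 2) = integral\<^sup>L M f - (integral\<^sup>L M g + integral\<^sup>L M h) / 2"
  using assms by simp

lemma iexp_times_one_minus_cos:
  "iexp s * complex_of_real (1 - cos t) = iexp s - (iexp (t + s) + iexp (- t + s)) / 2"
proof -
  have "complex_of_real (cos t) = (iexp t + iexp (- t)) / 2"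
    by (simp add: cos_of_real [symmetric] cos_exp_eq)
  then show ?thesis
    by (simp add: exp_add [symmetric] algebra_simps mult_exp_exp add_divide_distrib)
qed

text \<open>Finiteness of \<open>\<nu>\<close> bounds \<open>cos_mean\<close> by twice the total
  mass. Every domination argument for the moments rests on this bound, which is why the singular
  kernel has to be cut off.\<close>

locale trig_field = prob_space M + nu: finite_measure \<nu>
  for M :: "'a measure" and \<nu> :: "'e measure" +
  fixes \<theta> :: "'e \<Rightarrow> 'a \<Rightarrow> real"
  assumes field_measurable [measurable]: "case_prod \<theta> \<in> borel_measurable (\<nu> \<Otimes>\<^sub>M M)"
begin

sublocale pair_sigma_finite \<nu> M ..

lemma section_measurable: "e \<in> space \<nu> \<Longrightarrow> \<theta> e \<in> borel_measurable M"
  by measurable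

lemma lin_comb_measurable: "set l \<subseteq> UNIV \<times> space \<nu> \<Longrightarrow> lin_comb \<theta> l \<in> borel_measurable M"
  by (rule lin_comb_measurable_set [OF section_measurable])

lemma cos_mean_measurable [measurable]: "cos_mean \<nu> \<theta> \<in> borel_measurable M"
  unfolding cos_mean_def [abs_def] by measurable

lemma cos_mean_bounds: "0 \<le> cos_mean \<nu> \<theta> w" "cos_mean \<nu> \<theta> w \<le> 2 * measure \<nu> (space \<nu>)"
proof -
  show "0 \<le> cos_mean \<nu> \<theta> w"
    unfolding cos_mean_def by (intro integral_nonneg_AE AE_I2) simp
  show "cos_mean \<nu> \<theta> w \<le> 2 * measure \<nu> (space \<nu>)"
  \<comment> \<open>Since \<open>w\<close> need not lie in \<open>space M\<close>, its section may
    fail to be measurable; the Bochner integral then has the default value 0.\<close>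
  proof (cases "integrable \<nu> (\<lambda>e. 1 - cos (\<theta> e w))")
    case True
    have "cos_mean \<nu> \<theta> w \<le> (LINT e|\<nu>. 2)"
      unfolding cos_mean_def
    proof (rule integral_mono [OF True])
      show "1 - cos (\<theta> e w) \<le> 2" for e
        using cos_ge_minus_one [of "\<theta> e w"] by linarith
    qed simp
    then show ?thesis by (simp add: mult.commute)
  qed (simp add: cos_mean_def not_integrable_integral_eq)
qed

lemma norm_trig_integrand:
  "norm (iexp x * complex_of_real (cos_mean \<nu> \<theta> w ^ k)) \<le> (2 * measure \<nu> (space \<nu>)) ^ k"
  using power_mono [OF cos_mean_bounds(2,1), of w k] cos_mean_bounds(1) [of w]
  by (simp add: norm_mult norm_power)

lemma trig_integrand_integrable:
  assumes "set l \<subseteq> UNIV \<times> space \<nu>"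
  shows "integrable M (\<lambda>w. iexp (lin_comb \<theta> l w) * complex_of_real (cos_mean \<nu> \<theta> w ^ k))"
proof (rule integrable_const_bound)
  show "AE w in M. norm (iexp (lin_comb \<theta> l w) * complex_of_real (cos_mean \<nu> \<theta> w ^ k))
      \<le> (2 * measure \<nu> (space \<nu>)) ^ k"
    by (intro AE_I2 norm_trig_integrand)
qed (use lin_comb_measurable [OF assms] in measurable)

lemma norm_trig_moment:
  assumes "set l \<subseteq> UNIV \<times> space \<nu>"
  shows "norm (trig_moment M \<nu> \<theta> k l) \<le> (2 * measure \<nu> (space \<nu>)) ^ k"
proof -
  have "norm (trig_moment M \<nu> \<theta> k l) \<le> (LINT w|M. (2 * measure \<nu> (space \<nu>)) ^ k)"
    unfolding trig_moment_def
    by (intro order_trans [OF integral_norm_bound] integral_mono integrable_norm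
          trig_integrand_integrable [OF assms] norm_trig_integrand) simp
  then show ?thesis by (simp add: prob_space)
qed

lemma trig_moment_Cons_measurable:
  assumes "set l \<subseteq> UNIV \<times> space \<nu>"
  shows "(\<lambda>e. trig_moment M \<nu> \<theta> k ((s, e) # l)) \<in> borel_measurable \<nu>"
proof -
  note [measurable] = lin_comb_measurable [OF assms]
  show ?thesis unfolding trig_moment_def lin_comb_Cons by measurable
qed

text \<open>One factor of \<open>cos_mean ^ Suc k\<close> is pulled out by Fubini; writing its cosine through
  exponentials merges it into the linear combination. Induction on \<open>k\<close> therefore reduces all moments
  to \<open>k = 0\<close>, without a multivariate continuity theorem.\<close>

lemma trig_moment_Suc:
  assumes l: "set l \<subseteq> UNIV \<times> space \<nu>"
  shows "trig_moment M \<nu> \<theta> (Suc k) l =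
    (CLINT e|\<nu>. trig_moment M \<nu> \<theta> k l
       - (trig_moment M \<nu> \<theta> k ((1, e) # l) + trig_moment M \<nu> \<theta> k ((-1, e) # l)) / 2)"
proof -
  note [measurable] = lin_comb_measurable [OF l]
  let ?g = "\<lambda>w. iexp (lin_comb \<theta> l w) * complex_of_real (cos_mean \<nu> \<theta> w ^ k)"
  let ?h = "\<lambda>e w. ?g w * complex_of_real (1 - cos (\<theta> e w))"
  let ?C = "\<lambda>e. trig_moment M \<nu> \<theta> k l - (trig_moment M \<nu> \<theta> k ((1, e) # l) + trig_moment M \<nu> \<theta> k ((-1, e) # l)) / 2"
  interpret P: finite_measure "\<nu> \<Otimes>\<^sub>M M"
    by (intro finite_measure_pair_measure nu.finite_measure_axioms finite_measure_axioms)
  have bnd: "norm (?h e w) \<le> (2 * measure \<nu> (space \<nu>)) ^ k * 2" for e w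
  proof -
    show ?thesis
      unfolding norm_mult [of "?g w"] norm_of_real
      by (intro mult_mono norm_trig_integrand abs_one_minus_cos_le_2) auto
  qed
  have int: "integrable (\<nu> \<Otimes>\<^sub>M M) (case_prod ?h)"
    by (rule P.integrable_const_bound [where B="(2 * measure \<nu> (space \<nu>)) ^ k * 2"])
       (use bnd in \<open>auto intro!: AE_I2\<close>)
  have "trig_moment M \<nu> \<theta> (Suc k) l = (CLINT w|M. CLINT e|\<nu>. ?h e w)"
    unfolding trig_moment_def
  proof (intro Bochner_Integration.integral_cong refl)
    fix w assume "w \<in> space M"
    have "(CLINT e|\<nu>. ?h e w) = ?g w * complex_of_real (cos_mean \<nu> \<theta> w)"
      unfolding cos_mean_def integral_mult_right_zero integral_complex_of_real ..
    then show "iexp (lin_comb \<theta> l w) * complex_of_real (cos_mean \<nu> \<theta> w ^ Suc k) = (CLINT e|\<nu>. ?h e w)"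
      by (simp only: power_Suc of_real_mult mult_ac)
  qed
  also have "\<dots> = (CLINT e|\<nu>. CLINT w|M. ?h e w)"
    by (rule Fubini_integral [OF int])
  also have "\<dots> = (CLINT e|\<nu>. ?C e)"
  proof (intro Bochner_Integration.integral_cong refl)
    fix e assume e: "e \<in> space \<nu>"
    have ints: "integrable M (\<lambda>w. iexp (lin_comb \<theta> l' w) * complex_of_real (cos_mean \<nu> \<theta> w ^ k))"
      if "l' \<in> {l, (1, e) # l, (-1, e) # l}" for l'
      using that l e by (intro trig_integrand_integrable) auto
    have "?h e w = iexp (lin_comb \<theta> l w) * complex_of_real (cos_mean \<nu> \<theta> w ^ k)
        - (iexp (lin_comb \<theta> ((1, e) # l) w) * complex_of_real (cos_mean \<nu> \<theta> w ^ k)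
           + iexp (lin_comb \<theta> ((-1, e) # l) w) * complex_of_real (cos_mean \<nu> \<theta> w ^ k)) / 2" for w
    proof -
      have "?h e w = (iexp (lin_comb \<theta> l w) * complex_of_real (1 - cos (\<theta> e w)))
          * complex_of_real (cos_mean \<nu> \<theta> w ^ k)"
        by (simp only: mult_ac)
      then show ?thesis
        unfolding iexp_times_one_minus_cos by (simp add: field_simps)
    qed
    then show "(CLINT w|M. ?h e w) = ?C e"
      unfolding trig_moment_def by (simp only:) (rule integral_diff_half; rule ints; simp)
  qed
  finally show ?thesis .
qed

text \<open>The exponential series may be integrated termwise because \<open>cos_mean\<close> is
  bounded: the terms are dominated by those of another exponential series.\<close>

lemma iexp_cos_mean_sums:
  "(\<lambda>k. (\<i> * complex_of_real r) ^ k / fact k * trig_moment M \<nu> \<theta> k [])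
     sums (CLINT w|M. iexp (r * cos_mean \<nu> \<theta> w))"
proof -
  let ?B = "2 * measure \<nu> (space \<nu>)"
  let ?f = "\<lambda>k w. (\<i> * complex_of_real r) ^ k / fact k * complex_of_real (cos_mean \<nu> \<theta> w ^ k)"
  have norm_f: "norm (?f k w) \<le> (\<bar>r\<bar> * ?B) ^ k / fact k" for k w
    using mult_left_mono [OF power_mono [OF cos_mean_bounds(2,1), of w k], of "\<bar>r\<bar> ^ k"] cos_mean_bounds(1) [of w]
    by (simp add: norm_mult norm_divide norm_power power_mult_distrib divide_right_mono)
  have summ: "summable (\<lambda>k. (\<bar>r\<bar> * ?B) ^ k / fact k)"
    using summable_exp_generic [of "\<bar>r\<bar> * ?B"] by (simp add: divide_inverse mult.commute)
  have int_f: "integrable M (?f k)" for k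
    by (rule integrable_const_bound [where B="(\<bar>r\<bar> * ?B) ^ k / fact k"])
       (use norm_f in \<open>auto intro!: AE_I2\<close>)
  have "(\<lambda>k. integral\<^sup>L M (?f k)) sums (CLINT w|M. \<Sum>k. ?f k w)"
  proof (rule sums_integral)
    show "integrable M (?f k)" for k by (rule int_f)
    show "AE w in M. summable (\<lambda>k. norm (?f k w))"
      by (intro AE_I2 summable_comparison_test' [OF summ]) (use norm_f in auto)
    show "summable (\<lambda>k. LINT w|M. norm (?f k w))"
    proof (rule summable_comparison_test' [OF summ])
      fix k
      have "(LINT w|M. norm (?f k w)) \<le> (LINT w|M. (\<bar>r\<bar> * ?B) ^ k / fact k)"
        by (intro integral_mono norm_f integrable_norm int_f) simp
      then show "norm (LINT w|M. norm (?f k w)) \<le> (\<bar>r\<bar> * ?B) ^ k / fact k"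
        by (simp add: prob_space)
    qed
  qed
  moreover have "(\<Sum>k. ?f k w) = iexp (r * cos_mean \<nu> \<theta> w)" for w
    by (simp add: exp_def scaleR_conv_of_real power_mult_distrib divide_inverse mult_ac)
  moreover have "integral\<^sup>L M (?f k) = (\<i> * complex_of_real r) ^ k / fact k * trig_moment M \<nu> \<theta> k []" for k
    by (simp add: trig_moment_def)
  ultimately show ?thesis by (simp only:)
qed

end

text \<open>Induction on \<open>k\<close> with \<open>l\<close> arbitrary: each step lengthens the
  list by one entry and integrates over it, and dominated convergence applies with a constant
  majorant on the finite measure \<open>\<nu>\<close>. The case \<open>k = 0\<close> is the
  hypothesis on characteristic functions.\<close>

lemma trig_moment_tendsto:
  assumes fields: "\<And>n. trig_field M \<nu> (\<theta> n)" and limit: "trig_field N \<nu> \<theta>'"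
    and conv: "\<And>l. set l \<subseteq> UNIV \<times> space \<nu> \<Longrightarrow>
      (\<lambda>n. CLINT w|M. iexp (lin_comb (\<theta> n) l w)) \<longlonglongrightarrow> (CLINT w|N. iexp (lin_comb \<theta>' l w))"
    and l: "set l \<subseteq> UNIV \<times> space \<nu>"
  shows "(\<lambda>n. trig_moment M \<nu> (\<theta> n) k l) \<longlonglongrightarrow> trig_moment N \<nu> \<theta>' k l"
  using l
proof (induction k arbitrary: l)
  case 0
  then show ?case using conv by (simp add: trig_moment_def)
next
  case (Suc k)
  interpret limit: trig_field N \<nu> \<theta>' by (rule limit)
  let ?B = "2 * measure \<nu> (space \<nu>)"
  let ?c = "\<lambda>n e. trig_moment M \<nu> (\<theta> n) k l - (trig_moment M \<nu> (\<theta> n) k ((1, e) # l) + trig_moment M \<nu> (\<theta> n) k ((-1, e) # l)) / 2"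
  have Cons: "set ((s, e) # l) \<subseteq> UNIV \<times> space \<nu>" if "e \<in> space \<nu>" for s e
    using that Suc.prems by auto
  show ?case
    unfolding trig_field.trig_moment_Suc [OF fields Suc.prems] trig_field.trig_moment_Suc [OF limit Suc.prems]
  proof (rule integral_dominated_convergence [where w="\<lambda>_. ?B ^ k + (?B ^ k + ?B ^ k) / 2"])
    show "AE e in \<nu>. (\<lambda>n. ?c n e)
      \<longlonglongrightarrow> trig_moment N \<nu> \<theta>' k l
        - (trig_moment N \<nu> \<theta>' k ((1, e) # l) + trig_moment N \<nu> \<theta>' k ((-1, e) # l)) / 2"
      by (intro AE_I2 tendsto_intros Suc.IH Suc.prems Cons) simp_all
    show "AE e in \<nu>. norm (?c n e)
      \<le> ?B ^ k + (?B ^ k + ?B ^ k) / 2" for n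
    proof (rule AE_I2)
      fix e assume "e \<in> space \<nu>"
      then show "norm (?c n e)
        \<le> ?B ^ k + (?B ^ k + ?B ^ k) / 2"
        using trig_field.norm_trig_moment [OF fields [of n] Suc.prems, of k]
          trig_field.norm_trig_moment [OF fields [of n] Cons, of e k 1]
          trig_field.norm_trig_moment [OF fields [of n] Cons, of e k "-1"]
        by (intro order_trans [OF norm_triangle_ineq4] add_mono)
           (auto simp: norm_divide intro: order_trans [OF norm_triangle_ineq])
    qed
  qed (use trig_field.trig_moment_Cons_measurable [OF fields Suc.prems]
         limit.trig_moment_Cons_measurable [OF Suc.prems] in \<open>auto intro!: borel_measurable_diff borel_measurable_add borel_measurable_divide\<close>)
qed

text \<open>The moment bounds do not depend on \<open>n\<close>, so Tannery's theorem passes to the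
  limit in the whole exponential series.\<close>

proposition char_cos_mean_tendsto:
  assumes fields: "\<And>n. trig_field M \<nu> (\<theta> n)" and limit: "trig_field N \<nu> \<theta>'"
    and conv: "\<And>l. set l \<subseteq> UNIV \<times> space \<nu> \<Longrightarrow>
      (\<lambda>n. CLINT w|M. iexp (lin_comb (\<theta> n) l w)) \<longlonglongrightarrow> (CLINT w|N. iexp (lin_comb \<theta>' l w))"
  shows "(\<lambda>n. CLINT w|M. iexp (r * cos_mean \<nu> (\<theta> n) w)) \<longlonglongrightarrow> (CLINT w|N. iexp (r * cos_mean \<nu> \<theta>' w))"
proof -
  let ?B = "2 * measure \<nu> (space \<nu>)"
  let ?t = "\<lambda>n k. (\<i> * complex_of_real r) ^ k / fact k * trig_moment M \<nu> (\<theta> n) k []"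
  let ?s = "\<lambda>k. (\<i> * complex_of_real r) ^ k / fact k * trig_moment N \<nu> \<theta>' k []"
  have "(\<forall>\<^sub>F n in sequentially. summable (\<lambda>k. norm (?t n k))) \<and> summable (\<lambda>k. norm (?s k))
      \<and> (\<lambda>n. \<Sum>k. ?t n k) \<longlonglongrightarrow> (\<Sum>k. ?s k)"
  proof (rule tannerys_theorem [where M="\<lambda>k. (\<bar>r\<bar> * ?B) ^ k / fact k"])
    show "summable (\<lambda>k. (\<bar>r\<bar> * ?B) ^ k / fact k)"
      using summable_exp_generic [of "\<bar>r\<bar> * ?B"] by (simp add: divide_inverse mult.commute)
    show "(\<lambda>n. ?t n k) \<longlonglongrightarrow> (\<i> * complex_of_real r) ^ k / fact k * trig_moment N \<nu> \<theta>' k []" for k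
      by (intro tendsto_intros trig_moment_tendsto [OF fields limit conv]) auto
    show "\<forall>\<^sub>F (k, n) in sequentially \<times>\<^sub>F sequentially. norm (?t n k) \<le> (\<bar>r\<bar> * ?B) ^ k / fact k"
    proof (intro always_eventually allI, clarify)
      fix k n
      show "norm (?t n k) \<le> (\<bar>r\<bar> * ?B) ^ k / fact k"
        using mult_left_mono [OF trig_field.norm_trig_moment [OF fields, of "[]" n k], of "\<bar>r\<bar> ^ k"]
        by (auto simp: norm_mult norm_divide norm_power power_mult_distrib divide_right_mono)
    qed
  qed simp
  then show ?thesis
    using trig_field.iexp_cos_mean_sums [OF fields, THEN sums_unique, of r]
      trig_field.iexp_cos_mean_sums [OF limit, THEN sums_unique, of r] by simp
qed

section \<open>The singular kernel\<close>

lemma nn_integral_powr_from_0: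
  fixes a b :: real
  assumes "0 < b" "0 \<le> a"
  shows "(\<integral>\<^sup>+t. ennreal (t powr (b - 1)) * indicator {0..a} t \<partial>lborel) = ennreal (a powr b / b)"
proof -
  have "((\<lambda>t. t powr (b - 1)) has_integral (a powr (b - 1 + 1) / (b - 1 + 1))) {0..a}"
    using assms by (intro has_integral_powr_from_0) auto
  then show ?thesis
    by (intro nn_integral_has_integral_lebesgue') auto
qed

lemma nn_integral_powr_to_inf:
  fixes a c :: real
  assumes "0 < a" "0 < c"
  shows "(\<integral>\<^sup>+t. ennreal (t powr (- 1 - c)) * indicator {a..} t \<partial>lborel) = ennreal (a powr (- c) / c)"
proof -
  have "(\<integral>\<^sup>+t. ennreal (t powr (- 1 - c)) * indicator {a..} t \<partial>lborel) = ennreal (0 - (- (a powr (- c) / c)))"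
  proof (rule nn_integral_FTC_atLeast)
    show "((\<lambda>t. - (t powr (- c) / c)) has_real_derivative t powr (- 1 - c)) (at t)" if "a \<le> t" for t
      using that assms by (auto intro!: derivative_eq_intros simp: powr_diff powr_minus field_simps)
    have "((\<lambda>t. - (t powr (- c) / c)) \<longlongrightarrow> - (0 / c)) at_top"
      using assms by (intro tendsto_intros tendsto_neg_powr filterlim_ident) auto
    then show "((\<lambda>t. - (t powr (- c) / c)) \<longlongrightarrow> 0) at_top" by simp
  qed auto
  then show ?thesis by simp
qed

text \<open>The constant bound 2 serves for \<open>|t| \<ge> 1\<close>, the quadratic bound
  otherwise. Allowing all \<open>q\<close> in between is what makes the neglected part of the kernel
  integrable in \<open>kernel_le_tail\<close>.\<close>

lemma one_minus_cos_le:
  fixes t q :: real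
  assumes "0 \<le> q" "q \<le> 2"
  shows "1 - cos t \<le> 2 * \<bar>t\<bar> powr q"
proof (cases "\<bar>t\<bar> \<ge> 1")
  case True
  then have "1 \<le> \<bar>t\<bar> powr q" using assms by (intro ge_one_powr_ge_zero) auto
  then show ?thesis using cos_ge_minus_one [of t] by linarith
next
  case False
  have "1 - cos t = 2 * (sin (t / 2))\<^sup>2"
    using cos_double_sin [of "t / 2"] by simp
  also have "\<dots> \<le> 2 * (t / 2)\<^sup>2"
    using abs_sin_x_le_abs_x [of "t / 2"] by (simp only: abs_le_square_iff mult_le_cancel_left) simp
  also have "\<dots> \<le> 2 * \<bar>t\<bar> powr 2"
    by (cases "t = 0") (simp_all add: power2_eq_square powr_numeral)
  also have "\<dots> \<le> 2 * \<bar>t\<bar> powr q"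
    using False assms by (intro mult_left_mono powr_mono') auto
  finally show ?thesis .
qed

lemma powr_le_one_plus_powr:
  fixes r p q :: real
  assumes "0 \<le> r" "0 < p" "p \<le> q"
  shows "r powr p \<le> 1 + r powr q"
proof (cases "r \<le> 1")
  case True
  then have "r powr p \<le> 1" using assms by (intro powr_le1) auto
  then show ?thesis by (simp add: add_increasing2)
next
  case False
  then have "r powr p \<le> r powr q" using assms by (intro powr_mono) auto
  then show ?thesis by simp
qed

lemma iexp_lipschitz: "cmod (iexp x - iexp y) \<le> \<bar>x - y\<bar>"
proof -
  have "iexp x - iexp y = iexp y * (iexp (x - y) - 1)"
    by (simp add: algebra_simps mult_exp_exp)
  then show ?thesis
    using iexp_approx1 [of "x - y" 0] by (simp add: norm_mult)
qed

text \<open>Finite for \<open>0 < p < 2\<close>: the integrand is of order \<open>t^(1 - p)\<close>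
  at 0 and at most of order \<open>t^(- 1 - p)\<close> at infinity. As an \<open>ennreal\<close> it
  can be used in identities before finiteness is known.\<close>

definition kernel_const :: "real \<Rightarrow> ennreal" where
  "kernel_const p = (\<integral>\<^sup>+t. ennreal ((1 - cos t) * t powr (- 1 - p)) * indicator {0..} t \<partial>lborel)"

text \<open>Removing a neighbourhood of 0 leaves a finite measure; \<open>Suc m\<close> keeps the
  cut-off positive for every \<open>m\<close>.\<close>

definition tail_kernel :: "real \<Rightarrow> nat \<Rightarrow> real measure" where
  "tail_kernel p m = density lborel (\<lambda>t. ennreal (t powr (- 1 - p)) * indicator {1 / real (Suc m)..} t)"

lemma sets_tail_kernel [measurable_cong, simp]: "sets (tail_kernel p m) = sets borel"
  by (simp add: tail_kernel_def)

lemma finite_tail_kernel: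
  assumes "0 < p" shows "finite_measure (tail_kernel p m)"
proof (rule finite_measureI)
  have "emeasure (tail_kernel p m) (space (tail_kernel p m)) =
    (\<integral>\<^sup>+t. ennreal (t powr (- 1 - p)) * indicator {1 / real (Suc m)..} t \<partial>lborel)"
    by (simp add: tail_kernel_def emeasure_density)
  also have "\<dots> = ennreal ((1 / real (Suc m)) powr (- p) / p)"
    using assms by (intro nn_integral_powr_to_inf) auto
  finally show "emeasure (tail_kernel p m) (space (tail_kernel p m)) \<noteq> \<infinity>" by simp
qed

text \<open>Homogeneity: rescaling the variable by \<open>|z|\<close> turns the kernel into
  \<open>|z|^(-1-p)\<close> times itself, and the Jacobian contributes one more factor
  \<open>|z|\<close>.\<close>

lemma nn_integral_kernel:
  assumes "0 < p"
  shows "(\<integral>\<^sup>+t. ennreal ((1 - cos (t * z)) * t powr (- 1 - p)) * indicator {0..} t \<partial>lborel)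
    = kernel_const p * ennreal (\<bar>z\<bar> powr p)"
proof (cases "z = 0")
  case False
  let ?k = "\<lambda>t. ennreal ((1 - cos (t * z)) * t powr (- 1 - p)) * indicator {0..} t"
  let ?k' = "\<lambda>t. ennreal ((1 - cos (0 + \<bar>z\<bar> * t)) * (0 + \<bar>z\<bar> * t) powr (- 1 - p)) * indicator {0..} (0 + \<bar>z\<bar> * t)"
  let ?J = "\<integral>\<^sup>+t. ?k t \<partial>lborel"
  have "kernel_const p = \<bar>z\<bar> * (\<integral>\<^sup>+t. ?k' t \<partial>lborel)"
    unfolding kernel_const_def using False by (subst nn_integral_real_affine [of _ "\<bar>z\<bar>" 0]) auto
  also have "(\<integral>\<^sup>+t. ?k' t \<partial>lborel)
     = (\<integral>\<^sup>+t. ennreal (\<bar>z\<bar> powr (- 1 - p)) * (?k t) \<partial>lborel)"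
  proof (rule nn_integral_cong)
    fix t :: real
    have "cos (\<bar>z\<bar> * t) = cos (t * z)"
      by (cases "0 \<le> z") (auto simp: mult.commute)
    moreover have "0 \<le> 1 - cos (t * z)" by simp
    ultimately show "?k' t = ennreal (\<bar>z\<bar> powr (- 1 - p)) * (?k t)"
      using False
      by (auto simp: indicator_def powr_mult ennreal_mult [symmetric] zero_le_mult_iff mult_ac)
  qed
  also have "\<dots> = ennreal (\<bar>z\<bar> powr (- 1 - p)) * ?J"
    by (rule nn_integral_cmult) measurable
  finally have "kernel_const p * ennreal (\<bar>z\<bar> powr p) =
      (ennreal \<bar>z\<bar> * ennreal (\<bar>z\<bar> powr (- 1 - p)) * ennreal (\<bar>z\<bar> powr p)) * ?J"
    by (simp add: mult_ac)
  also have "ennreal \<bar>z\<bar> * ennreal (\<bar>z\<bar> powr (- 1 - p)) * ennreal (\<bar>z\<bar> powr p) = ennreal (\<bar>z\<bar> powr 1 * \<bar>z\<bar> powr (- 1 - p) * \<bar>z\<bar> powr p)"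
    using False by (simp add: ennreal_mult)
  also have "\<bar>z\<bar> powr 1 * \<bar>z\<bar> powr (- 1 - p) * \<bar>z\<bar> powr p = 1"
    using False by (simp only: powr_add [symmetric]) simp
  finally show ?thesis by simp
qed (use assms in simp)

lemma kernel_tail_le:
  assumes "0 < p"
  shows "(\<integral>\<^sup>+t. ennreal (1 - cos (t * z)) \<partial>tail_kernel p m) \<le> kernel_const p * ennreal (\<bar>z\<bar> powr p)"
  unfolding nn_integral_kernel [OF assms, symmetric] tail_kernel_def
proof (subst nn_integral_density)
  show "(\<integral>\<^sup>+t. ennreal (t powr (- 1 - p)) * indicator {1 / real (Suc m)..} t * ennreal (1 - cos (t * z)) \<partial>lborel)
    \<le> (\<integral>\<^sup>+t. ennreal ((1 - cos (t * z)) * t powr (- 1 - p)) * indicator {0..} t \<partial>lborel)"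
  proof (rule nn_integral_mono)
    fix t :: real
    have "1 / real (Suc m) \<le> t \<Longrightarrow> 0 \<le> t"
      by (rule order_trans [of _ "1 / real (Suc m)"]) auto
    then show "ennreal (t powr (- 1 - p)) * indicator {1 / real (Suc m)..} t * ennreal (1 - cos (t * z))
      \<le> ennreal ((1 - cos (t * z)) * t powr (- 1 - p)) * indicator {0..} t"
      by (auto simp: indicator_def ennreal_mult [symmetric] mult.commute simp del: of_nat_Suc)
  qed
qed measurable

text \<open>Below the cut-off \<open>a\<close>, the bound
  \<open>1 - cos (t z) \<le> 2 |t z|^q\<close> leaves the integral of \<open>t^(q - p - 1)\<close>
  over \<open>[0, a]\<close>, which is \<open>a^(q - p) / (q - p)\<close> and tends to 0 with
  \<open>a\<close> because \<open>q > p\<close>.\<close>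

lemma kernel_le_tail:
  assumes p: "0 < p" "p < q" "q \<le> 2"
  shows "kernel_const p * ennreal (\<bar>z\<bar> powr p) \<le> (\<integral>\<^sup>+t. ennreal (1 - cos (t * z)) \<partial>tail_kernel p m)
     + ennreal (2 * (1 / real (Suc m)) powr (q - p) / (q - p)) * ennreal (\<bar>z\<bar> powr q)"
proof -
  let ?a = "1 / real (Suc m)"
  let ?i = "\<lambda>t. ennreal (t powr (- 1 - p)) * indicator {?a..} t * ennreal (1 - cos (t * z))"
  let ?j = "\<lambda>t. ennreal (t powr (q - p - 1)) * indicator {0..?a} t"
  have "kernel_const p * ennreal (\<bar>z\<bar> powr p) \<le>
    (\<integral>\<^sup>+t. ?i t
      + ennreal (2 * \<bar>z\<bar> powr q) * (?j t) \<partial>lborel)"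
    unfolding nn_integral_kernel [OF p(1), symmetric]
  proof (rule nn_integral_mono)
    fix t :: real
    show "ennreal ((1 - cos (t * z)) * t powr (- 1 - p)) * indicator {0..} t
      \<le> ?i t
      + ennreal (2 * \<bar>z\<bar> powr q) * (?j t)"
    proof (cases "?a \<le> t \<or> t < 0")
      case True
      then show ?thesis
        by (auto simp: indicator_def ennreal_mult [symmetric] mult.commute)
    next
      case False
      then have t: "0 \<le> t" "t < ?a" by auto
      have "(1 - cos (t * z)) * t powr (- 1 - p) \<le> 2 * \<bar>t * z\<bar> powr q * t powr (- 1 - p)"
        using p by (intro mult_right_mono one_minus_cos_le) auto
      also have "\<dots> = 2 * \<bar>z\<bar> powr q * (t powr q * t powr (- 1 - p))"
        using t by (simp add: abs_mult powr_mult)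
      also have "t powr q * t powr (- 1 - p) = t powr (q - p - 1)"
        by (simp add: powr_add [symmetric] algebra_simps)
      finally show ?thesis
        using t by (simp add: ennreal_mult [symmetric] ennreal_leI)
    qed
  qed
  also have "\<dots> = (\<integral>\<^sup>+t. ?i t \<partial>lborel)
     + ennreal (2 * \<bar>z\<bar> powr q) * (\<integral>\<^sup>+t. ?j t \<partial>lborel)"
    by (simp add: nn_integral_add nn_integral_cmult del: of_nat_Suc)
  also have "(\<integral>\<^sup>+t. ?j t \<partial>lborel) = ennreal (?a powr (q - p) / (q - p))"
    using p by (intro nn_integral_powr_from_0) auto
  also have "(\<integral>\<^sup>+t. ?i t \<partial>lborel)
     = (\<integral>\<^sup>+t. ennreal (1 - cos (t * z)) \<partial>tail_kernel p m)"
    unfolding tail_kernel_def by (subst nn_integral_density) auto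
  also have "ennreal (2 * \<bar>z\<bar> powr q) * ennreal (?a powr (q - p) / (q - p))
     = ennreal (2 * ?a powr (q - p) / (q - p)) * ennreal (\<bar>z\<bar> powr q)"
    using p by (simp add: ennreal_mult [symmetric] mult_ac del: of_nat_Suc)
  finally show ?thesis .
qed

text \<open>The case \<open>z = 1\<close>, \<open>q = 2\<close>, \<open>m = 0\<close> of
  \<open>kernel_le_tail\<close>: there a function bounded by 2 is integrated against a finite
  measure.\<close>

lemma kernel_const_finite:
  assumes "0 < p" "p < 2" shows "kernel_const p < \<infinity>"
proof -
  interpret finite_measure "tail_kernel p 0" by (rule finite_tail_kernel [OF assms(1)])
  have "(\<integral>\<^sup>+t. ennreal (1 - cos (t * 1)) \<partial>tail_kernel p 0) \<le> (\<integral>\<^sup>+t. 2 \<partial>tail_kernel p 0)"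
  proof (rule nn_integral_mono)
    show "ennreal (1 - cos (t * 1)) \<le> 2" for t :: real
      using ennreal_leI [of "1 - cos t" 2] cos_ge_minus_one [of t] by simp
  qed
  also have "\<dots> < \<infinity>" by (simp add: ennreal_mult_less_top less_top [symmetric] ennreal_mult_eq_top_iff)
  finally have "(\<integral>\<^sup>+t. ennreal (1 - cos (t * 1)) \<partial>tail_kernel p 0)
     + ennreal (2 * (1 / real (Suc 0)) powr (2 - p) / (2 - p)) * ennreal (\<bar>1\<bar> powr 2) < \<infinity>"
    by (simp add: ennreal_mult_less_top)
  moreover have "kernel_const p * ennreal (\<bar>1\<bar> powr p) \<le> (\<integral>\<^sup>+t. ennreal (1 - cos (t * 1)) \<partial>tail_kernel p 0)
     + ennreal (2 * (1 / real (Suc 0)) powr (2 - p) / (2 - p)) * ennreal (\<bar>1\<bar> powr 2)"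
    using assms by (intro kernel_le_tail) auto
  ultimately show ?thesis by (simp add: le_less_trans)
qed

text \<open>Needed to divide by the constant. If it were 0, the integrand would vanish almost
  everywhere on [1, 2], where \<open>cos t < 1\<close>.\<close>

lemma kernel_const_pos: "0 < kernel_const p"
proof (rule ccontr)
  assume "\<not> 0 < kernel_const p"
  then have "AE t in lborel. ennreal ((1 - cos t) * t powr (- 1 - p)) * indicator {0..} t = 0"
    unfolding kernel_const_def by (subst nn_integral_0_iff_AE [symmetric]) auto
  then have "AE t in lborel. t \<notin> {1..2::real}"
  proof eventually_elim
    case (elim t)
    show ?case
    proof
      assume t: "t \<in> {1..2}"
      then have "cos t < cos 0"
        using pi_gt3 by (intro cos_monotone_0_pi) auto
      with t elim show False by (auto simp: ennreal_eq_0_iff mult_le_0_iff)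
    qed
  qed
  then have "{1..2::real} \<in> null_sets lborel"
    by (subst AE_iff_null_sets) auto
  then have "emeasure lborel {1..2::real} = 0" by auto
  then show False by simp
qed


section \<open>Weak convergence of power integrals of a process\<close>

lemma tendsto_by_approximation:
  fixes a :: "nat \<Rightarrow> 'a::metric_space"
  assumes close: "\<And>m n. dist (a n) (b m n) \<le> \<delta> m" "\<And>m. dist a' (b' m) \<le> \<delta> m"
    and conv: "\<And>m. b m \<longlonglongrightarrow> b' m" and \<delta>: "\<delta> \<longlonglongrightarrow> (0::real)"
  shows "a \<longlonglongrightarrow> a'"
proof (rule tendstoI)
  fix e :: real assume "0 < e"
  then have "\<forall>\<^sub>F m in sequentially. \<delta> m < e / 3"
    by (intro order_tendstoD(2) [OF \<delta>]) auto
  then obtain m where m: "\<delta> m < e / 3"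
    by (auto simp: eventually_sequentially)
  have "\<forall>\<^sub>F n in sequentially. dist (b m n) (b' m) < e / 3"
    using \<open>0 < e\<close> by (intro tendstoD [OF conv]) auto
  then show "\<forall>\<^sub>F n in sequentially. dist (a n) a' < e"
  proof eventually_elim
    case (elim n)
    have "dist (a n) a' \<le> dist (a n) (b m n) + dist (b m n) (b' m) + dist a' (b' m)"
      using dist_triangle [of "a n" a' "b m n"] dist_triangle [of "b m n" a' "b' m"]
      by (simp add: dist_commute)
    with close(1) [of n m] close(2) [of m] m elim show ?case by linarith
  qed
qed

text \<open>The bound \<open>B\<close> is a parameter so that a single constant can serve a whole
  sequence of processes together with its limit.\<close>

locale bounded_power_process = prob_space M + U: finite_measure U
  for M :: "'a measure" and U :: "'u measure" +
  fixes Z :: "'u \<Rightarrow> 'a \<Rightarrow> real" and p q B :: real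
  assumes process_measurable [measurable]: "case_prod Z \<in> borel_measurable (U \<Otimes>\<^sub>M M)"
    and exponents: "0 < p" "p < q" "q < 2"
    and bound_nonneg: "0 \<le> B"
    and moment_bound: "(\<integral>\<^sup>+w. \<integral>\<^sup>+u. ennreal (\<bar>Z u w\<bar> powr q) \<partial>U \<partial>M) \<le> ennreal B"
begin

definition powint :: "real \<Rightarrow> 'a \<Rightarrow> ennreal" where
  "powint r w = (\<integral>\<^sup>+u. ennreal (\<bar>Z u w\<bar> powr r) \<partial>U)"

text \<open>The index gains the kernel variable \<open>t\<close>, so that integrating
  \<open>1 - cos\<close> of this field over \<open>U\<close> and \<open>tail_kernel p m\<close>
  gives the truncated kernel integral of every \<open>Z u\<close> at once.\<close>

definition field :: "'u \<times> real \<Rightarrow> 'a \<Rightarrow> real" where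
  "field e w = snd e * Z (fst e) w"

lemma powint_measurable [measurable]: "powint r \<in> borel_measurable M"
  unfolding powint_def [abs_def] by measurable

lemma trig_field: "trig_field M (U \<Otimes>\<^sub>M tail_kernel p m) field"
proof -
  interpret T: finite_measure "tail_kernel p m" by (rule finite_tail_kernel [OF exponents(1)])
  interpret UT: finite_measure "U \<Otimes>\<^sub>M tail_kernel p m"
    by (intro finite_measure_pair_measure U.finite_measure_axioms T.finite_measure_axioms)
  show ?thesis
  proof
    show "case_prod field \<in> borel_measurable ((U \<Otimes>\<^sub>M tail_kernel p m) \<Otimes>\<^sub>M M)"
      unfolding field_def by measurable
  qed
qed

lemma lin_comb_field: "lin_comb field l w = lin_comb Z (map (\<lambda>(s, u, t). (s * t, u)) l) w"
  by (induction l) (auto simp: field_def)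

lemma AE_powint_finite: "AE w in M. powint q w < \<infinity>"
proof -
  have "(\<integral>\<^sup>+w. powint q w \<partial>M) \<noteq> \<infinity>"
    using moment_bound unfolding powint_def
    by (metis ennreal_less_top infinity_ennreal_def leD)
  then show ?thesis
    using nn_integral_PInf_AE [of "powint q" M] by (simp add: less_top)
qed

lemma powint_p_finite: "powint q w < \<infinity> \<Longrightarrow> w \<in> space M \<Longrightarrow> powint p w < \<infinity>"
proof -
  assume fin: "powint q w < \<infinity>" and [measurable]: "w \<in> space M"
  have "powint p w \<le> (\<integral>\<^sup>+u. 1 + ennreal (\<bar>Z u w\<bar> powr q) \<partial>U)"
    unfolding powint_def
  proof (rule nn_integral_mono)
    fix u
    have "\<bar>Z u w\<bar> powr p \<le> 1 + \<bar>Z u w\<bar> powr q"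
      using exponents by (intro powr_le_one_plus_powr) auto
    then show "ennreal (\<bar>Z u w\<bar> powr p) \<le> 1 + ennreal (\<bar>Z u w\<bar> powr q)"
      by (metis ennreal_leI ennreal_plus ennreal_1 powr_ge_zero zero_le_one)
  qed
  also have "\<dots> = emeasure U (space U) + powint q w"
    unfolding powint_def by (subst nn_integral_add) auto
  also have "\<dots> < \<infinity>" using fin U.emeasure_finite [of "space U"] by (simp add: less_top [symmetric])
  finally show ?thesis .
qed

text \<open>The two pointwise inequalities \<open>kernel_tail_le\<close> and
  \<open>kernel_le_tail\<close>, at \<open>z = Z u w\<close>, are integrated over
  \<open>u\<close>.\<close>

lemma cos_mean_field_approx:
  assumes fin: "powint q w < \<infinity>" and w [measurable]: "w \<in> space M"
  shows "\<bar>enn2real (kernel_const p) * enn2real (powint p w) - cos_mean (U \<Otimes>\<^sub>M tail_kernel p m) field w\<bar>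
    \<le> 2 * (1 / real (Suc m)) powr (q - p) / (q - p) * enn2real (powint q w)" (is "_ \<le> ?r * _")
proof -
  let ?T = "U \<Otimes>\<^sub>M tail_kernel p m"
  interpret T: finite_measure "tail_kernel p m" by (rule finite_tail_kernel [OF exponents(1)])
  interpret F: trig_field M "?T" field by (rule trig_field)
  let ?c = "cos_mean (?T) field w"
  have "ennreal ?c = (\<integral>\<^sup>+e. ennreal (1 - cos (field e w)) \<partial>(?T))"
    unfolding cos_mean_def
  proof (rule nn_integral_eq_integral [symmetric])
    show "integrable (?T) (\<lambda>e. 1 - cos (field e w))"
    proof (rule F.nu.integrable_const_bound [where B=2])
      have "norm (1 - cos (field e w)) \<le> 2" for e
        using abs_one_minus_cos_le_2 by simp
      then show "AE e in ?T. norm (1 - cos (field e w)) \<le> 2" by simp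
    qed (simp add: field_def)
  qed simp
  also have "\<dots> = (\<integral>\<^sup>+u. \<integral>\<^sup>+t. ennreal (1 - cos (t * Z u w)) \<partial>tail_kernel p m \<partial>U)"
    by (subst T.nn_integral_fst [symmetric]) (simp_all add: field_def)
  finally have c: "ennreal ?c = \<dots>" .
  let ?k = "enn2real (kernel_const p)"
  have k: "kernel_const p = ennreal ?k"
    using kernel_const_finite [of p] exponents by simp
  have kP: "ennreal (?k * enn2real (powint p w)) = (\<integral>\<^sup>+u. kernel_const p * ennreal (\<bar>Z u w\<bar> powr p) \<partial>U)"
    using powint_p_finite [OF fin w] k
    by (simp add: nn_integral_cmult powint_def [symmetric] ennreal_mult)
  have r0: "0 \<le> ?r" using exponents by simp
  have rQ: "ennreal (?r * enn2real (powint q w)) = (\<integral>\<^sup>+u. ennreal ?r * ennreal (\<bar>Z u w\<bar> powr q) \<partial>U)"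
    unfolding ennreal_mult [OF r0 enn2real_nonneg]
    using fin by (simp add: nn_integral_cmult powint_def [symmetric])
  have c0: "0 \<le> ?c" by (rule F.cos_mean_bounds)
  have rq0: "0 \<le> ?r * enn2real (powint q w)" using exponents by simp
  have "ennreal ?c \<le> ennreal (?k * enn2real (powint p w))"
    unfolding c kP by (intro nn_integral_mono kernel_tail_le exponents)
  then have 1: "?c \<le> ?k * enn2real (powint p w)"
    by (subst (asm) ennreal_le_iff) auto
  have "ennreal (?k * enn2real (powint p w)) \<le> ennreal ?c + ennreal (?r * enn2real (powint q w))"
    unfolding c kP rQ
  proof (subst nn_integral_add [symmetric])
    show "(\<integral>\<^sup>+u. kernel_const p * ennreal (\<bar>Z u w\<bar> powr p) \<partial>U) \<le>
      (\<integral>\<^sup>+u. (\<integral>\<^sup>+t. ennreal (1 - cos (t * Z u w)) \<partial>tail_kernel p m) + ennreal ?r * ennreal (\<bar>Z u w\<bar> powr q) \<partial>U)"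
      by (intro nn_integral_mono kernel_le_tail) (use exponents in auto)
  qed auto
  also have "\<dots> = ennreal (?c + ?r * enn2real (powint q w))"
    using c0 rq0 by simp
  finally have 2: "?k * enn2real (powint p w) \<le> ?c + ?r * enn2real (powint q w)"
    using c0 rq0 by (subst (asm) ennreal_le_iff) auto
  from 1 2 show ?thesis by simp
qed

text \<open>The exponential is 1-Lipschitz, so the truncation error may be taken in mean. The bound
  depends on the process only through \<open>B\<close>, which gives the uniformity in
  \<open>n\<close> demanded by \<open>tendsto_by_approximation\<close>.\<close>

lemma char_powint_approx:
  "dist (CLINT w|M. iexp (r * (enn2real (kernel_const p) * enn2real (powint p w))))
     (CLINT w|M. iexp (r * cos_mean (U \<Otimes>\<^sub>M tail_kernel p m) field w))
   \<le> \<bar>r\<bar> * (2 * (1 / real (Suc m)) powr (q - p) / (q - p) * B)"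
proof -
  interpret F: trig_field M "U \<Otimes>\<^sub>M tail_kernel p m" field by (rule trig_field)
  let ?r = "2 * (1 / real (Suc m)) powr (q - p) / (q - p)"
  let ?x = "\<lambda>w. r * (enn2real (kernel_const p) * enn2real (powint p w))"
  let ?y = "\<lambda>w. r * cos_mean (U \<Otimes>\<^sub>M tail_kernel p m) field w"
  let ?n = "\<lambda>w. cmod (iexp (?x w) - iexp (?y w))"
  have r0: "0 \<le> ?r" using exponents by simp
  have intq: "integrable M (\<lambda>w. enn2real (powint q w))"
  proof (rule integrableI_nonneg)
    have "(\<integral>\<^sup>+w. ennreal (enn2real (powint q w)) \<partial>M) \<le> (\<integral>\<^sup>+w. powint q w \<partial>M)"
      by (intro nn_integral_mono) (metis ennreal_enn2real_if order_refl zero_le)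
    also have "\<dots> \<le> ennreal B" using moment_bound unfolding powint_def .
    finally show "(\<integral>\<^sup>+w. ennreal (enn2real (powint q w)) \<partial>M) < \<infinity>"
      by (simp add: le_less_trans)
  qed auto
  have "ennreal (LINT w|M. enn2real (powint q w)) = (\<integral>\<^sup>+w. ennreal (enn2real (powint q w)) \<partial>M)"
    by (subst nn_integral_eq_integral [OF intq]) auto
  also have "\<dots> \<le> (\<integral>\<^sup>+w. powint q w \<partial>M)"
    by (intro nn_integral_mono) (simp add: ennreal_enn2real_if)
  also have "\<dots> \<le> ennreal B" using moment_bound unfolding powint_def .
  finally have Eq: "(LINT w|M. enn2real (powint q w)) \<le> B"
    using bound_nonneg by simp
  have ix: "integrable M (\<lambda>w. iexp (?x w))" and iy: "integrable M (\<lambda>w. iexp (?y w))"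
    by (rule integrable_const_bound [where B=1]; simp)+
  have "dist (CLINT w|M. iexp (?x w)) (CLINT w|M. iexp (?y w)) = cmod (CLINT w|M. iexp (?x w) - iexp (?y w))"
    unfolding dist_norm by (subst Bochner_Integration.integral_diff [OF ix iy]) simp
  also have "\<dots> \<le> (LINT w|M. ?n w)"
    by (rule integral_norm_bound)
  also have "\<dots> \<le> (LINT w|M. \<bar>r\<bar> * (?r * enn2real (powint q w)))"
  proof (rule integral_mono_AE)
    show "integrable M (\<lambda>w. ?n w)"
      by (intro integrable_norm Bochner_Integration.integrable_diff ix iy)
    show "AE w in M. ?n w \<le> \<bar>r\<bar> * (?r * enn2real (powint q w))"
      using AE_powint_finite AE_space
    proof eventually_elim
      case (elim w)
      have "?n w \<le> \<bar>?x w - ?y w\<bar>"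
        by (rule iexp_lipschitz)
      also have "\<dots> = \<bar>r\<bar> * \<bar>enn2real (kernel_const p) * enn2real (powint p w)
          - cos_mean (U \<Otimes>\<^sub>M tail_kernel p m) field w\<bar>"
        by (simp only: right_diff_distrib [symmetric] abs_mult)
      also have "\<dots> \<le> \<bar>r\<bar> * (?r * enn2real (powint q w))"
        using elim by (intro mult_left_mono cos_mean_field_approx) auto
      finally show ?case .
    qed
  qed (use intq in simp)
  also have "\<dots> = \<bar>r\<bar> * (?r * (LINT w|M. enn2real (powint q w)))"
    by (simp only: integral_mult_right_zero)
  also have "\<dots> \<le> \<bar>r\<bar> * (?r * B)"
    using r0 Eq by (intro mult_left_mono) auto
  finally show ?thesis .
qed

end

text \<open>Truncated functionals converge for each \<open>m\<close>, and the truncation error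
  vanishes uniformly in \<open>n\<close>. Using \<open>enn2real\<close> loses nothing, since the
  power integrals are finite almost surely.\<close>

theorem weak_conv_powint:
  fixes Z :: "nat \<Rightarrow> 'u \<Rightarrow> 'a \<Rightarrow> real" and Z' :: "'u \<Rightarrow> 'b \<Rightarrow> real"
  assumes Z: "\<And>n. bounded_power_process M U (Z n) p q B" and Z': "bounded_power_process N U Z' p q B"
    and conv: "\<And>l. set l \<subseteq> UNIV \<times> space U \<Longrightarrow>
      (\<lambda>n. CLINT w|M. iexp (lin_comb (Z n) l w)) \<longlonglongrightarrow> (CLINT w|N. iexp (lin_comb Z' l w))"
  shows "weak_conv_m (\<lambda>n. distr M borel (\<lambda>w. enn2real (\<integral>\<^sup>+u. ennreal (\<bar>Z n u w\<bar> powr p) \<partial>U)))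
     (distr N borel (\<lambda>w. enn2real (\<integral>\<^sup>+u. ennreal (\<bar>Z' u w\<bar> powr p) \<partial>U)))"
proof -
  interpret Z: bounded_power_process M U "Z n" p q B for n by (rule Z)
  interpret Z': bounded_power_process N U Z' p q B by (rule Z')
  let ?k = "enn2real (kernel_const p)"
  have k: "?k \<noteq> 0"
    using kernel_const_pos [of p] kernel_const_finite [of p] Z'.exponents
    by (auto simp: enn2real_eq_0_iff)
  show ?thesis
    unfolding Z.powint_def [symmetric] Z'.powint_def [symmetric]
  proof (rule levy_continuity)
    fix t :: real
    \<comment> \<open>The approximation concerns the power integral multiplied by the kernel
      constant; the frequency is rescaled to compensate.\<close>
    let ?r = "t / ?k"
    let ?\<delta> = "\<lambda>m. \<bar>?r\<bar> * (2 * (1 / real (Suc m)) powr (q - p) / (q - p) * B)"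
    have "(\<lambda>n. CLINT w|M. iexp (?r * (?k * enn2real (Z.powint n p w)))) \<longlonglongrightarrow>
      (CLINT w|N. iexp (?r * (?k * enn2real (Z'.powint p w))))"
    proof (rule tendsto_by_approximation [OF Z.char_powint_approx Z'.char_powint_approx])
      fix m
      show "(\<lambda>n. CLINT w|M. iexp (?r * cos_mean (U \<Otimes>\<^sub>M tail_kernel p m) (Z.field n) w)) \<longlonglongrightarrow>
        (CLINT w|N. iexp (?r * cos_mean (U \<Otimes>\<^sub>M tail_kernel p m) Z'.field w))"
      proof (rule char_cos_mean_tendsto [OF Z.trig_field Z'.trig_field])
        fix l :: "(real \<times> 'u \<times> real) list"
        assume "set l \<subseteq> UNIV \<times> space (U \<Otimes>\<^sub>M tail_kernel p m)"
        then have "set (map (\<lambda>(s, u, t). (s * t, u)) l) \<subseteq> UNIV \<times> space U"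
          by (auto simp: space_pair_measure)
        from conv [OF this]
        show "(\<lambda>n. CLINT w|M. iexp (lin_comb (Z.field n) l w)) \<longlonglongrightarrow> (CLINT w|N. iexp (lin_comb Z'.field l w))"
          unfolding Z.lin_comb_field Z'.lin_comb_field .
      qed
    next
      have "(\<lambda>m. (1 / real (Suc m)) powr (q - p)) \<longlonglongrightarrow> 0"
        using Z'.exponents LIMSEQ_inverse_real_of_nat
        by (intro tendsto_zero_powrI [where b="q - p"]) (auto simp: inverse_eq_divide)
      then have "?\<delta> \<longlonglongrightarrow> \<bar>?r\<bar> * (2 * 0 / (q - p) * B)"
        using Z'.exponents by (intro tendsto_intros) auto
      then show "?\<delta> \<longlonglongrightarrow> 0" by simp
    qed
    moreover have "?r * (?k * x) = t * x" for x using k by simp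
    ultimately show "(\<lambda>n. char (distr M borel (\<lambda>w. enn2real (Z.powint n p w))) t)
      \<longlonglongrightarrow> char (distr N borel (\<lambda>w. enn2real (Z'.powint p w))) t"
      by (simp only: char_def) (subst (1 2) integral_distr; simp)
  qed auto
qed

section \<open>A Hardy-type inequality for quantile functions\<close>

lemma quantile_le_iff:
  assumes "right_continuous_mono K 0 1" "0 < u" "u < 1"
  shows "quantile K u \<le> x \<longleftrightarrow> u \<le> K x"
  unfolding quantile_def by (rule right_continuous_mono.pseudoinverse [OF assms, symmetric])

lemma less_quantile_iff:
  assumes "right_continuous_mono K 0 1" "0 < u" "u < 1"
  shows "x < quantile K u \<longleftrightarrow> K x < u"
  using quantile_le_iff [OF assms, of x] by linarith

lemma quantile_mono:
  assumes "right_continuous_mono K 0 1" "0 < u" "u \<le> v" "v < 1"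
  shows "quantile K u \<le> quantile K v"
proof -
  have "v \<le> K (quantile K v)" using assms quantile_le_iff [OF assms(1), of v "quantile K v"] by linarith
  then show ?thesis using assms quantile_le_iff [OF assms(1), of u "quantile K v"] by linarith
qed

lemma quantile_bounds:
  assumes K: "right_continuous_mono K 0 1" and u: "0 < u" "u < 1"
    and supp: "\<And>x. x < - m \<Longrightarrow> K x = 0" "\<And>x. m \<le> x \<Longrightarrow> K x = 1"
  shows "- m \<le> quantile K u" "quantile K u \<le> m"
proof -
  have "u \<le> K (quantile K u)" using quantile_le_iff [OF K u, of "quantile K u"] by simp
  then show "- m \<le> quantile K u" using supp(1) [of "quantile K u"] u by linarith
  show "quantile K u \<le> m" using quantile_le_iff [OF K u, of m] supp(2) [of m] u by simp
qed

abbreviation unit_lborel :: "real measure" where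
  "unit_lborel \<equiv> restrict_space lborel {0<..<1}"

lemma space_unit_lborel [simp]: "space unit_lborel = {0<..<1}"
  by (simp add: space_restrict_space)

lemma prob_space_unit_lborel: "prob_space unit_lborel"
  by (auto simp add: emeasure_restrict_space space_restrict_space intro!: prob_spaceI)

lemma fst_unit_lborel_measurable [measurable]: "fst \<in> borel_measurable (unit_lborel \<Otimes>\<^sub>M M)"
  by (rule measurable_compose [OF measurable_fst measurable_restrict_space1]) simp

lemma quantile_measurable:
  assumes "right_continuous_mono K 0 1"
  shows "quantile K \<in> borel_measurable unit_lborel"
proof -
  have "mono_on {0<..<1} (quantile K)"
    by (intro mono_onI quantile_mono [OF assms]) auto
  then have "quantile K \<in> borel_measurable (restrict_space borel {0<..<1})"
    by (rule borel_measurable_mono_on_fnc)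
  moreover have "sets unit_lborel = sets (restrict_space borel {0<..<1::real})"
    by (rule sets_restrict_space_cong) simp
  ultimately show ?thesis
    using measurable_cong_sets [OF _ refl] by blast
qed

text \<open>The fundamental theorem for \<open>|b - y|^q\<close>, independent of the order of
  \<open>a\<close> and \<open>b\<close>: at most one of the two intervals is nonempty.\<close>

lemma powr_le_nn_integral_between:
  fixes a b q :: real
  assumes "0 < q"
  shows "ennreal (\<bar>b - a\<bar> powr q) \<le> ennreal q * (\<integral>\<^sup>+y. ennreal (\<bar>b - y\<bar> powr (q - 1))
    * indicator ({a..<b} \<union> {b..<a}) y \<partial>lborel)"
proof -
  \<comment> \<open>The direction from \<open>b\<close> towards \<open>a\<close>; the substitution
    \<open>b + ?s * y\<close> makes \<open>y\<close> the distance from \<open>b\<close>.\<close>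
  let ?s = "if a \<le> b then - 1 else 1 :: real"
  \<comment> \<open>The half-open intervals become \<open>[0, |b - a|]\<close> only up to an
    endpoint, which depends on the direction.\<close>
  have ae: "AE x in lborel. x \<noteq> 0 \<and> x \<noteq> \<bar>b - a\<bar>"
    using AE_lborel_singleton [of 0] AE_lborel_singleton [of "\<bar>b - a\<bar>"] by eventually_elim auto
  have "(\<integral>\<^sup>+y. ennreal (\<bar>b - y\<bar> powr (q - 1)) * indicator ({a..<b} \<union> {b..<a}) y \<partial>lborel)
    = ennreal \<bar>?s\<bar> * (\<integral>\<^sup>+y. ennreal (\<bar>b - (b + ?s * y)\<bar> powr (q - 1))
        * indicator ({a..<b} \<union> {b..<a}) (b + ?s * y) \<partial>lborel)"
    by (rule nn_integral_real_affine) auto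
  also have "\<dots> = (\<integral>\<^sup>+y. ennreal (y powr (q - 1)) * indicator {0..\<bar>b - a\<bar>} y \<partial>lborel)"
    by (auto intro!: nn_integral_cong_AE eventually_mono [OF ae] split: split_indicator)
  also have "\<dots> = ennreal (\<bar>b - a\<bar> powr q / q)"
    using assms by (intro nn_integral_powr_from_0) auto
  finally show ?thesis
    using assms by (simp add: ennreal_mult [symmetric])
qed

text \<open>Either \<open>2 q y \<le> x f\<close>, and the product is at most half of
  \<open>x^q f\<close>, or \<open>x < 2 q y / f\<close>, and \<open>x\<close> can be eliminated. The
  second case is the origin of the constant \<open>q (2 q)^(q - 1)\<close>.\<close>

lemma young_absorb:
  fixes x y f q :: real
  assumes "1 < q" "0 \<le> x" "0 \<le> y" "0 < f"
  shows "q * (x powr (q - 1) * y) \<le> x powr q * f / 2 + q * (2 * q) powr (q - 1) * (y powr q / f powr (q - 1))"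
proof (cases "2 * q * y \<le> x * f")
  case True
  have "q * (x powr (q - 1) * y) = x powr (q - 1) * (2 * q * y) / 2" by simp
  also have "\<dots> \<le> x powr (q - 1) * (x * f) / 2"
    using True by (intro divide_right_mono mult_left_mono) auto
  also have "\<dots> = x powr q * f / 2"
    using powr_mult_base [of x "q - 1"] assms by (simp add: mult_ac)
  also have "\<dots> \<le> x powr q * f / 2 + q * (2 * q) powr (q - 1) * (y powr q / f powr (q - 1))"
    using assms by simp
  finally show ?thesis .
next
  case False
  then have "0 < y" using assms by (metis less_eq_real_def mult_eq_0_iff mult_nonneg_nonneg)
  have "x \<le> 2 * q * y / f" using False assms by (simp add: field_simps)
  then have "x powr (q - 1) \<le> (2 * q * y / f) powr (q - 1)"
    using assms by (intro powr_mono2) auto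
  then have "q * (x powr (q - 1) * y) \<le> q * ((2 * q * y / f) powr (q - 1) * y)"
    using assms by (intro mult_left_mono mult_right_mono) auto
  also have "\<dots> = q * (2 * q) powr (q - 1) * (y powr q / f powr (q - 1))"
  proof -
    have "y powr (q - 1) * y = y powr q" using powr_mult_base [of y "q - 1"] assms by (simp add: mult_ac)
    then show ?thesis using assms by (simp add: powr_mult powr_divide)
  qed
  also have "\<dots> \<le> x powr q * f / 2 + q * (2 * q) powr (q - 1) * (y powr q / f powr (q - 1))"
    using assms by simp
  finally show ?thesis .
qed

lemma ennreal_absorb_half:
  fixes A X :: ennreal
  assumes "A < \<infinity>" "A \<le> ennreal (1 / 2) * A + X"
  shows "A \<le> 2 * X"
proof (cases "X = \<infinity>")
  case False
  with assms obtain a x where "A = ennreal a" "X = ennreal x" "0 \<le> a" "0 \<le> x"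
    by (metis ennreal_cases less_top infinity_ennreal_def neq_iff)
  moreover from this have "ennreal (1 / 2) * A + X = ennreal (1 / 2 * a + x)"
    by (simp only: ennreal_mult ennreal_plus)
  ultimately have "ennreal a \<le> ennreal (1 / 2 * a + x)"
    using assms by (simp only:)
  then have "a \<le> 1 / 2 * a + x"
    by (rule ennreal_le_iff [THEN iffD1, rotated]) (use \<open>0 \<le> a\<close> \<open>0 \<le> x\<close> in simp)
  then have "a \<le> 2 * x" by simp
  then have "ennreal a \<le> ennreal (2 * x)" by (rule ennreal_leI)
  then show ?thesis using \<open>0 \<le> x\<close> by (simp add: \<open>A = _\<close> \<open>X = _\<close> ennreal_mult)
qed (simp add: ennreal_mult_eq_top_iff)

lemma ennreal_lin_comb:
  assumes "0 \<le> h" "0 \<le> c" "0 \<le> a" "0 \<le> d" "0 \<le> b"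
  shows "ennreal (h * (c * a) + d * b) = ennreal h * (ennreal c * ennreal a) + ennreal d * ennreal b"
  using assms by (simp add: ennreal_mult ennreal_plus)

section \<open>Quantile transform and Hardy inequality for a law with positive continuous
  density\<close>

locale density_cdf = real_distribution \<mu> for \<mu> :: "real measure" +
  fixes f :: "real \<Rightarrow> real"
  assumes deriv_cdf: "\<And>x. (cdf \<mu> has_real_derivative f x) (at x)"
    and density_pos: "\<And>x. 0 < f x"
    and density_continuous: "continuous_on UNIV f"
begin

sublocale cdf_distribution \<mu> ..

abbreviation F :: "real \<Rightarrow> real" where "F \<equiv> cdf \<mu>"
abbreviation Q :: "real \<Rightarrow> real" where "Q \<equiv> quantile F"

lemma cdf_right_continuous_mono: "right_continuous_mono F 0 1" ..

lemma F_continuous: "isCont F x"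
  using deriv_cdf by (rule DERIV_isCont)

lemma F_less: "x < y \<Longrightarrow> F x < F y"
  by (rule DERIV_pos_imp_increasing) (use deriv_cdf density_pos in blast)+

lemma F_less_iff: "F x < F y \<longleftrightarrow> x < y"
  by (intro strict_mono_less strict_monoI F_less)

lemma F_bounds: "0 < F x" "F x < 1"
  using F_less [of "x - 1" x] F_less [of x "x + 1"] cdf_nonneg [of "x - 1"] cdf_bounded_prob [of "x + 1"]
  by linarith+

lemma Q_le_iff: "0 < u \<Longrightarrow> u < 1 \<Longrightarrow> Q u \<le> x \<longleftrightarrow> u \<le> F x"
  by (rule quantile_le_iff [OF cdf_right_continuous_mono])

lemma Q_F [simp]: "Q (F x) = x"
proof (rule antisym)
  show "Q (F x) \<le> x" using Q_le_iff [of "F x" x] F_bounds [of x] by simp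
  have "F x \<le> F (Q (F x))" using Q_le_iff [of "F x" "Q (F x)"] F_bounds [of x] by simp
  then show "x \<le> Q (F x)" using F_less_iff by (meson not_less)
qed

lemma F_Q: "0 < u \<Longrightarrow> u < 1 \<Longrightarrow> F (Q u) = u"
proof (rule antisym)
  assume u: "0 < u" "u < 1"
  then show "u \<le> F (Q u)" using Q_le_iff [of u "Q u"] by simp
  show "F (Q u) \<le> u"
  \<comment> \<open>To the left of \<open>Q u\<close> the distribution function stays below
    \<open>u\<close>; continuity carries this bound to \<open>Q u\<close> itself.\<close>
  proof (rule tendsto_upperbound [where F="at_left (Q u)"])
    show "(F \<longlongrightarrow> F (Q u)) (at_left (Q u))"
      using F_continuous [of "Q u"] unfolding isCont_def by (rule tendsto_within_subset) simp
    show "\<forall>\<^sub>F x in at_left (Q u). F x \<le> u"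
    proof -
      have "F x \<le> u" if "x < Q u" for x using Q_le_iff [OF u, of x] that by linarith
      then show ?thesis by (simp add: eventually_at_filter)
    qed
  qed simp
qed

lemma F_measurable [measurable]: "F \<in> borel_measurable borel"
  by (rule measurable_C)

lemma f_measurable [measurable]: "f \<in> borel_measurable borel"
  using density_continuous by (rule borel_measurable_continuous_onI)

lemma F_measurable_unit [measurable]: "F \<in> borel \<rightarrow>\<^sub>M unit_lborel"
  using F_bounds by (intro measurable_restrict_space2) auto

lemma Q_measurable [measurable]: "Q \<in> borel_measurable unit_lborel"
  by (rule quantile_measurable [OF cdf_right_continuous_mono])

lemma distr_Q: "distr unit_lborel borel Q = \<mu>"
  using distr_I_eq_M unfolding quantile_def .

lemma eq_density: "\<mu> = density lborel (\<lambda>x. ennreal (f x))"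
proof (rule measure_eqI_generator_eq)
  let ?E = "range (\<lambda>(a, b). {a<..b}) :: real set set"
  show "Int_stable ?E" by (auto simp: Int_stable_def)
  show "?E \<subseteq> Pow UNIV" by simp
  show "sets \<mu> = sigma_sets UNIV ?E" "sets (density lborel (\<lambda>x. ennreal (f x))) = sigma_sets UNIV ?E"
    by (simp_all add: borel_sigma_sets_Ioc)
  show "range (\<lambda>i::nat. {- real i<..real i}) \<subseteq> ?E" by auto
  show "(\<Union>i::nat. {- real i<..real i}) = UNIV" by (rule UN_Ioc_eq_UNIV)
  show "emeasure \<mu> {- real i<..real i} \<noteq> \<infinity>" for i by simp
  show "emeasure \<mu> X = emeasure (density lborel (\<lambda>x. ennreal (f x))) X" if XE: "X \<in> ?E" for X
  proof -
    obtain a b where X: "X = {a<..b}" using XE by auto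
    show ?thesis
    proof (cases "a \<le> b")
      case True
      have ae: "AE x in lborel. x \<noteq> a" by (rule AE_lborel_singleton)
      have "emeasure (density lborel (\<lambda>x. ennreal (f x))) X = (\<integral>\<^sup>+x. ennreal (f x) * indicator {a<..b} x \<partial>lborel)"
        by (simp add: X emeasure_density)
      also have "\<dots> = (\<integral>\<^sup>+x. ennreal (f x) * indicator {a..b} x \<partial>lborel)"
        by (intro nn_integral_cong_AE eventually_mono [OF ae]) (auto split: split_indicator)
      also have "\<dots> = ennreal (F b - F a)"
        using True deriv_cdf density_pos by (intro nn_integral_FTC_Icc) (auto intro: less_imp_le)
      also have "\<dots> = emeasure \<mu> X"
        using emeasure_Ioc [OF True] by (simp add: X)
      finally show ?thesis ..
    qed (simp add: X)
  qed
qed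

text \<open>The substitution \<open>u = F x\<close>, obtained from the fact that \<open>Q\<close>
  maps the uniform law to \<open>\<mu>\<close> and that \<open>\<mu>\<close> has density
  \<open>f\<close>.\<close>

lemma nn_integral_unit_eq:
  assumes [measurable]: "g \<in> borel_measurable unit_lborel"
  shows "(\<integral>\<^sup>+u. g u \<partial>unit_lborel) = (\<integral>\<^sup>+x. ennreal (f x) * g (F x) \<partial>lborel)"
proof -
  have "(\<integral>\<^sup>+u. g u \<partial>unit_lborel) = (\<integral>\<^sup>+u. g (F (Q u)) \<partial>unit_lborel)"
    by (intro nn_integral_cong) (auto simp: F_Q)
  also have "\<dots> = (\<integral>\<^sup>+x. g (F x) \<partial>distr unit_lborel borel Q)"
    by (subst nn_integral_distr) auto
  also have "\<dots> = (\<integral>\<^sup>+x. ennreal (f x) * g (F x) \<partial>lborel)"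
    unfolding distr_Q by (subst eq_density, subst nn_integral_density) auto
  finally show ?thesis .
qed

text \<open>With \<open>T = quantile K\<close>, write \<open>\<bar>T u - Q u\<bar>\<^sup>q\<close> as \<open>q\<close> times the integral of \<open>\<bar>T u - y\<bar>\<^sup>q\<^sup>-\<^sup>1\<close> over the \<open>y\<close>
  between \<open>Q u\<close> and \<open>T u\<close>. There \<open>\<bar>T u - y\<bar> \<le> \<bar>T (F y) - y\<bar>\<close> by monotonicity, and for fixed \<open>y\<close> the
  admissible \<open>u\<close> form a set of measure \<open>\<bar>K y - F y\<bar>\<close>. Young's inequality bounds the result by half
  of the left-hand side plus the claimed integral; clamping \<open>Q\<close> to \<open>[-R, R]\<close> makes the left-hand side
  finite, so that it can be absorbed.\<close>

lemma quantile_distance_le_clamped: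
  fixes K :: "real \<Rightarrow> real" and q m R :: real
  assumes K: "right_continuous_mono K 0 1"
    and supp: "\<And>x. x < - m \<Longrightarrow> K x = 0" "\<And>x. m \<le> x \<Longrightarrow> K x = 1"
    and q: "1 < q" and R: "m \<le> R" "0 \<le> R"
  shows "(\<integral>\<^sup>+u. ennreal (\<bar>quantile K u - max (- R) (min R (Q u))\<bar> powr q) \<partial>unit_lborel) \<le>
    2 * (ennreal (q * (2 * q) powr (q - 1)) * (\<integral>\<^sup>+x. ennreal (\<bar>K x - F x\<bar> powr q / f x powr (q - 1)) \<partial>lborel))"
    (is "?A \<le> 2 * (ennreal ?C * ?J)")
proof (rule ennreal_absorb_half)
  have [measurable]: "K \<in> borel_measurable borel"
    by (rule borel_measurable_mono [OF right_continuous_mono.mono [OF K]])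
  note [measurable] = quantile_measurable [OF K]
  interpret unit: prob_space unit_lborel by (rule prob_space_unit_lborel)
  interpret P: pair_sigma_finite unit_lborel lborel ..
  let ?T = "quantile K" and ?QR = "\<lambda>u. max (- R) (min R (Q u))"
  let ?D = "\<lambda>y. ennreal (\<bar>?T (F y) - y\<bar> powr (q - 1)) * indicator {- R..<R} y"
  let ?S = "\<lambda>y. {K y<..F y} \<union> {F y<..K y}"
  let ?e = "\<lambda>y. ennreal (\<bar>K y - F y\<bar> powr q / f y powr (q - 1))"
  let ?t = "\<lambda>y. ennreal (\<bar>?T (F y) - y\<bar> powr q)"
  let ?d = "\<lambda>u. ennreal (\<bar>?T u - ?QR u\<bar> powr q)"
  have [measurable]: "Measurable.pred (unit_lborel \<Otimes>\<^sub>M lborel) (\<lambda>x. fst x \<in> ?S (snd x))"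
    unfolding Un_iff greaterThanAtMost_iff by measurable
  have T: "- R \<le> ?T u" "?T u \<le> R" if "u \<in> {0<..<1}" for u
    using quantile_bounds [OF K _ _ supp, of u] that R by auto
  have "?A \<le> (\<integral>\<^sup>+u. ennreal ((2 * R) powr q) \<partial>unit_lborel)"
  proof (rule nn_integral_mono)
    fix u assume "u \<in> space unit_lborel"
    then have "\<bar>?T u - ?QR u\<bar> \<le> 2 * R" using T [of u] R by auto
    then show "?d u \<le> ennreal ((2 * R) powr q)"
      using q by (intro ennreal_leI powr_mono2) auto
  qed
  also have "\<dots> < \<infinity>" using unit.emeasure_space_1 by simp
  finally show "?A < \<infinity>" .
  have "?A \<le> (\<integral>\<^sup>+u. ennreal q * (\<integral>\<^sup>+y. ?D y * indicator (?S y) u \<partial>lborel) \<partial>unit_lborel)"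
  proof (rule nn_integral_mono)
    fix u assume "u \<in> space unit_lborel"
    then have u: "0 < u" "u < 1" by auto
    have "?d u \<le> ennreal q * (\<integral>\<^sup>+y. ennreal (\<bar>?T u - y\<bar> powr (q - 1))
        * indicator ({?QR u..<?T u} \<union> {?T u..<?QR u}) y \<partial>lborel)"
      using q by (intro powr_le_nn_integral_between) auto
    also have "\<dots> \<le> ennreal q * (\<integral>\<^sup>+y. ?D y * indicator (?S y) u \<partial>lborel)"
    proof (intro mult_left_mono nn_integral_mono)
      fix y
      show "ennreal (\<bar>?T u - y\<bar> powr (q - 1)) * indicator ({?QR u..<?T u} \<union> {?T u..<?QR u}) y
        \<le> ?D y * indicator (?S y) u"
      proof (cases "y \<in> {?QR u..<?T u} \<union> {?T u..<?QR u}")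
        case True
        have Tu: "- R \<le> ?T u" "?T u \<le> R" using T u by auto
        consider "?QR u \<le> y" "y < ?T u" | "?T u \<le> y" "y < ?QR u" using True by auto
        then have "y \<in> {- R..<R} \<and> u \<in> ?S y \<and> \<bar>?T u - y\<bar> \<le> \<bar>?T (F y) - y\<bar>"
        proof cases
          case 1
          then have "Q u \<le> y" using Tu by (auto simp: max_def min_def split: if_splits)
          then have "u \<le> F y" using Q_le_iff u by simp
          moreover have "K y < u" using 1 less_quantile_iff [OF K u] by simp
          moreover have "?T u \<le> ?T (F y)" using quantile_mono [OF K, of u "F y"] u \<open>u \<le> F y\<close> F_bounds by simp
          ultimately show ?thesis using 1 Tu by auto
        next
          case 2
          then have "y < Q u" using Tu by (auto simp: max_def min_def split: if_splits)
          then have "F y < u" using Q_le_iff [OF u, of y] by simp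
          moreover have "u \<le> K y" using 2 quantile_le_iff [OF K u] by simp
          moreover have "?T (F y) \<le> ?T u" using quantile_mono [OF K, of "F y" u] u \<open>F y < u\<close> F_bounds by simp
          ultimately show ?thesis using 2 Tu by auto
        qed
        then show ?thesis
          using q by (auto simp: indicator_def intro!: ennreal_leI powr_mono2)
      qed simp
    qed simp
    finally show "?d u \<le> ennreal q * (\<integral>\<^sup>+y. ?D y * indicator (?S y) u \<partial>lborel)" .
  qed
  also have "\<dots> = ennreal q * (\<integral>\<^sup>+u. \<integral>\<^sup>+y. ?D y * indicator (?S y) u \<partial>lborel \<partial>unit_lborel)"
    by (rule nn_integral_cmult) measurable
  also have "(\<integral>\<^sup>+u. \<integral>\<^sup>+y. ?D y * indicator (?S y) u \<partial>lborel \<partial>unit_lborel)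
      = (\<integral>\<^sup>+y. \<integral>\<^sup>+u. ?D y * indicator (?S y) u \<partial>unit_lborel \<partial>lborel)"
    by (rule P.Fubini' [symmetric]) measurable
  also have "\<dots> \<le> (\<integral>\<^sup>+y. ?D y * ennreal \<bar>K y - F y\<bar> \<partial>lborel)"
  proof (rule nn_integral_mono)
    fix y
    have "(\<integral>\<^sup>+u. ?D y * indicator (?S y) u \<partial>unit_lborel) = ?D y * (\<integral>\<^sup>+u. indicator (?S y) u \<partial>unit_lborel)"
      by (rule nn_integral_cmult, rule measurable_restrict_space1) simp
    also have "(\<integral>\<^sup>+u. indicator (?S y) u \<partial>unit_lborel) \<le> (\<integral>\<^sup>+u. indicator (?S y) u \<partial>lborel)"
      by (subst nn_integral_restrict_space, simp, rule nn_integral_mono) (auto split: split_indicator)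
    also have "\<dots> = emeasure lborel (?S y)" by (rule nn_integral_indicator) simp
    also have "\<dots> = ennreal \<bar>K y - F y\<bar>"
      by (cases "K y \<le> F y") auto
    finally show "(\<integral>\<^sup>+u. ?D y * indicator (?S y) u \<partial>unit_lborel) \<le> ?D y * ennreal \<bar>K y - F y\<bar>"
      by (simp add: mult_left_mono)
  qed
  also have "ennreal q * \<dots> = (\<integral>\<^sup>+y. ennreal q * (?D y * ennreal \<bar>K y - F y\<bar>) \<partial>lborel)"
    by (rule nn_integral_cmult [symmetric]) measurable
  also have "\<dots> \<le> (\<integral>\<^sup>+y. ennreal (1 / 2) * (ennreal (f y) * (?t y * indicator {- R..<R} y))
      + ennreal ?C * ?e y \<partial>lborel)"
  proof (rule nn_integral_mono)
    fix y
    have "q * (\<bar>?T (F y) - y\<bar> powr (q - 1) * \<bar>K y - F y\<bar>) \<le> \<bar>?T (F y) - y\<bar> powr q * f y / 2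
        + ?C * (\<bar>K y - F y\<bar> powr q / f y powr (q - 1))"
      using q density_pos by (intro young_absorb) auto
    then have "ennreal (q * (\<bar>?T (F y) - y\<bar> powr (q - 1) * \<bar>K y - F y\<bar>)) \<le> ennreal (1 / 2 * (f y * \<bar>?T (F y) - y\<bar> powr q)
        + ?C * (\<bar>K y - F y\<bar> powr q / f y powr (q - 1)))"
      by (intro ennreal_leI) (simp add: mult_ac)
    also have "\<dots> = ennreal (1 / 2) * (ennreal (f y) * ?t y)
      + ennreal ?C * ?e y"
      using q density_pos [of y] by (intro ennreal_lin_comb) auto
    finally have le: "ennreal q * (ennreal (\<bar>?T (F y) - y\<bar> powr (q - 1)) * ennreal \<bar>K y - F y\<bar>)
      \<le> ennreal (1 / 2) * (ennreal (f y) * ?t y)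
      + ennreal ?C * ?e y"
      using q by (simp only: ennreal_mult' [symmetric] ennreal_mult'' [symmetric] powr_ge_zero abs_ge_zero)
    show "ennreal q * (?D y * ennreal \<bar>K y - F y\<bar>) \<le>
      ennreal (1 / 2) * (ennreal (f y) * (?t y * indicator {- R..<R} y))
      + ennreal ?C * ?e y"
    proof (cases "y \<in> {- R..<R}")
      case True
      then have ind: "indicator {- R..<R} y = (1 :: ennreal)" by (rule indicator_simps)
      show ?thesis unfolding ind mult_1_right by (rule le)
    qed simp
  qed
  also have "\<dots> = ennreal (1 / 2) * (\<integral>\<^sup>+y. ennreal (f y) * (?t y * indicator {- R..<R} y) \<partial>lborel)
      + ennreal ?C * ?J"
    by (simp add: nn_integral_add nn_integral_cmult)
  \<comment> \<open>Writing \<open>y\<close> as \<open>Q (F y)\<close> exhibits the integrand as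
    \<open>f\<close> times a function of \<open>F y\<close>, so that the substitution
    \<open>u = F y\<close> leads back to an integral over \<open>u\<close>.\<close>
  also have "(\<integral>\<^sup>+y. ennreal (f y) * (?t y * indicator {- R..<R} y) \<partial>lborel)
     = (\<integral>\<^sup>+y. ennreal (f y) * (ennreal (\<bar>?T (F y) - Q (F y)\<bar> powr q) * indicator {- R..<R} (Q (F y))) \<partial>lborel)"
    by simp
  also have "\<dots> = (\<integral>\<^sup>+u. ennreal (\<bar>?T u - Q u\<bar> powr q) * indicator {- R..<R} (Q u) \<partial>unit_lborel)"
    by (rule nn_integral_unit_eq [symmetric]) measurable
  \<comment> \<open>Where the indicator is 1 the clamping is inactive, so this is part of the
    original left-hand side.\<close>
  also have "\<dots> \<le> ?A"
    by (intro nn_integral_mono) (auto simp: indicator_def)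
  finally show "?A \<le> ennreal (1 / 2) * ?A + ennreal ?C * ?J"
    by (simp add: add_right_mono mult_left_mono)
qed

text \<open>The clamped bound does not depend on the clamping level, so Fatou's lemma removes the
  level.\<close>

proposition quantile_distance_le:
  fixes K :: "real \<Rightarrow> real" and q m :: real
  assumes K: "right_continuous_mono K 0 1"
    and supp: "\<And>x. x < - m \<Longrightarrow> K x = 0" "\<And>x. m \<le> x \<Longrightarrow> K x = 1"
    and q: "1 < q"
  shows "(\<integral>\<^sup>+u. ennreal (\<bar>quantile K u - Q u\<bar> powr q) \<partial>unit_lborel) \<le>
    2 * (ennreal (q * (2 * q) powr (q - 1)) * (\<integral>\<^sup>+x. ennreal (\<bar>K x - F x\<bar> powr q / f x powr (q - 1)) \<partial>lborel))"
    (is "_ \<le> ?B")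
proof -
  let ?d = "\<lambda>u. ennreal (\<bar>quantile K u - Q u\<bar> powr q)"
  note [measurable] = quantile_measurable [OF K]
  \<comment> \<open>The level \<open>|m| + i\<close> is nonnegative and at least \<open>m\<close>,
    as the clamped inequality requires.\<close>
  let ?g = "\<lambda>(i::nat) u. ennreal (\<bar>quantile K u - max (- (\<bar>m\<bar> + real i)) (min (\<bar>m\<bar> + real i) (Q u))\<bar> powr q)"
  have "(\<integral>\<^sup>+u. ?d u \<partial>unit_lborel) = (\<integral>\<^sup>+u. liminf (\<lambda>i. ?g i u) \<partial>unit_lborel)"
  proof (rule nn_integral_cong)
    fix u
    have "\<forall>\<^sub>F i in sequentially. \<bar>Q u\<bar> \<le> real i"
      by (meson eventually_at_top_linorder nat_ceiling_le_eq)
    then have "\<forall>\<^sub>F i in sequentially. ?g i u = ?d u"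
    proof eventually_elim
      case (elim i)
      then have "max (- (\<bar>m\<bar> + real i)) (min (\<bar>m\<bar> + real i) (Q u)) = Q u" by (auto simp: max_def min_def)
      then show ?case by simp
    qed
    then have "(\<lambda>i. ?g i u) \<longlonglongrightarrow> ?d u"
      by (rule tendsto_eventually)
    then show "?d u = liminf (\<lambda>i. ?g i u)"
      by (rule lim_imp_Liminf [OF trivial_limit_sequentially, symmetric])
  qed
  also have "\<dots> \<le> liminf (\<lambda>i. \<integral>\<^sup>+u. ?g i u \<partial>unit_lborel)"
    by (rule nn_integral_liminf) measurable
  also have "\<dots> \<le> limsup (\<lambda>i. \<integral>\<^sup>+u. ?g i u \<partial>unit_lborel)"
    by (rule Liminf_le_Limsup) simp
  also have "\<dots> \<le> ?B"
    by (intro Limsup_bounded always_eventually allI quantile_distance_le_clamped [OF K supp q]) auto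
  finally show ?thesis .
qed

end

section \<open>Tails\<close>

text \<open>For \<open>\<gamma> > 0\<close> the derivative is
  \<open>(\<gamma> + \<epsilon> y) * \<psi> y / y\<close>, whose numerator is eventually at least 1
  since \<open>\<psi>\<close> tends to infinity. For \<open>\<gamma> = 0\<close> the bound is the
  condition on \<open>L'\<close> with \<open>l1 \<ge> 1\<close>.\<close>

lemma regularly_varying_deriv_ge:
  assumes rv: "regularly_varying \<psi>" and lim: "filterlim \<psi> at_top at_top"
  shows "\<forall>\<^sub>F y in at_top. 1 / y \<le> deriv \<psi> y"
proof -
  obtain \<gamma> y0 L \<epsilon> where y0: "0 < y0" and \<gamma>: "0 \<le> \<gamma>"
    and \<psi>: "\<And>y. y0 < y \<Longrightarrow> \<psi> y = y powr \<gamma> * L y"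
    and L: "\<And>y. y0 < y \<Longrightarrow> (L has_real_derivative \<epsilon> y * L y / y) (at y)"
    and \<epsilon>: "(\<epsilon> \<longlongrightarrow> 0) at_top"
    and slow: "\<gamma> = 0 \<Longrightarrow> \<exists>l1\<ge>1. \<forall>y>y0. l1 / y \<le> deriv L y"
    using rv unfolding regularly_varying_def by metis
  have ev: "\<forall>\<^sub>F z in nhds y. \<psi> z = z powr \<gamma> * L z" if "y0 < y" for y
    using eventually_nhds_in_open [of "{y0<..}" y] that by (auto elim!: eventually_mono intro: \<psi>)
  have large: "\<forall>\<^sub>F y in at_top. y0 < y" by (rule eventually_gt_at_top)
  show ?thesis
  proof (cases "\<gamma> = 0")
    case True
    then obtain l1 where l1: "1 \<le> l1" "\<And>y. y0 < y \<Longrightarrow> l1 / y \<le> deriv L y" using slow by blast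
    from large show ?thesis
    proof eventually_elim
      case (elim y)
      have "\<forall>\<^sub>F z in nhds y. z powr \<gamma> * L z = L z"
      proof -
        have "\<forall>\<^sub>F z in nhds y. z \<in> {y0<..}" using elim by (intro eventually_nhds_in_open) auto
        then show ?thesis by eventually_elim (use y0 True in auto)
      qed
      with ev [OF elim] have "\<forall>\<^sub>F z in nhds y. \<psi> z = L z"
        by eventually_elim simp
      then have "deriv \<psi> y = deriv L y" by (rule deriv_cong_ev) simp
      moreover have "1 / y \<le> l1 / y" using l1 elim y0 by (intro divide_right_mono) auto
      ultimately show ?case using l1(2) [OF elim] by linarith
    qed
  next
    case False
    with \<gamma> have pos: "0 < \<gamma>" by simp
    have "\<forall>\<^sub>F y in at_top. - (\<gamma> / 2) < \<epsilon> y"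
      using pos by (intro order_tendstoD(1) [OF \<epsilon>]) auto
    \<comment> \<open>The threshold is the reciprocal of the lower bound \<open>\<gamma> / 2\<close>
      for \<open>\<gamma> + \<epsilon> y\<close>.\<close>
    moreover have "\<forall>\<^sub>F y in at_top. 2 / \<gamma> \<le> \<psi> y"
      using lim by (simp add: filterlim_at_top)
    ultimately show ?thesis using large
    proof eventually_elim
      case (elim y)
      have "((\<lambda>z. z powr \<gamma> * L z) has_real_derivative (\<gamma> + \<epsilon> y) * \<psi> y / y) (at y)"
        using elim y0 by (auto intro!: derivative_eq_intros L simp: \<psi> powr_diff field_simps)
      then have "(\<psi> has_real_derivative (\<gamma> + \<epsilon> y) * \<psi> y / y) (at y)"
        using DERIV_cong_ev [OF refl ev refl] elim by blast
      then have "deriv \<psi> y = (\<gamma> + \<epsilon> y) * \<psi> y / y" by (rule DERIV_imp_deriv)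
      moreover have "\<gamma> / 2 * (2 / \<gamma>) \<le> (\<gamma> + \<epsilon> y) * \<psi> y"
        using elim pos by (intro mult_mono) auto
      ultimately show ?case using pos elim y0 by (simp add: divide_right_mono)
    qed
  qed
qed

text \<open>Replacing \<open>g\<close> by its lower bound \<open>S x / x\<close> leaves
  \<open>S^(1 - q/2) * x^(q - 1)\<close>. The decay of \<open>S\<close> makes this
  \<open>O(x^(-1-c))\<close>, where \<open>c = a (1 - q/2) - q\<close> is positive by
  assumption.\<close>

lemma nn_integral_tail_finite:
  fixes S g :: "real \<Rightarrow> real" and a q x0 C :: real
  assumes x0: "1 \<le> x0" and q: "1 < q" "q < 2" and a: "q < a * (1 - q / 2)" and C: "0 < C"
    and S: "\<And>x. x0 \<le> x \<Longrightarrow> 0 < S x" "\<And>x. x0 \<le> x \<Longrightarrow> S x \<le> g x * x" "\<And>x. x0 \<le> x \<Longrightarrow> S x \<le> C * x powr (- a)"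
  shows "(\<integral>\<^sup>+x. ennreal (S x powr (q / 2) / g x powr (q - 1)) * indicator {x0..} x \<partial>lborel) < \<infinity>"
proof -
  let ?s = "\<lambda>x. ennreal (S x powr (q / 2) / g x powr (q - 1)) * indicator {x0..} x"
  let ?c = "a * (1 - q / 2) - q"
  have "(\<integral>\<^sup>+x. ?s x \<partial>lborel)
    \<le> (\<integral>\<^sup>+x. ennreal (C powr (1 - q / 2)) * (ennreal (x powr (- 1 - ?c)) * indicator {x0..} x) \<partial>lborel)"
  proof (rule nn_integral_mono)
    fix x
    show "?s x
      \<le> ennreal (C powr (1 - q / 2)) * (ennreal (x powr (- 1 - ?c)) * indicator {x0..} x)"
    proof (cases "x0 \<le> x")
      case True
      have x: "0 < x" using True x0 by simp
      have "S x / x \<le> g x" using S(2) [OF True] x by (simp add: field_simps)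
      moreover from this have "0 < g x" using S(1) [OF True] x by (metis divide_pos_pos less_le_trans)
      ultimately have "S x powr (q / 2) / g x powr (q - 1) \<le> S x powr (q / 2) / (S x / x) powr (q - 1)"
        using S(1) [OF True] x q by (intro divide_left_mono powr_mono2 mult_pos_pos) auto
      also have "\<dots> = S x powr (q / 2) / S x powr (q - 1) * x powr (q - 1)"
        using S(1) [OF True] x by (simp add: powr_divide)
      also have "S x powr (q / 2) / S x powr (q - 1) = S x powr (1 - q / 2)"
        by (simp add: powr_diff [symmetric])
      also have "S x powr (1 - q / 2) * x powr (q - 1) \<le> (C * x powr (- a)) powr (1 - q / 2) * x powr (q - 1)"
        using S [OF True] q by (intro mult_right_mono powr_mono2) auto
      also have "\<dots> = C powr (1 - q / 2) * (x powr (- a * (1 - q / 2)) * x powr (q - 1))"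
        using C by (simp add: powr_mult powr_powr)
      also have "x powr (- a * (1 - q / 2)) * x powr (q - 1) = x powr (- 1 - ?c)"
        by (simp add: powr_add [symmetric] algebra_simps)
      finally show ?thesis
        using True by (simp add: ennreal_mult [symmetric] ennreal_leI)
    qed simp
  qed
  also have "\<dots> = ennreal (C powr (1 - q / 2)) * ennreal (x0 powr (- ?c) / ?c)"
    using a x0 by (simp add: nn_integral_cmult nn_integral_powr_to_inf)
  also have "\<dots> < \<infinity>" by (simp add: ennreal_mult_less_top)
  finally show ?thesis .
qed

context density_cdf
begin

text \<open>After \<open>u = F x\<close> this is the integral of
  \<open>(sqrt (u (1 - u)) / f (Q u))^q\<close>, the \<open>q\<close>-th power of the standard
  deviation of a Brownian bridge divided by \<open>f (Q u)\<close>. It bounds the moments before and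
  after the limit.\<close>

definition J_integral :: "real \<Rightarrow> ennreal" where
  "J_integral q = (\<integral>\<^sup>+x. ennreal ((F x * (1 - F x)) powr (q / 2) / f x powr (q - 1)) \<partial>lborel)"

text \<open>On a compact interval the integrand is continuous; outside it one factor of
  \<open>F (1 - F)\<close> is replaced by 1 and \<open>nn_integral_tail_finite\<close> applies, on
  the left after reflection.\<close>

lemma J_integral_finite:
  assumes q: "1 < q" "q < 2" and a: "q < a * (1 - q / 2)" and b: "0 < b"
    and right: "\<forall>\<^sub>F x in at_top. 1 - F x \<le> f x * x"
    and left: "\<forall>\<^sub>F x in at_top. F (- x) \<le> f (- x) * x"
    and tail: "\<forall>\<^sub>F x in at_infinity. F x * (1 - F x) \<le> b * \<bar>x\<bar> powr (- a)"
  shows "J_integral q < \<infinity>"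
proof -
  let ?r = "\<lambda>x. ennreal ((1 - F x) powr (q / 2) / f x powr (q - 1))"
  let ?l = "\<lambda>x. ennreal (F x powr (q / 2) / f x powr (q - 1))"
  let ?h = "\<lambda>x. (F x * (1 - F x)) powr (q / 2) / f x powr (q - 1)"
  have mid: "\<forall>\<^sub>F x in at_top. 1 / 2 < F x"
    by (rule order_tendstoD(1) [OF cdf_lim_at_top_prob]) simp
  have mid': "\<forall>\<^sub>F x in at_top. F (- x) < 1 / 2"
    using order_tendstoD(2) [OF cdf_lim_at_bot, of "1 / 2"]
    by (simp add: eventually_at_bot_linorder at_top_mirror eventually_filtermap)
  have t1: "\<forall>\<^sub>F x in at_top. F x * (1 - F x) \<le> b * \<bar>x\<bar> powr (- a)"
    using tail at_top_le_at_infinity by (rule filter_leD [rotated])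
  have t2: "\<forall>\<^sub>F x in at_top. F (- x) * (1 - F (- x)) \<le> b * \<bar>- x\<bar> powr (- a)"
  proof -
    have "\<forall>\<^sub>F x in at_bot. F x * (1 - F x) \<le> b * \<bar>x\<bar> powr (- a)"
      using tail at_bot_le_at_infinity by (rule filter_leD [rotated])
    then show ?thesis
      by (simp add: at_bot_mirror eventually_filtermap)
  qed
  obtain x0 where x0: "1 \<le> x0" and all: "\<And>x. x0 \<le> x \<Longrightarrow> 1 - F x \<le> f x * x \<and> F (- x) \<le> f (- x) * x \<and> 1 / 2 < F x
     \<and> F (- x) < 1 / 2 \<and> F x * (1 - F x) \<le> b * \<bar>x\<bar> powr (- a) \<and> F (- x) * (1 - F (- x)) \<le> b * \<bar>- x\<bar> powr (- a)"
  proof -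
    have "\<forall>\<^sub>F x in at_top. 1 \<le> x \<and> 1 - F x \<le> f x * x \<and> F (- x) \<le> f (- x) * x \<and> 1 / 2 < F x
     \<and> F (- x) < 1 / 2 \<and> F x * (1 - F x) \<le> b * \<bar>x\<bar> powr (- a) \<and> F (- x) * (1 - F (- x)) \<le> b * \<bar>- x\<bar> powr (- a)"
      using eventually_ge_at_top [of 1] right left mid mid' t1 t2 by eventually_elim blast
    then show thesis using that unfolding eventually_at_top_linorder by blast
  qed
  \<comment> \<open>One factor of \<open>F (1 - F)\<close> exceeds 1/2, so the bound on the product
    passes to the other factor at the cost of 2.\<close>
  have le: "s \<le> 2 * b * x powr (- a)" if "r * s \<le> b * \<bar>x\<bar> powr (- a)" "1 / 2 < r" "x0 \<le> x" "0 < s" for r s x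
  proof -
    have "1 / 2 * s \<le> r * s" using that by (intro mult_right_mono) auto
    also have "\<dots> \<le> b * x powr (- a)" using that x0 by simp
    finally show ?thesis by simp
  qed
  have R: "(\<integral>\<^sup>+x. ?r x * indicator {x0..} x \<partial>lborel) < \<infinity>"
  proof (rule nn_integral_tail_finite [OF x0 q a, where C="2 * b"])
    show "1 - F x \<le> 2 * b * x powr (- a)" if "x0 \<le> x" for x
      using all [OF that] F_bounds [of x] by (intro le [of "F x"] that) auto
  qed (use all b F_bounds in auto)
  have "(\<integral>\<^sup>+x. ?l x * indicator {..- x0} x \<partial>lborel)
    = (\<integral>\<^sup>+x. ennreal (F (- x) powr (q / 2) / f (- x) powr (q - 1)) * indicator {x0..} x \<partial>lborel)"
    by (subst nn_integral_real_affine [where c="- 1" and t=0])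
       (auto intro!: nn_integral_cong split: split_indicator)
  also have "\<dots> < \<infinity>"
  proof (rule nn_integral_tail_finite [OF x0 q a, where C="2 * b"])
    show "F (- x) \<le> 2 * b * x powr (- a)" if "x0 \<le> x" for x
      using all [OF that] F_bounds [of "- x"] by (intro le [of "1 - F (- x)"] that) (auto simp: mult.commute)
  qed (use all b F_bounds in auto)
  finally have L: "(\<integral>\<^sup>+x. ?l x * indicator {..- x0} x \<partial>lborel) < \<infinity>" .
  have "continuous_on {- x0..x0} ?h"
  proof -
    have "continuous_on {- x0..x0} f" "continuous_on {- x0..x0} F"
      using density_continuous F_continuous by (auto intro: continuous_on_subset continuous_at_imp_continuous_on)
    then show ?thesis
      using F_bounds density_pos by (intro continuous_intros) (auto simp: less_imp_neq [symmetric] intro: less_imp_neq)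
  qed
  then have "compact (?h ` {- x0..x0})" by (rule compact_continuous_image) simp
  then obtain B where B: "\<And>x. x \<in> {- x0..x0} \<Longrightarrow> ?h x \<le> B"
    using compact_imp_bounded bounded_real by (metis (no_types, lifting) abs_le_D1 imageI)
  have "J_integral q \<le> (\<integral>\<^sup>+x. (ennreal B * indicator {- x0..x0} x
     + ?r x * indicator {x0..} x)
     + ?l x * indicator {..- x0} x \<partial>lborel)"
    unfolding J_integral_def
  proof (rule nn_integral_mono)
    fix x
    have Fx: "0 < F x" "F x < 1" using F_bounds by auto
    consider "x < - x0" | "x \<in> {- x0..x0}" | "x0 < x" by force
    then show "ennreal (?h x) \<le> (ennreal B * indicator {- x0..x0} x
     + ?r x * indicator {x0..} x)
     + ?l x * indicator {..- x0} x"
    proof cases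
      case 1
      have "F x * (1 - F x) \<le> F x" using Fx by (simp add: algebra_simps)
      then have "?h x \<le> F x powr (q / 2) / f x powr (q - 1)"
        using Fx q by (intro divide_right_mono powr_mono2) auto
      then show ?thesis using 1 x0 by (auto intro: ennreal_leI)
    next
      case 2
      have "ennreal (?h x) \<le> ennreal B" using B [OF 2] by (rule ennreal_leI)
      also have "\<dots> = ennreal B * indicator {- x0..x0} x" using 2 by simp
      finally show ?thesis by (intro add_increasing2 zero_le)
    next
      case 3
      have "F x * (1 - F x) \<le> 1 - F x" using Fx by (intro mult_left_le_one_le) auto
      then have "?h x \<le> (1 - F x) powr (q / 2) / f x powr (q - 1)"
        using Fx q by (intro divide_right_mono powr_mono2) auto
      then show ?thesis using 3 x0 by (auto intro: ennreal_leI)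
    qed
  qed
  also have "\<dots> = ennreal B * emeasure lborel {- x0..x0}
     + (\<integral>\<^sup>+x. ?r x * indicator {x0..} x \<partial>lborel)
     + (\<integral>\<^sup>+x. ?l x * indicator {..- x0} x \<partial>lborel)"
    by (simp add: nn_integral_add nn_integral_cmult)
  also have "\<dots> < \<infinity>"
    using L R x0 by (simp add: ennreal_mult_less_top)
  finally show ?thesis .
qed

end

section \<open>Empirical distribution functions\<close>

lemma (in prob_space) integrable_bounded:
  fixes Z :: "'a \<Rightarrow> real"
  assumes "Z \<in> borel_measurable M" "\<And>w. \<bar>Z w\<bar> \<le> c"
  shows "integrable M Z"
  using assms by (intro integrable_const_bound [where B=c]) auto

lemma (in prob_space) prob_ge_le_second_moment:
  fixes Z :: "'a \<Rightarrow> real"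
  assumes [measurable]: "Z \<in> borel_measurable M" and int: "integrable M (\<lambda>w. (Z w)\<^sup>2)" and c: "0 < c"
  shows "prob {w \<in> space M. c \<le> \<bar>Z w\<bar>} \<le> expectation (\<lambda>w. (Z w)\<^sup>2) / c\<^sup>2"
proof -
  let ?E = "{w \<in> space M. c \<le> \<bar>Z w\<bar>}"
  have "prob ?E = expectation (indicator ?E)"
    by simp
  also have "\<dots> \<le> expectation (\<lambda>w. (Z w)\<^sup>2 / c\<^sup>2)"
  proof (rule integral_mono)
    fix w
    have "1 \<le> (Z w)\<^sup>2 / c\<^sup>2" if "c \<le> \<bar>Z w\<bar>"
      using c that power_mono [of c "\<bar>Z w\<bar>" 2] by simp
    then show "indicator ?E w \<le> (Z w)\<^sup>2 / c\<^sup>2"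
      by (auto simp: indicator_def)
    show "integrable M (indicat_real ?E)"
      by (rule integrable_real_indicator) (auto simp: less_top [symmetric])
  qed (use int in auto)
  finally show ?thesis by simp
qed

text \<open>Using \<open>r\<^sup>q \<le> 1 + r\<^sup>2\<close> in place of Jensen's inequality costs the factor \<open>2\<close>.\<close>

lemma (in prob_space) nn_integral_powr_le_second_moment:
  fixes Z :: "'a \<Rightarrow> real"
  assumes [measurable]: "Z \<in> borel_measurable M" and int: "integrable M (\<lambda>w. (Z w)\<^sup>2)"
    and s: "expectation (\<lambda>w. (Z w)\<^sup>2) \<le> s" "0 < s" and q: "0 < q" "q \<le> 2"
  shows "(\<integral>\<^sup>+w. ennreal (\<bar>Z w\<bar> powr q) \<partial>M) \<le> ennreal (2 * s powr (q / 2))"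
proof -
  have "\<bar>Z w\<bar> powr q \<le> s powr (q / 2) * (1 + (Z w)\<^sup>2 / s)" for w
  proof -
    have "r powr q \<le> 1 + r\<^sup>2" if "0 \<le> r" for r :: real
      using powr_le_one_plus_powr [of r q 2] that q by simp
    \<comment> \<open>Normalising by \<open>sqrt s\<close> makes the crude bound homogeneous, so
      that it scales like \<open>s^(q/2)\<close>.\<close>
    from this [of "\<bar>Z w\<bar> / sqrt s"] have "(\<bar>Z w\<bar> / sqrt s) powr q \<le> 1 + (Z w)\<^sup>2 / s"
      using s by (simp add: power_divide)
    moreover have "(\<bar>Z w\<bar> / sqrt s) powr q = \<bar>Z w\<bar> powr q / s powr (q / 2)"
      using s by (simp add: powr_divide powr_half_sqrt [symmetric] powr_powr)
    ultimately show ?thesis using s by (simp add: field_simps)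
  qed
  then have "(\<integral>\<^sup>+w. ennreal (\<bar>Z w\<bar> powr q) \<partial>M) \<le> (\<integral>\<^sup>+w. ennreal (s powr (q / 2) * (1 + (Z w)\<^sup>2 / s)) \<partial>M)"
    by (intro nn_integral_mono ennreal_leI)
  also have "\<dots> = ennreal (expectation (\<lambda>w. s powr (q / 2) * (1 + (Z w)\<^sup>2 / s)))"
    using s int by (intro nn_integral_eq_integral) auto
  also have "expectation (\<lambda>w. s powr (q / 2) * (1 + (Z w)\<^sup>2 / s)) = s powr (q / 2) * (1 + expectation (\<lambda>w. (Z w)\<^sup>2) / s)"
    using int by (simp add: prob_space)
  also have "\<dots> \<le> s powr (q / 2) * 2"
    using s by (intro mult_left_mono) auto
  finally show ?thesis by (simp add: mult.commute ennreal_leI)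
qed

text \<open>The value type is left open so that the locale covers both the pairs and their
  coordinates.\<close>

locale iid_sequence = prob_space M for M :: "'a measure" +
  fixes V :: "nat \<Rightarrow> 'a \<Rightarrow> 'c::topological_space"
  assumes indep: "indep_vars (\<lambda>_. borel) V UNIV"
    and ident: "\<And>i. distr M borel (V i) = distr M borel (V 0)"
begin

lemma V_measurable [measurable]: "V i \<in> borel_measurable M"
  using indep unfolding indep_vars_def2 by simp

lemma expectation_ident:
  fixes g :: "'c \<Rightarrow> real"
  assumes [measurable]: "g \<in> borel_measurable borel"
  shows "expectation (\<lambda>w. g (V i w)) = expectation (\<lambda>w. g (V 0 w))"
proof -
  have "expectation (\<lambda>w. g (V i w)) = (LINT x|distr M borel (V i). g x)"
    by (subst integral_distr) auto
  also have "\<dots> = expectation (\<lambda>w. g (V 0 w))"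
    by (subst ident, subst integral_distr) auto
  finally show ?thesis .
qed

context
  fixes g :: "'c \<Rightarrow> real" and c :: real
  assumes g [measurable]: "g \<in> borel_measurable borel" and bounded: "\<And>x. \<bar>g x\<bar> \<le> c"
    and centered: "expectation (\<lambda>w. g (V 0 w)) = 0"
begin

lemma indep_g: "indep_vars (\<lambda>_. borel) (\<lambda>i w. g (V i w)) UNIV"
  by (rule indep_vars_compose2 [OF indep]) simp

lemma bounded_mult: "\<bar>g x * g y\<bar> \<le> c * c"
  using bounded [of x] bounded [of y] by (simp add: abs_mult mult_mono')

lemma second_moment_sum:
  "expectation (\<lambda>w. (\<Sum>i<n. g (V i w))\<^sup>2) = real n * expectation (\<lambda>w. (g (V 0 w))\<^sup>2)"
proof -
  have int: "integrable M (\<lambda>w. g (V i w) * g (V j w))" for i j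
    by (rule integrable_bounded [OF _ bounded_mult]) simp
  have int1: "integrable M (\<lambda>w. g (V i w))" for i
    by (rule integrable_bounded [OF _ bounded]) simp
  have cov: "expectation (\<lambda>w. g (V i w) * g (V j w)) = (if i = j then expectation (\<lambda>w. (g (V 0 w))\<^sup>2) else 0)" for i j
  proof (cases "i = j")
    case True
    then show ?thesis
      using expectation_ident [of "\<lambda>x. (g x)\<^sup>2" i] by (simp add: power2_eq_square)
  next
    case False
    have "expectation (\<lambda>w. \<Prod>k\<in>{i, j}. g (V k w)) = (\<Prod>k\<in>{i, j}. expectation (\<lambda>w. g (V k w)))"
      by (intro indep_vars_lebesgue_integral indep_vars_subset [OF indep_g] int1) auto
    with False show ?thesis
      using expectation_ident [OF g, of i] centered by simp
  qed
  have "expectation (\<lambda>w. (\<Sum>i<n. g (V i w))\<^sup>2) = (\<Sum>i<n. \<Sum>j<n. expectation (\<lambda>w. g (V i w) * g (V j w)))"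
    using int by (simp add: power2_eq_square sum_product)
  also have "\<dots> = real n * expectation (\<lambda>w. (g (V 0 w))\<^sup>2)"
    unfolding cov by simp
  finally show ?thesis .
qed

text \<open>The central limit theorem, read off through characteristic functions. Zero variance is
  treated separately, where all summands vanish almost surely; it does occur, for instance when both
  coordinates of the pairs agree.\<close>

lemma char_normalized_sum_tendsto:
  "(\<lambda>n. CLINT w|M. iexp ((\<Sum>i<n. g (V i w)) / sqrt (real n)))
     \<longlonglongrightarrow> complex_of_real (exp (- expectation (\<lambda>w. (g (V 0 w))\<^sup>2) / 2))"
proof -
  define v where "v = expectation (\<lambda>w. (g (V 0 w))\<^sup>2)"
  have sq_int: "integrable M (\<lambda>w. (g (V i w))\<^sup>2)" for i
    unfolding power2_eq_square by (rule integrable_bounded [OF _ bounded_mult]) simp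
  have v_i: "expectation (\<lambda>w. (g (V i w))\<^sup>2) = v" for i
    unfolding v_def by (rule expectation_ident) simp
  have mean: "expectation (\<lambda>w. g (V i w)) = 0" for i
    using expectation_ident [OF g, of i] centered by simp
  have "0 \<le> v" unfolding v_def by simp
  show ?thesis
  proof (cases "v = 0")
    case True
    have "AE w in M. g (V i w) = 0" for i
      using integral_nonneg_eq_0_iff_AE [OF sq_int, of i] v_i [of i] True by simp
    then have "AE w in M. \<forall>i. g (V i w) = 0" by (simp add: AE_all_countable)
    then have "(CLINT w|M. iexp ((\<Sum>i<n. g (V i w)) / sqrt (real n))) = (CLINT w|M. 1)" for n
      by (intro integral_cong_AE) (auto elim!: eventually_mono)
    then show ?thesis using True by (simp add: v_def [symmetric] prob_space)
  next
    case False
    with \<open>0 \<le> v\<close> have v: "0 < v" by simp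
    let ?D = "\<lambda>n. distr M borel (\<lambda>w. (\<Sum>i<n. g (V i w)) / sqrt (real n * (sqrt v)\<^sup>2))"
    have "weak_conv_m (\<lambda>n. ?D n) std_normal_distribution"
    proof (rule central_limit_theorem_zero_mean [OF indep_g mean])
      show "distr M borel (\<lambda>w. g (V i w)) = distr M borel (\<lambda>w. g (V 0 w))" for i
      proof -
        have "distr M borel (g \<circ> V i) = distr (distr M borel (V i)) borel g" for i
          by (rule distr_distr [symmetric]) simp_all
        then show ?thesis using ident [of i] by (simp add: comp_def)
      qed
    qed (use v sq_int v_i mean in auto)
    \<comment> \<open>Evaluating at frequency \<open>sqrt v\<close> undoes the normalisation by the
      standard deviation.\<close>
    then have "(\<lambda>n. char (?D n) (sqrt v))
      \<longlonglongrightarrow> char std_normal_distribution (sqrt v)"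
      by (intro levy_continuity1) (auto intro: real_dist_normal_dist)
    moreover have "char (?D n) (sqrt v)
      = (CLINT w|M. iexp ((\<Sum>i<n. g (V i w)) / sqrt (real n)))" for n
    proof -
      have "sqrt v * (x / sqrt (real n * (sqrt v)\<^sup>2)) = x / sqrt (real n)" for x
        using v by (simp add: real_sqrt_mult)
      then show ?thesis
        unfolding char_def by (subst integral_distr) (simp_all only: borel_measurable_const, measurable)
    qed
    ultimately show ?thesis
      using v by (simp add: char_std_normal_distribution v_def [symmetric])
  qed
qed

end

end

lemma iid_sequence_compose:
  assumes "iid_sequence M V" and [measurable]: "h \<in> borel \<rightarrow>\<^sub>M borel"
  shows "iid_sequence M (\<lambda>i w. h (V i w))"
proof -
  interpret iid_sequence M V by fact
  have "distr M borel (h \<circ> V i) = distr (distr M borel (V i)) borel h" for i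
    by (rule distr_distr [symmetric]) simp_all
  then have "distr M borel (\<lambda>w. h (V i w)) = distr M borel (\<lambda>w. h (V 0 w))" for i
    using ident [of i] by (simp add: comp_def)
  then show ?thesis
    by unfold_locales (rule indep_vars_compose2 [OF indep], simp)
qed

lemma empirical_cdf_eq_sum: "empirical_cdf n x t = (\<Sum>i<n. of_bool (x i \<le> t)) / real n"
proof -
  have "{i. i < n \<and> x i \<le> t} = {i \<in> {..<n}. x i \<le> t}" by auto
  then show ?thesis unfolding empirical_cdf_def by (simp add: sum.If_cases of_bool_def Int_def)
qed

lemma right_continuous_mono_empirical_cdf:
  assumes "0 < n" shows "right_continuous_mono (empirical_cdf n x) 0 1"
proof
  show "continuous (at_right a) (empirical_cdf n x)" for a
    unfolding continuous_within empirical_cdf_eq_sum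
  proof (intro tendsto_divide tendsto_sum tendsto_const)
    fix i
    have "\<forall>\<^sub>F t in at_right a. of_bool (x i \<le> t) = (of_bool (x i \<le> a) :: real)"
    proof (cases "x i \<le> a")
      case True
      then show ?thesis by (simp add: eventually_at_filter)
    next
      case False
      then have "\<forall>\<^sub>F t in at_right a. t < x i"
        by (intro order_tendstoD(2) [OF tendsto_ident_at]) simp
      then show ?thesis by eventually_elim (use False in auto)
    qed
    then show "((\<lambda>t. of_bool (x i \<le> t)) \<longlongrightarrow> (of_bool (x i \<le> a) :: real)) (at_right a)"
      by (rule tendsto_eventually)
  qed (use assms in auto)
  show "mono (empirical_cdf n x)"
    unfolding empirical_cdf_eq_sum by (intro monoI divide_right_mono sum_mono) auto
  have "((\<lambda>t. (\<Sum>i<n. of_bool (x i \<le> t)) / real n) \<longlongrightarrow> (\<Sum>i<n. 0) / real n) at_bot"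
  proof (intro tendsto_divide tendsto_sum tendsto_const)
    show "((\<lambda>t. of_bool (x i \<le> t)) \<longlongrightarrow> (0::real)) at_bot" for i
      by (rule tendsto_eventually, rule eventually_mono [OF eventually_gt_at_bot [of "x i"]]) simp
  qed (use assms in auto)
  then show "(empirical_cdf n x \<longlongrightarrow> 0) at_bot" unfolding empirical_cdf_eq_sum by simp
  have "((\<lambda>t. (\<Sum>i<n. of_bool (x i \<le> t)) / real n) \<longlongrightarrow> (\<Sum>i<n. 1) / real n) at_top"
  proof (intro tendsto_divide tendsto_sum tendsto_const)
    show "((\<lambda>t. of_bool (x i \<le> t)) \<longlongrightarrow> (1::real)) at_top" for i
      using eventually_ge_at_top [of "x i"]
      by (intro tendsto_eventually) (auto elim!: eventually_mono)
  qed (use assms in auto)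
  then show "(empirical_cdf n x \<longlongrightarrow> 1) at_top"
    unfolding empirical_cdf_eq_sum using assms by simp
qed

lemma empirical_cdf_support:
  assumes "0 < n"
  obtains m where "\<And>t. t < - m \<Longrightarrow> empirical_cdf n x t = 0" "\<And>t. m \<le> t \<Longrightarrow> empirical_cdf n x t = 1"
proof -
  \<comment> \<open>A crude common bound for all sample points; it serves as the \<open>m\<close>
    required by the Hardy inequality.\<close>
  have *: "\<bar>x i\<bar> \<le> (\<Sum>i<n. \<bar>x i\<bar>)" if "i < n" for i
    by (rule member_le_sum) (use that in auto)
  show ?thesis
  proof
    show "empirical_cdf n x t = 0" if "t < - (\<Sum>i<n. \<bar>x i\<bar>)" for t
      using * that unfolding empirical_cdf_eq_sum by (force intro!: sum.neutral)
    show "empirical_cdf n x t = 1" if "(\<Sum>i<n. \<bar>x i\<bar>) \<le> t" for t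
    proof -
      have "(\<Sum>i<n. of_bool (x i \<le> t) :: real) = (\<Sum>i<n. 1)"
        using * that by (intro sum.cong) force+
      then show ?thesis using assms unfolding empirical_cdf_eq_sum by simp
    qed
  qed
qed

text \<open>Passes from convergence in probability to its metric form, which adds up well and
  applies directly to characteristic functions.\<close>

lemma (in prob_space) expectation_min_one_tendsto_0:
  fixes D :: "nat \<Rightarrow> 'a \<Rightarrow> real"
  assumes [measurable]: "\<And>n. D n \<in> borel_measurable M"
    and lim: "\<And>\<eta>. 0 < \<eta> \<Longrightarrow> (\<lambda>n. prob {w \<in> space M. \<eta> < \<bar>D n w\<bar>}) \<longlonglongrightarrow> 0"
  shows "(\<lambda>n. expectation (\<lambda>w. min 1 \<bar>D n w\<bar>)) \<longlonglongrightarrow> 0"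
proof (rule tendstoI)
  fix e :: real assume "0 < e"
  let ?E = "\<lambda>n. {w \<in> space M. e / 2 < \<bar>D n w\<bar>}"
  have le: "expectation (\<lambda>w. min 1 \<bar>D n w\<bar>) \<le> e / 2 + prob (?E n)" for n
  proof -
    have ind: "integrable M (indicat_real (?E n))"
      by (rule integrable_real_indicator) (auto simp: less_top [symmetric])
    have "expectation (\<lambda>w. min 1 \<bar>D n w\<bar>) \<le> expectation (\<lambda>w. e / 2 + indicator (?E n) w)"
    proof (rule integral_mono)
      show "integrable M (\<lambda>w. min 1 \<bar>D n w\<bar>)"
        by (rule integrable_bounded [where c=1]) auto
      show "min 1 \<bar>D n w\<bar> \<le> e / 2 + indicator (?E n) w" if "w \<in> space M" for w
        using \<open>0 < e\<close> that by (auto simp: indicator_def min_def)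
    qed (use ind in auto)
    also have "\<dots> = e / 2 + prob (?E n)"
      using ind by (simp add: prob_space)
    finally show ?thesis .
  qed
  have "\<forall>\<^sub>F n in sequentially. prob (?E n) < e / 2"
    using \<open>0 < e\<close> by (intro order_tendstoD(2) [OF lim]) auto
  then show "\<forall>\<^sub>F n in sequentially. dist (expectation (\<lambda>w. min 1 \<bar>D n w\<bar>)) 0 < e"
  proof eventually_elim
    case (elim n)
    have "0 \<le> expectation (\<lambda>w. min 1 \<bar>D n w\<bar>)" by (rule integral_nonneg_AE) simp
    then show ?case using le [of n] elim by simp
  qed
qed

text \<open>The quantile is at most \<open>a\<close> exactly if \<open>u\<close> is at most the
  empirical distribution function at \<open>a\<close>, a finite sum of measurable terms; this gives
  joint measurability.\<close>

lemma quantile_empirical_measurable: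
  fixes X :: "nat \<Rightarrow> 'a \<Rightarrow> real"
  assumes [measurable]: "\<And>i. X i \<in> borel_measurable M" and "0 < n"
  shows "(\<lambda>(u, w). quantile (empirical_cdf n (\<lambda>i. X i w)) u) \<in> borel_measurable (unit_lborel \<Otimes>\<^sub>M M)"
  unfolding borel_measurable_iff_le
proof
  fix a
  let ?S = "{z \<in> space (unit_lborel \<Otimes>\<^sub>M M). (case z of (u, w) \<Rightarrow> quantile (empirical_cdf n (\<lambda>i. X i w)) u) \<le> a}"
  have "?S
    = {z \<in> space (unit_lborel \<Otimes>\<^sub>M M). fst z \<le> (\<Sum>i<n. of_bool (X i (snd z) \<le> a)) / real n}"
    using quantile_le_iff [OF right_continuous_mono_empirical_cdf [OF \<open>0 < n\<close>]]
    by (auto simp: space_pair_measure empirical_cdf_eq_sum)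
  also have "\<dots> \<in> sets (unit_lborel \<Otimes>\<^sub>M M)" by measurable
  finally show "?S
    \<in> sets (unit_lborel \<Otimes>\<^sub>M M)" .
qed

locale density_sample = iid_sequence M X + dist: density_cdf "distr M borel (X 0)" f
  for M :: "'a measure" and X :: "nat \<Rightarrow> 'a \<Rightarrow> real" and f :: "real \<Rightarrow> real"
begin

abbreviation F :: "real \<Rightarrow> real" where "F \<equiv> cdf (distr M borel (X 0))"
abbreviation Q :: "real \<Rightarrow> real" where "Q \<equiv> quantile F"

abbreviation K :: "nat \<Rightarrow> 'a \<Rightarrow> real \<Rightarrow> real" where
  "K n w \<equiv> empirical_cdf n (\<lambda>i. X i w)"

lemma K_measurable [measurable]: "(\<lambda>w. K n w t) \<in> borel_measurable M"
  unfolding empirical_cdf_eq_sum by measurable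

lemma K_measurable_pair [measurable]: "(\<lambda>z. K n (snd z) (fst z)) \<in> borel_measurable (borel \<Otimes>\<^sub>M M)"
  unfolding empirical_cdf_eq_sum by measurable

lemma quantile_K_measurable [measurable]:
  "0 < n \<Longrightarrow> u \<in> {0<..<1} \<Longrightarrow> (\<lambda>w. quantile (K n w) u) \<in> borel_measurable M"
  using measurable_compose [OF measurable_Pair1' [of u unit_lborel M] quantile_empirical_measurable [of X M n]] by simp

lemma expectation_indicator: "expectation (\<lambda>w. of_bool (X i w \<le> t)) = F t"
proof -
  have "expectation (\<lambda>w. of_bool (X i w \<le> t)) = expectation (\<lambda>w. of_bool (X 0 w \<le> t) :: real)"
    using expectation_ident [of "\<lambda>x. of_bool (x \<le> t)" i] by simp
  also have "\<dots> = expectation (indicator {w \<in> space M. X 0 w \<le> t})"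
    by (intro Bochner_Integration.integral_cong) (auto simp: indicator_def)
  also have "\<dots> = prob {w \<in> space M. X 0 w \<le> t}" by simp
  also have "\<dots> = F t"
    by (simp add: cdf_def measure_distr vimage_def Int_def conj_commute)
  finally show ?thesis .
qed

lemma expectation_of_bool_mult: "expectation (\<lambda>w. of_bool (X i w \<le> s) * of_bool (X i w \<le> t)) = F (min s t)"
proof -
  have "of_bool (X i w \<le> s) * of_bool (X i w \<le> t) = (of_bool (X i w \<le> min s t) :: real)" for w
    by auto
  then show ?thesis using expectation_indicator [of i "min s t"] by simp
qed

lemma integrable_of_bool: "integrable M (\<lambda>w. of_bool (X i w \<le> t) :: real)"
  by (rule integrable_bounded [where c=1]) auto

text \<open>Two points and two coefficients, so that the variance at one point and the variance of
  an increment are both instances.\<close>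

lemma second_moment_K_diff:
  fixes c d :: real
  assumes "0 < n"
  shows "expectation (\<lambda>w. (c * (K n w s - F s) + d * (K n w t - F t))\<^sup>2)
    = expectation (\<lambda>w. (c * (of_bool (X 0 w \<le> s) - F s) + d * (of_bool (X 0 w \<le> t) - F t))\<^sup>2) / real n"
proof -
  let ?g = "\<lambda>x. c * (of_bool (x \<le> s) - F s) + d * (of_bool (x \<le> t) - F t)"
  have b: "\<bar>?g x\<bar> \<le> \<bar>c\<bar> * 1 + \<bar>d\<bar> * 1" for x :: real
  proof -
    have "\<bar>of_bool (x \<le> r) - F r\<bar> \<le> 1" for r using dist.F_bounds [of r] by auto
    then show ?thesis
      by (intro order_trans [OF abs_triangle_ineq] add_mono) (simp_all only: abs_mult mult_left_mono abs_ge_zero)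
  qed
  have m: "expectation (\<lambda>w. ?g (X 0 w)) = 0"
    using integrable_of_bool by (simp add: expectation_indicator prob_space)
  have "expectation (\<lambda>w. (\<Sum>i<n. ?g (X i w))\<^sup>2) = real n * expectation (\<lambda>w. (?g (X 0 w))\<^sup>2)"
    by (rule second_moment_sum [OF _ b m]) measurable
  moreover have "(\<Sum>i<n. ?g (X i w)) = real n * (c * (K n w s - F s) + d * (K n w t - F t))" for w
    using assms by (simp add: empirical_cdf_eq_sum sum.distrib sum_subtractf sum_distrib_left [symmetric] field_simps)
  ultimately have "(real n)\<^sup>2 * expectation (\<lambda>w. (c * (K n w s - F s) + d * (K n w t - F t))\<^sup>2)
      = real n * expectation (\<lambda>w. (?g (X 0 w))\<^sup>2)"
    by (simp only: power_mult_distrib integral_mult_right_zero)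
  moreover have "a = b / r" if "r\<^sup>2 * a = r * b" "0 < r" for a b r :: real
    using that by (simp add: power2_eq_square field_simps)
  ultimately show ?thesis using assms by simp
qed

lemma second_moment_K:
  assumes "0 < n"
  shows "expectation (\<lambda>w. (K n w t - F t)\<^sup>2) = F t * (1 - F t) / real n"
proof -
  have "expectation (\<lambda>w. (K n w t - F t)\<^sup>2) = expectation (\<lambda>w. (of_bool (X 0 w \<le> t) - F t)\<^sup>2) / real n"
    using second_moment_K_diff [OF assms, of 1 t 0 t] by simp
  also have "(\<lambda>w. (of_bool (X 0 w \<le> t) - F t)\<^sup>2) = (\<lambda>w. (1 - 2 * F t) * of_bool (X 0 w \<le> t) + (F t)\<^sup>2)"
    by (auto simp: fun_eq_iff power2_eq_square algebra_simps)
  also have "expectation \<dots> = (1 - 2 * F t) * F t + (F t)\<^sup>2"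
    using integrable_of_bool by (simp add: expectation_indicator prob_space)
  also have "\<dots> = F t * (1 - F t)" by (simp add: power2_eq_square algebra_simps)
  finally show ?thesis .
qed

text \<open>Exactly, the second moment is \<open>(d - d^2) / n\<close> with
  \<open>d = |F s - F t|\<close>, as for a Bernoulli variable. Its smallness for near points makes
  the local error of the quantiles vanish.\<close>

lemma second_moment_K_increment:
  assumes "0 < n"
  shows "expectation (\<lambda>w. ((K n w s - F s) - (K n w t - F t))\<^sup>2) \<le> \<bar>F s - F t\<bar> / real n"
proof -
  have "expectation (\<lambda>w. ((K n w s - F s) - (K n w t - F t))\<^sup>2)
     = expectation (\<lambda>w. ((of_bool (X 0 w \<le> s) - F s) - (of_bool (X 0 w \<le> t) - F t))\<^sup>2) / real n"
    using second_moment_K_diff [OF assms, of 1 s "- 1" t]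
    by (simp only: mult_1_left mult_minus1 add_uminus_conv_diff)
  also have "(\<lambda>w. ((of_bool (X 0 w \<le> s) - F s) - (of_bool (X 0 w \<le> t) - F t))\<^sup>2)
    = (\<lambda>w. of_bool (X 0 w \<le> s) + of_bool (X 0 w \<le> t) - 2 * (of_bool (X 0 w \<le> s) * of_bool (X 0 w \<le> t))
        - 2 * (F s - F t) * (of_bool (X 0 w \<le> s) - of_bool (X 0 w \<le> t)) + (F s - F t)\<^sup>2)"
    by (auto simp: fun_eq_iff power2_eq_square algebra_simps)
  also have "expectation \<dots> = F s + F t - 2 * F (min s t) - 2 * (F s - F t) * (F s - F t) + (F s - F t)\<^sup>2"
  proof -
    have "integrable M (\<lambda>w. of_bool (X 0 w \<le> s) * of_bool (X 0 w \<le> t) :: real)"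
      by (rule integrable_bounded [where c=1]) auto
    then show ?thesis
      using integrable_of_bool by (simp add: expectation_indicator expectation_of_bool_mult prob_space)
  qed
  also have "F s + F t - 2 * F (min s t) = \<bar>F s - F t\<bar>"
    using dist.cdf_nondecreasing [of s t] dist.cdf_nondecreasing [of t s] by (cases "s \<le> t") (auto simp: min_def)
  also have "(\<bar>F s - F t\<bar> - 2 * (F s - F t) * (F s - F t) + (F s - F t)\<^sup>2) / real n \<le> \<bar>F s - F t\<bar> / real n"
  proof (rule divide_right_mono)
    have "\<bar>x\<bar> - 2 * x * x + x\<^sup>2 \<le> \<bar>x\<bar>" for x :: real
      using zero_le_power2 [of x] by (simp add: power2_eq_square)
    then show "\<bar>F s - F t\<bar> - 2 * (F s - F t) * (F s - F t) + (F s - F t)\<^sup>2 \<le> \<bar>F s - F t\<bar>" .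
  qed simp
  finally show ?thesis .
qed

lemma K_deviation_le_1: "\<bar>K n w t - F t\<bar> \<le> 1"
proof -
  have "0 \<le> K n w t" unfolding empirical_cdf_def by simp
  moreover have "K n w t \<le> 1"
    unfolding empirical_cdf_def by (cases "n = 0") (auto intro: order_trans [OF card_mono [of "{..<n}"]])
  ultimately show ?thesis using dist.F_bounds [of t] by auto
qed

text \<open>The Hardy inequality reduces the claim to moments of \<open>K - F\<close> at fixed
  points, which are at most \<open>2 (F (1 - F) / n)^(q/2)\<close>. The powers of \<open>n\<close>
  cancel, so the bound is uniform; the factor 4 collects one 2 from each estimate.\<close>

lemma moment_bound_empirical_quantile:
  assumes n: "0 < n" and q: "1 < q" "q < 2"
  shows "(\<integral>\<^sup>+w. \<integral>\<^sup>+u. ennreal (\<bar>sqrt (real n) * (quantile (K n w) u - Q u)\<bar> powr q) \<partial>unit_lborel \<partial>M)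
    \<le> ennreal (4 * q * (2 * q) powr (q - 1)) * dist.J_integral q"
proof -
  let ?e = "\<lambda>w x. ennreal (\<bar>K n w x - F x\<bar> powr q / f x powr (q - 1))"
  let ?j = "\<lambda>x. ennreal ((F x * (1 - F x)) powr (q / 2) / f x powr (q - 1))"
  let ?v = "\<lambda>w u. ennreal (\<bar>sqrt (real n) * (quantile (K n w) u - Q u)\<bar> powr q)"
  interpret P: pair_sigma_finite lborel M ..
  let ?C = "q * (2 * q) powr (q - 1)" and ?n = "real n powr (q / 2)"
  have "(\<integral>\<^sup>+w. \<integral>\<^sup>+u. ?v w u \<partial>unit_lborel \<partial>M)
    \<le> (\<integral>\<^sup>+w. ennreal ?n * (2 * (ennreal ?C * (\<integral>\<^sup>+x. ?e w x \<partial>lborel))) \<partial>M)"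
  proof (rule nn_integral_mono)
    fix w
    have rc: "right_continuous_mono (K n w) 0 1" by (rule right_continuous_mono_empirical_cdf [OF n])
    note [measurable] = quantile_measurable [OF rc]
    obtain m where m: "\<And>t. t < - m \<Longrightarrow> K n w t = 0" "\<And>t. m \<le> t \<Longrightarrow> K n w t = 1"
      using empirical_cdf_support [OF n] by blast
    have "\<bar>sqrt (real n) * y\<bar> powr q = ?n * \<bar>y\<bar> powr q" for y
      by (simp add: abs_mult powr_mult powr_half_sqrt [symmetric] powr_powr)
    then have "(\<integral>\<^sup>+u. ?v w u \<partial>unit_lborel)
      = ennreal ?n * (\<integral>\<^sup>+u. ennreal (\<bar>quantile (K n w) u - Q u\<bar> powr q) \<partial>unit_lborel)"
      by (simp add: ennreal_mult nn_integral_cmult)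
    also have "\<dots> \<le> ennreal ?n * (2 * (ennreal ?C * (\<integral>\<^sup>+x. ?e w x \<partial>lborel)))"
      using q by (intro mult_left_mono dist.quantile_distance_le [OF rc m]) auto
    finally show "(\<integral>\<^sup>+u. ?v w u \<partial>unit_lborel) \<le> \<dots>" .
  qed
  also have "\<dots> = ennreal ?n * (2 * (ennreal ?C * (\<integral>\<^sup>+w. \<integral>\<^sup>+x. ?e w x \<partial>lborel \<partial>M)))"
  proof -
    have [measurable]: "(\<lambda>w. \<integral>\<^sup>+x. ?e w x \<partial>lborel) \<in> borel_measurable M"
      unfolding empirical_cdf_eq_sum by measurable
    show ?thesis by (simp add: nn_integral_cmult)
  qed
  also have "(\<integral>\<^sup>+w. \<integral>\<^sup>+x. ?e w x \<partial>lborel \<partial>M)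
    = (\<integral>\<^sup>+x. \<integral>\<^sup>+w. ?e w x \<partial>M \<partial>lborel)"
    by (rule P.Fubini') (unfold empirical_cdf_eq_sum, measurable)
  also have "\<dots> \<le> (\<integral>\<^sup>+x. ennreal (2 / ?n) * ?j x \<partial>lborel)"
  proof (rule nn_integral_mono)
    fix x
    have b: "0 < F x" "F x < 1" using dist.F_bounds by auto
    have "(\<integral>\<^sup>+w. ?e w x \<partial>M)
      = (\<integral>\<^sup>+w. ennreal (1 / f x powr (q - 1)) * ennreal (\<bar>K n w x - F x\<bar> powr q) \<partial>M)"
      by (intro nn_integral_cong) (simp add: ennreal_mult [symmetric])
    also have "\<dots> = ennreal (1 / f x powr (q - 1)) * (\<integral>\<^sup>+w. ennreal (\<bar>K n w x - F x\<bar> powr q) \<partial>M)"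
      by (rule nn_integral_cmult) measurable
    also have "(\<integral>\<^sup>+w. ennreal (\<bar>K n w x - F x\<bar> powr q) \<partial>M) \<le> ennreal (2 * (F x * (1 - F x) / real n) powr (q / 2))"
    proof (rule nn_integral_powr_le_second_moment)
      have "\<bar>(K n w x - F x)\<^sup>2\<bar> \<le> 1" for w
        using K_deviation_le_1 [of n w x] by (simp add: abs_square_le_1)
      then show "integrable M (\<lambda>w. (K n w x - F x)\<^sup>2)"
        by (intro integrable_bounded [where c=1]) auto
    qed (use second_moment_K [OF n, of x] b n q in auto)
    also have "ennreal (1 / f x powr (q - 1)) * ennreal (2 * (F x * (1 - F x) / real n) powr (q / 2))
      = ennreal (2 / ?n) * ?j x"
      using b n by (simp add: ennreal_mult [symmetric] powr_divide)
    finally show "(\<integral>\<^sup>+w. ?e w x \<partial>M)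
      \<le> ennreal (2 / ?n) * ?j x"
      by (simp add: mult_left_mono)
  qed
  also have "\<dots> = ennreal (2 / ?n) * dist.J_integral q"
    unfolding dist.J_integral_def by (rule nn_integral_cmult) measurable
  also have "ennreal ?n * (2 * (ennreal ?C * (ennreal (2 / ?n) * dist.J_integral q)))
    = (ennreal ?n * ennreal 2 * ennreal ?C * ennreal (2 / ?n)) * dist.J_integral q"
    by (simp add: mult_ac)
  also have "ennreal ?n * ennreal 2 * ennreal ?C * ennreal (2 / ?n) = ennreal (?n * 2 * ?C * (2 / ?n))"
    using q by (simp only: ennreal_mult' [symmetric] powr_ge_zero zero_le_numeral mult_nonneg_nonneg less_imp_le)
  also have "?n * 2 * ?C * (2 / ?n) = 4 * q * (2 * q) powr (q - 1)"
    using n by simp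
  finally show ?thesis by (simp add: mult_left_mono)
qed

end

section \<open>Bahadur representation at a fixed level\<close>

context density_sample
begin

context
  fixes u :: real
  assumes u: "u \<in> {0<..<1}"
begin

abbreviation h :: real where "h \<equiv> f (Q u)"

abbreviation quantile_error :: "nat \<Rightarrow> 'a \<Rightarrow> real" where
  "quantile_error n w \<equiv> sqrt (real n) * (quantile (K n w) u - Q u)"

abbreviation linear_error :: "nat \<Rightarrow> 'a \<Rightarrow> real" where
  "linear_error n w \<equiv> sqrt (real n) * (u - K n w (Q u)) / h"

text \<open>Measures how far the empirical distribution function is from the line of slope
  \<open>h\<close> over a distance \<open>y / sqrt n\<close> from \<open>Q u\<close>; the sign is
  the one that suits \<open>quantile_error_gt_iff\<close>.\<close>

abbreviation local_error :: "nat \<Rightarrow> real \<Rightarrow> 'a \<Rightarrow> real" where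
  "local_error n y w \<equiv> sqrt (real n) * (K n w (Q u) - K n w (Q u + y / sqrt (real n))) / h + y"

lemma h_pos: "0 < h" by (rule dist.density_pos)

lemma F_Qu: "F (Q u) = u" using u by (intro dist.F_Q) auto

lemma quantile_error_measurable: "quantile_error n \<in> borel_measurable M"
proof (cases "n = 0")
  case False
  then show ?thesis using quantile_K_measurable [of n u] u by simp
qed simp

lemma K_square_integrable:
  "integrable M (\<lambda>w. (c * (K n w s - F s) + d * (K n w t - F t))\<^sup>2)"
proof -
  have "\<bar>c * (K n w s - F s) + d * (K n w t - F t)\<bar> \<le> \<bar>c\<bar> * 1 + \<bar>d\<bar> * 1" for w
    by (intro order_trans [OF abs_triangle_ineq] add_mono) (simp_all only: abs_mult mult_left_mono abs_ge_zero K_deviation_le_1)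
  then have "\<bar>(c * (K n w s - F s) + d * (K n w t - F t))\<^sup>2\<bar> \<le> (\<bar>c\<bar> * 1 + \<bar>d\<bar> * 1)\<^sup>2" for w
    by (metis abs_ge_zero power2_abs power_abs power_mono)
  then show ?thesis by (rule integrable_bounded [rotated]) simp
qed

text \<open>The quantile exceeds a point exactly if the empirical distribution function there is
  below \<open>u\<close>. This replaces a random point by the deterministic point
  \<open>Q u + y / sqrt n\<close>, where second moments are available.\<close>

lemma quantile_error_gt_iff:
  assumes n: "0 < n"
  shows "y < quantile_error n w \<longleftrightarrow> y < linear_error n w + local_error n y w"
proof -
  have "y < quantile_error n w \<longleftrightarrow> Q u + y / sqrt (real n) < quantile (K n w) u"
    using n by (simp add: field_simps)
  also have "\<dots> \<longleftrightarrow> K n w (Q u + y / sqrt (real n)) < u"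
    using u by (intro less_quantile_iff right_continuous_mono_empirical_cdf n) auto
  also have "\<dots> \<longleftrightarrow> 0 < sqrt (real n) * (u - K n w (Q u + y / sqrt (real n))) / h"
    using n h_pos by (simp add: zero_less_divide_iff zero_less_mult_iff)
  also have "sqrt (real n) * (u - K n w (Q u + y / sqrt (real n))) / h = linear_error n w + local_error n y w - y"
    using h_pos by (simp add: field_simps)
  finally show ?thesis by simp
qed

lemma prob_linear_error_ge:
  assumes n: "0 < n" and m: "0 < m"
  shows "prob {w \<in> space M. m \<le> \<bar>linear_error n w\<bar>} \<le> 1 / (h\<^sup>2 * m\<^sup>2)"
proof -
  have eq: "(linear_error n w)\<^sup>2 = real n / h\<^sup>2 * (K n w (Q u) - F (Q u))\<^sup>2" for w
    by (simp add: F_Qu power_divide power_mult_distrib power2_commute)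
  have "prob {w \<in> space M. m \<le> \<bar>linear_error n w\<bar>} \<le> expectation (\<lambda>w. (linear_error n w)\<^sup>2) / m\<^sup>2"
    using K_square_integrable [of 1 n "Q u" 0 0] m
    by (intro prob_ge_le_second_moment) (simp_all add: eq)
  also have "expectation (\<lambda>w. (linear_error n w)\<^sup>2) = u * (1 - u) / h\<^sup>2"
    using n by (simp only: eq integral_mult_right_zero second_moment_K) (simp add: F_Qu)
  also have "\<dots> / m\<^sup>2 \<le> 1 / h\<^sup>2 / m\<^sup>2"
    using u mult_mono [of u 1 "1 - u" 1] by (intro divide_right_mono) auto
  finally show ?thesis by simp
qed

text \<open>Differentiability of \<open>F\<close> at \<open>Q u\<close> along the increments
  \<open>y / sqrt n\<close>; this is the deterministic part of \<open>local_error\<close>.\<close>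

lemma scaled_increment_tendsto:
  "(\<lambda>n. y - sqrt (real n) * (F (Q u + y / sqrt (real n)) - F (Q u)) / h) \<longlonglongrightarrow> 0"
proof (cases "y = 0")
  case False
  have lim: "(\<lambda>n. y / sqrt (real n)) \<longlonglongrightarrow> 0"
    by (intro real_tendsto_divide_at_top [OF tendsto_const] filterlim_compose [OF sqrt_at_top filterlim_real_sequentially])
  have "((\<lambda>t. (F (Q u + t) - F (Q u)) / t) \<longlongrightarrow> h) (at 0)"
    using dist.deriv_cdf by (simp add: DERIV_def)
  moreover have "filterlim (\<lambda>n. y / sqrt (real n)) (at 0) sequentially"
    unfolding filterlim_at using lim False by (auto intro: eventually_mono [OF eventually_gt_at_top [of 0]])
  ultimately have "(\<lambda>n. (F (Q u + y / sqrt (real n)) - F (Q u)) / (y / sqrt (real n))) \<longlonglongrightarrow> h"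
    by (rule filterlim_compose)
  then have "(\<lambda>n. y - y * ((F (Q u + y / sqrt (real n)) - F (Q u)) / (y / sqrt (real n))) / h) \<longlonglongrightarrow> y - y * h / h"
    using h_pos by (intro tendsto_intros) auto
  then show ?thesis using False h_pos by (simp add: mult.commute)
qed simp

text \<open>Subtracting the deterministic part leaves a centered increment of the empirical process
  over a shrinking interval, whose second moment tends to 0. The offset \<open>y\<close> is fixed;
  no uniformity in it is claimed.\<close>

lemma local_error_tendsto:
  assumes \<eta>: "0 < \<eta>"
  shows "(\<lambda>n. prob {w \<in> space M. \<eta> \<le> \<bar>local_error n y w\<bar>}) \<longlonglongrightarrow> 0"
proof (rule tendsto_sandwich [OF _ _ tendsto_const])
  let ?E = "\<lambda>n. {w \<in> space M. \<eta> \<le> \<bar>local_error n y w\<bar>}"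
  let ?x = "\<lambda>n. Q u + y / sqrt (real n)"
  let ?b = "\<lambda>n. \<bar>F (Q u) - F (?x n)\<bar> / (h\<^sup>2 * (\<eta> / 2)\<^sup>2)"
  have "\<forall>\<^sub>F n in sequentially. \<bar>y - sqrt (real n) * (F (?x n) - F (Q u)) / h\<bar> < \<eta> / 2"
    using \<eta> by (intro order_tendstoD(2) [OF tendsto_rabs_zero [OF scaled_increment_tendsto]]) auto
  then show "\<forall>\<^sub>F n in sequentially. prob (?E n) \<le> ?b n"
    using eventually_gt_at_top [of 0]
  proof eventually_elim
    case (elim n)
    let ?A = "\<lambda>w. sqrt (real n) / h * ((K n w (Q u) - F (Q u)) - (K n w (?x n) - F (?x n)))"
    have eq: "local_error n y w = ?A w + (y - sqrt (real n) * (F (?x n) - F (Q u)) / h)" for w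
      using h_pos by (simp add: field_simps)
    have "prob (?E n) \<le> prob {w \<in> space M. \<eta> / 2 \<le> \<bar>?A w\<bar>}"
    proof (rule finite_measure_mono)
      show "?E n \<subseteq> {w \<in> space M. \<eta> / 2 \<le> \<bar>?A w\<bar>}"
        unfolding eq using elim by (auto simp only: mem_Collect_eq)
    qed measurable
    also have "\<dots> \<le> expectation (\<lambda>w. (?A w)\<^sup>2) / (\<eta> / 2)\<^sup>2"
    proof (rule prob_ge_le_second_moment)
      have "?A w = sqrt (real n) / h * (K n w (Q u) - F (Q u)) + - (sqrt (real n) / h) * (K n w (?x n) - F (?x n))" for w
        by (simp only: right_diff_distrib mult_minus_left add_uminus_conv_diff)
      then show "integrable M (\<lambda>w. (?A w)\<^sup>2)"
        by (simp only:) (rule K_square_integrable)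
    qed (use \<eta> in auto)
    also have "expectation (\<lambda>w. (?A w)\<^sup>2) = real n / h\<^sup>2
        * expectation (\<lambda>w. ((K n w (Q u) - F (Q u)) - (K n w (?x n) - F (?x n)))\<^sup>2)"
      by (simp only: power_mult_distrib integral_mult_right_zero) (simp add: power_divide)
    also have "\<dots> \<le> real n / h\<^sup>2 * (\<bar>F (Q u) - F (?x n)\<bar> / real n)"
      using elim by (intro mult_left_mono second_moment_K_increment) auto
    also have "\<dots> = \<bar>F (Q u) - F (?x n)\<bar> / h\<^sup>2" using elim by simp
    finally show ?case by (simp add: divide_right_mono)
  qed
  have "(\<lambda>n. y / sqrt (real n)) \<longlonglongrightarrow> 0"
    by (intro real_tendsto_divide_at_top [OF tendsto_const] filterlim_compose [OF sqrt_at_top filterlim_real_sequentially])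
  then have "?x \<longlonglongrightarrow> Q u + 0" by (intro tendsto_intros)
  then have "(\<lambda>n. F (?x n)) \<longlonglongrightarrow> F (Q u)"
    by (intro isCont_tendsto_compose [OF dist.F_continuous]) simp
  then have "?b \<longlonglongrightarrow> \<bar>F (Q u) - F (Q u)\<bar> / (h\<^sup>2 * (\<eta> / 2)\<^sup>2)"
    using h_pos \<eta> by (intro tendsto_intros) auto
  then show "?b \<longlonglongrightarrow> 0" by simp
qed (auto intro!: always_eventually)

text \<open>By \<open>quantile_error_gt_iff\<close>, a gap between the two errors forces a large local error on a grid of
  mesh \<open>\<eta>\<close>; while the linear error is bounded, only boundedly many grid points matter.\<close>

lemma error_gap_imp_local_error:
  assumes n: "0 < n" and \<eta>: "0 < \<eta>" and W: "\<bar>linear_error n w\<bar> < m"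
    and gap: "3 * \<eta> < \<bar>quantile_error n w - linear_error n w\<bar>"
  obtains j where "j \<in> {- \<lceil>m / \<eta>\<rceil> - 2..\<lceil>m / \<eta>\<rceil> + 2}" "\<eta> \<le> \<bar>local_error n (of_int j * \<eta>) w\<bar>"
proof -
  let ?W = "linear_error n w" and ?V = "quantile_error n w"
  have W_div: "?W / \<eta> < m / \<eta>" "- (m / \<eta>) < ?W / \<eta>"
  proof -
    have "w / \<eta> < m / \<eta> \<and> - (m / \<eta>) < w / \<eta>" if "\<bar>w\<bar> < m" for w
      using that \<eta> by (auto simp: field_simps abs_less_iff)
    from this [OF W] show "?W / \<eta> < m / \<eta>" "- (m / \<eta>) < ?W / \<eta>" by auto
  qed
  have W_eq: "?W = ?W / \<eta> * \<eta>" using \<eta> by simp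
  consider "?W + 3 * \<eta> < ?V" | "?V < ?W - 3 * \<eta>" using gap by linarith
  then show thesis
  proof cases
    case 1
    \<comment> \<open>A grid point between \<open>?W + \<eta>\<close> and
      \<open>?W + 2 * \<eta>\<close> still lies below \<open>?V\<close>, so the local error there
      must supply at least \<open>\<eta>\<close>.\<close>
    define j where "j = \<lceil>?W / \<eta>\<rceil> + 1"
    have j: "?W / \<eta> + 1 \<le> of_int j" "of_int j < ?W / \<eta> + 2"
      unfolding j_def using ceiling_correct [of "?W / \<eta>"] by auto
    have j2: "?W + \<eta> \<le> of_int j * \<eta>" "of_int j * \<eta> < ?W + 2 * \<eta>"
      using mult_right_mono [OF j(1), of \<eta>] mult_strict_right_mono [OF j(2), of \<eta>] \<eta> W_eq
      by (auto simp: distrib_right)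
    have "of_int j * \<eta> < ?V" using 1 j2 \<eta> by linarith
    then have "of_int j * \<eta> < ?W + local_error n (of_int j * \<eta>) w"
      using quantile_error_gt_iff [OF n] by blast
    then have "\<eta> \<le> \<bar>local_error n (of_int j * \<eta>) w\<bar>" using j2 by linarith
    moreover have "j \<in> {- \<lceil>m / \<eta>\<rceil> - 2..\<lceil>m / \<eta>\<rceil> + 2}"
      unfolding j_def using W_div ceiling_correct [of "m / \<eta>"] ceiling_correct [of "?W / \<eta>"] by auto linarith+
    ultimately show thesis by (intro that)
  next
    case 2
    \<comment> \<open>The mirror image: a grid point between \<open>?W - 2 * \<eta>\<close> and
      \<open>?W - \<eta>\<close> is not below \<open>?V\<close>, and the failed criterion forces a
      local error of at most \<open>- \<eta>\<close>.\<close>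
    define j where "j = \<lfloor>?W / \<eta>\<rfloor> - 1"
    have j: "of_int j \<le> ?W / \<eta> - 1" "?W / \<eta> - 2 < of_int j"
      using real_of_int_floor_gt_diff_one [of "?W / \<eta>"] of_int_floor_le [of "?W / \<eta>"]
      unfolding j_def of_int_diff of_int_1 by linarith+
    have j2: "of_int j * \<eta> \<le> ?W - \<eta>" "?W - 2 * \<eta> < of_int j * \<eta>"
      using mult_right_mono [OF j(1), of \<eta>] mult_strict_right_mono [OF j(2), of \<eta>] \<eta> W_eq
      by (auto simp: left_diff_distrib)
    have "\<not> of_int j * \<eta> < ?V" using 2 j2 \<eta> by linarith
    then have "\<not> of_int j * \<eta> < ?W + local_error n (of_int j * \<eta>) w"
      using quantile_error_gt_iff [OF n] by blast
    then have "\<eta> \<le> \<bar>local_error n (of_int j * \<eta>) w\<bar>" using j2 by linarith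
    moreover have "j \<in> {- \<lceil>m / \<eta>\<rceil> - 2..\<lceil>m / \<eta>\<rceil> + 2}"
      unfolding j_def using W_div ceiling_correct [of "m / \<eta>"] floor_correct [of "?W / \<eta>"] by auto linarith+
    ultimately show thesis by (intro that)
  qed
qed

text \<open>The level \<open>m\<close> is fixed before \<open>n\<close>: it makes a large linear
  error improbable for all \<open>n > 0\<close> at once, and then a union bound over a fixed finite
  grid suffices.\<close>

lemma error_gap_tendsto:
  assumes \<eta>: "0 < \<eta>"
  shows "(\<lambda>n. prob {w \<in> space M. 3 * \<eta> < \<bar>quantile_error n w - linear_error n w\<bar>}) \<longlonglongrightarrow> 0"
proof (rule tendstoI)
  let ?G = "\<lambda>n. {w \<in> space M. 3 * \<eta> < \<bar>quantile_error n w - linear_error n w\<bar>}"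
  fix e :: real assume e: "0 < e"
  have [measurable]: "quantile_error n \<in> borel_measurable M" for n by (rule quantile_error_measurable)
  \<comment> \<open>Chosen so that \<open>(h * m)^2 > 2 / e\<close>, which brings the Chebyshev
    bound \<open>1 / (h^2 m^2)\<close> below \<open>e / 2\<close>.\<close>
  define m where "m = sqrt (2 / e) / h + 1"
  have m: "0 < m" using e h_pos by (simp add: m_def add_nonneg_pos)
  have "2 / e < (h * m)\<^sup>2"
  proof -
    have "sqrt (2 / e) < h * m" using h_pos by (simp add: m_def distrib_left)
    then have "(sqrt (2 / e))\<^sup>2 < (h * m)\<^sup>2" using e by (intro power_strict_mono) auto
    then show ?thesis using e by simp
  qed
  then have small: "1 / (h\<^sup>2 * m\<^sup>2) < e / 2"
    using e m h_pos by (simp add: power_mult_distrib field_simps)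
  let ?J = "{- \<lceil>m / \<eta>\<rceil> - 2..\<lceil>m / \<eta>\<rceil> + 2}"
  let ?E = "\<lambda>n j. {w \<in> space M. \<eta> \<le> \<bar>local_error n (of_int j * \<eta>) w\<bar>}"
  have "(\<lambda>n. \<Sum>j\<in>?J. prob (?E n j)) \<longlonglongrightarrow> (\<Sum>j\<in>?J. 0)"
    by (intro tendsto_sum local_error_tendsto \<eta>)
  then have "\<forall>\<^sub>F n in sequentially. (\<Sum>j\<in>?J. prob (?E n j)) < e / 2"
    using e by (intro order_tendstoD(2)) auto
  then show "\<forall>\<^sub>F n in sequentially. dist (prob (?G n)) 0 < e"
    using eventually_gt_at_top [of 0]
  proof eventually_elim
    case (elim n)
    let ?L = "{w \<in> space M. m \<le> \<bar>linear_error n w\<bar>}"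
    have "prob (?G n) \<le> prob (?L \<union> (\<Union>j\<in>?J. ?E n j))"
    proof (rule finite_measure_mono)
      show "?G n \<subseteq> ?L \<union> (\<Union>j\<in>?J. ?E n j)"
      proof
        fix w assume w: "w \<in> ?G n"
        show "w \<in> ?L \<union> (\<Union>j\<in>?J. ?E n j)"
        proof (cases "m \<le> \<bar>linear_error n w\<bar>")
          case True
          with w show ?thesis by blast
        next
          case False
          then have "\<bar>linear_error n w\<bar> < m" by simp
          from error_gap_imp_local_error [OF elim(2) \<eta> this] w
          obtain j where "j \<in> ?J" "\<eta> \<le> \<bar>local_error n (of_int j * \<eta>) w\<bar>" by blast
          with w show ?thesis by blast
        qed
      qed
      show "?L \<union> (\<Union>j\<in>?J. ?E n j) \<in> events" by measurable
    qed
    also have "\<dots> \<le> prob ?L + prob (\<Union>j\<in>?J. ?E n j)"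
      by (rule measure_Un_le) measurable
    also have "prob (\<Union>j\<in>?J. ?E n j) \<le> (\<Sum>j\<in>?J. prob (?E n j))"
      by (rule finite_measure_subadditive_finite) auto
    also have "prob ?L \<le> 1 / (h\<^sup>2 * m\<^sup>2)" by (rule prob_linear_error_ge [OF elim(2) m])
    finally show ?case using small elim(1) by simp
  qed
qed

proposition bahadur_representation:
  "(\<lambda>n. expectation (\<lambda>w. min 1 \<bar>quantile_error n w - linear_error n w\<bar>)) \<longlonglongrightarrow> 0"
proof (rule expectation_min_one_tendsto_0)
  show "(\<lambda>w. quantile_error n w - linear_error n w) \<in> borel_measurable M" for n
    by (intro borel_measurable_diff quantile_error_measurable) measurable
  show "(\<lambda>n. prob {w \<in> space M. \<eta> < \<bar>quantile_error n w - linear_error n w\<bar>}) \<longlonglongrightarrow> 0" if "0 < \<eta>" for \<eta>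
    using error_gap_tendsto [of "\<eta> / 3"] that by simp
qed

end

end

section \<open>Gaussian limits of linear combinations\<close>

lemma min_one_abs_add: "min 1 \<bar>a + b\<bar> \<le> min 1 \<bar>a\<bar> + min 1 \<bar>b :: real\<bar>"
  by (auto simp: min_def)

lemma min_one_abs_mult: "min 1 \<bar>c * a\<bar> \<le> max 1 \<bar>c\<bar> * min 1 \<bar>a :: real\<bar>"
proof (cases "\<bar>a\<bar> \<le> 1")
  case True
  have "\<bar>c * a\<bar> \<le> max 1 \<bar>c\<bar> * \<bar>a\<bar>" unfolding abs_mult by (intro mult_right_mono) auto
  with True show ?thesis by (simp add: min_def)
qed (auto simp: min_def)

context prob_space
begin

text \<open>Convergence to 0 in probability in its metric form; the truncation at 1 removes every
  integrability question.\<close>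

definition negligible :: "(nat \<Rightarrow> 'a \<Rightarrow> real) \<Rightarrow> bool" where
  "negligible D \<longleftrightarrow> (\<forall>n. D n \<in> borel_measurable M) \<and>
     (\<lambda>n. expectation (\<lambda>w. min 1 \<bar>D n w\<bar>)) \<longlonglongrightarrow> 0"

lemma integrable_min_one: "Z \<in> borel_measurable M \<Longrightarrow> integrable M (\<lambda>w. min 1 \<bar>Z w :: real\<bar>)"
  by (rule integrable_bounded [where c=1]) auto

lemma negligible_le:
  assumes D: "\<And>n. D n \<in> borel_measurable M"
    and le: "\<And>n. expectation (\<lambda>w. min 1 \<bar>D n w\<bar>) \<le> b n" and b: "b \<longlonglongrightarrow> 0"
  shows "negligible D"
  unfolding negligible_def
proof
  show "(\<lambda>n. expectation (\<lambda>w. min 1 \<bar>D n w\<bar>)) \<longlonglongrightarrow> 0"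
    by (rule tendsto_sandwich [OF _ _ tendsto_const b])
       (auto intro!: always_eventually le integral_nonneg_AE)
qed (use D in blast)

lemma negligible_add:
  assumes "negligible D" "negligible E" shows "negligible (\<lambda>n w. D n w + E n w)"
proof (rule negligible_le)
  have [measurable]: "D n \<in> borel_measurable M" "E n \<in> borel_measurable M" for n
    using assms by (auto simp: negligible_def)
  show "(\<lambda>w. D n w + E n w) \<in> borel_measurable M" for n by measurable
  show "expectation (\<lambda>w. min 1 \<bar>D n w + E n w\<bar>)
    \<le> expectation (\<lambda>w. min 1 \<bar>D n w\<bar>) + expectation (\<lambda>w. min 1 \<bar>E n w\<bar>)" for n
    by (subst Bochner_Integration.integral_add [symmetric])
       (auto intro!: integral_mono integrable_min_one Bochner_Integration.integrable_add min_one_abs_add)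
  show "(\<lambda>n. expectation (\<lambda>w. min 1 \<bar>D n w\<bar>) + expectation (\<lambda>w. min 1 \<bar>E n w\<bar>)) \<longlonglongrightarrow> 0"
    using assms tendsto_add [of _ "0::real" _ _ 0] by (simp add: negligible_def)
qed

lemma negligible_cmult:
  assumes "negligible D" shows "negligible (\<lambda>n w. c * D n w)"
proof (rule negligible_le)
  have [measurable]: "D n \<in> borel_measurable M" for n
    using assms by (auto simp: negligible_def)
  show "(\<lambda>w. c * D n w) \<in> borel_measurable M" for n by measurable
  show "expectation (\<lambda>w. min 1 \<bar>c * D n w\<bar>) \<le> max 1 \<bar>c\<bar> * expectation (\<lambda>w. min 1 \<bar>D n w\<bar>)" for n
    unfolding integral_mult_right_zero [symmetric]
    by (intro integral_mono integrable_min_one integrable_mult_right min_one_abs_mult) measurable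
  show "(\<lambda>n. max 1 \<bar>c\<bar> * expectation (\<lambda>w. min 1 \<bar>D n w\<bar>)) \<longlonglongrightarrow> 0"
    using assms by (intro tendsto_mult_right_zero) (simp add: negligible_def)
qed

lemma negligible_lin_comb:
  assumes "\<And>e. e \<in> S \<Longrightarrow> negligible (\<lambda>n. D n e)" "set l \<subseteq> UNIV \<times> S"
  shows "negligible (\<lambda>n. lin_comb (D n) l)"
  using assms(2)
proof (induction l)
  case Nil
  then show ?case by (simp add: negligible_def lin_comb_def)
next
  case (Cons x l)
  obtain s e where [simp]: "x = (s, e)" by (cases x)
  have "negligible (\<lambda>n w. s * D n e w + lin_comb (D n) l w)"
    using Cons by (intro negligible_add negligible_cmult assms(1)) auto
  then show ?case by (simp add: lin_comb_def)
qed

text \<open>Slutsky's theorem for characteristic functions: two exponentials whose phases differ by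
  \<open>d\<close> are at distance at most \<open>|d|\<close> and at most 2, hence at most
  \<open>2 * min 1 |d|\<close>.\<close>

lemma char_add_negligible:
  assumes D: "negligible D" and [measurable]: "\<And>n. A n \<in> borel_measurable M"
    and lim: "(\<lambda>n. CLINT w|M. iexp (A n w)) \<longlonglongrightarrow> c"
  shows "(\<lambda>n. CLINT w|M. iexp (A n w + D n w)) \<longlonglongrightarrow> c"
proof -
  let ?n = "\<lambda>n w. cmod (iexp (A n w + D n w) - iexp (A n w))"
  have [measurable]: "D n \<in> borel_measurable M" for n
    using D by (auto simp: negligible_def)
  have int: "integrable M (\<lambda>w. iexp (Z w))" if [measurable]: "Z \<in> borel_measurable M" for Z
    by (rule integrable_const_bound [where B=1]) auto
  have "(\<lambda>n. (CLINT w|M. iexp (A n w + D n w)) - (CLINT w|M. iexp (A n w))) \<longlonglongrightarrow> 0"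
  proof (rule Lim_null_comparison)
    show "\<forall>\<^sub>F n in sequentially. cmod ((CLINT w|M. iexp (A n w + D n w)) - (CLINT w|M. iexp (A n w)))
      \<le> 2 * expectation (\<lambda>w. min 1 \<bar>D n w\<bar>)"
    proof (intro always_eventually allI)
      fix n
      have "(CLINT w|M. iexp (A n w + D n w)) - (CLINT w|M. iexp (A n w))
        = (CLINT w|M. iexp (A n w + D n w) - iexp (A n w))"
        by (rule Bochner_Integration.integral_diff [symmetric]) (rule int, measurable)+
      also have "cmod \<dots> \<le> expectation (\<lambda>w. ?n n w)"
        by (rule integral_norm_bound)
      also have "\<dots> \<le> expectation (\<lambda>w. 2 * min 1 \<bar>D n w\<bar>)"
      proof (rule integral_mono)
        show "integrable M (\<lambda>w. ?n n w)"
          by (intro integrable_norm Bochner_Integration.integrable_diff int) measurable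
        show "integrable M (\<lambda>w. 2 * min 1 \<bar>D n w\<bar>)"
          by (intro integrable_mult_right integrable_min_one) measurable
        show "?n n w \<le> 2 * min 1 \<bar>D n w\<bar>" for w
        proof -
          have "?n n w \<le> \<bar>A n w + D n w - A n w\<bar>"
            by (rule iexp_lipschitz)
          moreover have "?n n w \<le> 2"
            by (rule order_trans [OF norm_triangle_ineq4]) simp
          moreover have "c \<le> 2 * min 1 \<bar>d\<bar>" if "c \<le> \<bar>d\<bar>" "c \<le> 2" for c d :: real
            using that by (auto simp: min_def)
          ultimately show ?thesis by (simp only: add_diff_cancel_left')
        qed
      qed
      finally show "cmod ((CLINT w|M. iexp (A n w + D n w)) - (CLINT w|M. iexp (A n w)))
        \<le> 2 * expectation (\<lambda>w. min 1 \<bar>D n w\<bar>)" by simp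
    qed
    show "(\<lambda>n. 2 * expectation (\<lambda>w. min 1 \<bar>D n w\<bar>)) \<longlonglongrightarrow> 0"
      using D by (intro tendsto_mult_right_zero) (simp add: negligible_def)
  qed
  from tendsto_add [OF this lim] show ?thesis by simp
qed

end

lemma lin_comb_cong: "(\<And>s e. (s, e) \<in> set l \<Longrightarrow> \<theta> e w = \<theta>' e w') \<Longrightarrow> lin_comb \<theta> l w = lin_comb \<theta>' l w'"
  unfolding lin_comb_def by (rule arg_cong [where f=sum_list], rule map_cong) auto

lemma lin_comb_add: "lin_comb (\<lambda>e w. \<theta> e w + \<theta>' e w) l w = lin_comb \<theta> l w + lin_comb \<theta>' l w"
  by (induction l) (auto simp: lin_comb_def algebra_simps)

text \<open>By bilinearity only pairwise mixed moments matter. Each induction expands one argument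
  and carries integrability along, because additivity of the integral needs it.\<close>

lemma second_moment_lin_comb_cong:
  assumes int: "\<And>e e'. e \<in> S \<Longrightarrow> e' \<in> S \<Longrightarrow> integrable M (\<lambda>w. \<theta> e w * \<theta> e' w :: real)"
    and int': "\<And>e e'. e \<in> S \<Longrightarrow> e' \<in> S \<Longrightarrow> integrable N (\<lambda>w. \<theta>' e w * \<theta>' e' w :: real)"
    and eq: "\<And>e e'. e \<in> S \<Longrightarrow> e' \<in> S \<Longrightarrow> (LINT w|M. \<theta> e w * \<theta> e' w) = (LINT w|N. \<theta>' e w * \<theta>' e' w)"
    and l: "set l \<subseteq> UNIV \<times> S"
  shows "(LINT w|M. (lin_comb \<theta> l w)\<^sup>2) = (LINT w|N. (lin_comb \<theta>' l w)\<^sup>2)"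
proof -
  have 1: "integrable M (\<lambda>w. \<theta> e w * lin_comb \<theta> l w) \<and> integrable N (\<lambda>w. \<theta>' e w * lin_comb \<theta>' l w) \<and>
    (LINT w|M. \<theta> e w * lin_comb \<theta> l w) = (LINT w|N. \<theta>' e w * lin_comb \<theta>' l w)"
    if e: "e \<in> S" and "set l \<subseteq> UNIV \<times> S" for e l
    using that(2)
  proof (induction l)
    case (Cons x l)
    obtain s e' where x: "x = (s, e')" by (cases x)
    have *: "a * (s * b + c) = s * (a * b) + a * c" for a b c :: real by (simp add: algebra_simps)
    show ?case
      using Cons e unfolding x lin_comb_Cons * by (auto simp: int int' eq)
  qed simp
  have "integrable M (\<lambda>w. lin_comb \<theta> l w * lin_comb \<theta> l' w) \<and> integrable N (\<lambda>w. lin_comb \<theta>' l w * lin_comb \<theta>' l' w) \<and>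
    (LINT w|M. lin_comb \<theta> l w * lin_comb \<theta> l' w) = (LINT w|N. lin_comb \<theta>' l w * lin_comb \<theta>' l' w)"
    if l': "set l' \<subseteq> UNIV \<times> S" and "set l \<subseteq> UNIV \<times> S" for l l'
    using that(2)
  proof (induction l)
    case (Cons x l)
    obtain s e' where x: "x = (s, e')" by (cases x)
    have *: "(s * b + c) * a = s * (b * a) + c * a" for a b c :: real by (simp add: algebra_simps)
    show ?case
      using Cons l' 1 [of e' l'] unfolding x lin_comb_Cons * by auto
  qed simp
  from this [OF l l] show ?thesis by (simp add: power2_eq_square)
qed

text \<open>Collects repeated indices, to match the finite index sets in
  \<open>centered_gaussian_process\<close>.\<close>

lemma lin_comb_eq_sum:
  assumes "finite J" "snd ` set l \<subseteq> J"
  shows "lin_comb \<theta> l w = (\<Sum>e\<in>J. (\<Sum>(s, e')\<leftarrow>l. if e' = e then s else 0) * \<theta> e w)"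
  using assms(2)
proof (induction l)
  case (Cons x l)
  obtain s e' where x: "x = (s, e')" by (cases x)
  have e': "e' \<in> J" using Cons.prems x by simp
  have "(\<Sum>e\<in>J. (\<Sum>(s, e')\<leftarrow>x # l. if e' = e then s else 0) * \<theta> e w)
    = (\<Sum>e\<in>J. (if e' = e then s * \<theta> e w else 0)) + (\<Sum>e\<in>J. (\<Sum>(s, e')\<leftarrow>l. if e' = e then s else 0) * \<theta> e w)"
    unfolding x sum.distrib [symmetric] by (intro sum.cong) (auto simp: distrib_right)
  also have "(\<Sum>e\<in>J. (if e' = e then s * \<theta> e w else 0)) = s * \<theta> e' w"
    using assms(1) e' by simp
  finally show ?case using Cons x by simp
qed (simp add: lin_comb_def)

text \<open>The point mass at 0 is handled apart from the laws with a density; a positive second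
  moment excludes it in the last claim.\<close>

lemma (in prob_space) centered_gaussian_properties:
  assumes law: "centered_gaussian_law (distr M borel S)" and [measurable]: "S \<in> borel_measurable M"
  shows "integrable M (\<lambda>w. (S w)\<^sup>2)" "expectation S = 0"
    "(CLINT w|M. iexp (S w)) = complex_of_real (exp (- expectation (\<lambda>w. (S w)\<^sup>2) / 2))"
    "0 < expectation (\<lambda>w. (S w)\<^sup>2) \<Longrightarrow> AE w in M. S w \<noteq> 0"
proof -
  have "integrable M (\<lambda>w. (S w)\<^sup>2) \<and> expectation S = 0 \<and>
    (CLINT w|M. iexp (S w)) = complex_of_real (exp (- expectation (\<lambda>w. (S w)\<^sup>2) / 2)) \<and>
    (0 < expectation (\<lambda>w. (S w)\<^sup>2) \<longrightarrow> (AE w in M. S w \<noteq> 0))"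
    using law unfolding centered_gaussian_law_def
  proof (elim disjE exE conjE)
    assume eq: "distr M borel S = return borel 0"
    have "AE x in distr M borel S. x = 0"
      unfolding eq by (subst AE_return) auto
    then have ae: "AE w in M. S w = 0" by (subst (asm) AE_distr_iff) auto
    have "integrable M (\<lambda>w. (S w)\<^sup>2) \<longleftrightarrow> integrable M (\<lambda>w. 0 :: real)"
      by (intro integrable_cong_AE) (use ae in auto)
    moreover have E: "expectation (\<lambda>w. (S w)\<^sup>2) = expectation (\<lambda>w. 0)" "expectation S = expectation (\<lambda>w. 0)"
      by (intro integral_cong_AE; use ae in auto)+
    moreover have "(CLINT w|M. iexp (S w)) = (CLINT w|M. 1)"
      by (intro integral_cong_AE) (use ae in auto)
    ultimately show ?thesis by (simp add: prob_space)
  next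
    fix \<sigma> :: real assume \<sigma>: "0 < \<sigma>" and eq: "distr M borel S = density lborel (normal_density 0 \<sigma>)"
    have D: "distributed M lborel S (normal_density 0 \<sigma>)"
      unfolding distributed_def using eq distr_cong [of M M borel lborel S S] by simp
    have mean: "expectation S = 0"
      using normal_distributed_expectation [OF \<sigma> D] .
    have sq: "expectation (\<lambda>w. (S w)\<^sup>2) = \<sigma>\<^sup>2"
      using normal_distributed_variance [OF \<sigma> D] mean by simp
    have int: "integrable M (\<lambda>w. (S w)\<^sup>2)"
      \<comment> \<open>A non-integrable function has Bochner integral 0, so the positive value
        already proves integrability.\<close>
      using sq \<sigma> not_integrable_integral_eq [of M "\<lambda>w. (S w)\<^sup>2"] by (metis less_irrefl zero_less_power)
    have D1: "distributed M lborel (\<lambda>w. S w / \<sigma>) std_normal_density"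
      using normal_standard_normal_convert [OF \<sigma>, of S 0] D by simp
    then have std: "distr M borel (\<lambda>w. S w / \<sigma>) = std_normal_distribution"
      using distr_cong [of M M borel lborel "\<lambda>w. S w / \<sigma>"] by (simp add: distributed_def)
    have "(CLINT w|M. iexp (S w)) = char (distr M borel (\<lambda>w. S w / \<sigma>)) \<sigma>"
      unfolding char_def using \<sigma> by (subst integral_distr) auto
    also have "\<dots> = complex_of_real (exp (- (\<sigma>\<^sup>2) / 2))"
      unfolding std by (simp add: char_std_normal_distribution)
    finally have char: "(CLINT w|M. iexp (S w)) = complex_of_real (exp (- (\<sigma>\<^sup>2) / 2))" .
    have "AE x in distr M borel S. x \<noteq> 0"
      unfolding eq using \<sigma> by (subst AE_density) (auto intro: AE_mp [OF AE_lborel_singleton [of 0]])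
    then have "AE w in M. S w \<noteq> 0" by (subst (asm) AE_distr_iff) auto
    with mean sq int char show ?thesis by simp
  qed
  then show "integrable M (\<lambda>w. (S w)\<^sup>2)" "expectation S = 0"
    "(CLINT w|M. iexp (S w)) = complex_of_real (exp (- expectation (\<lambda>w. (S w)\<^sup>2) / 2))"
    "0 < expectation (\<lambda>w. (S w)\<^sup>2) \<Longrightarrow> AE w in M. S w \<noteq> 0"
    by auto
qed

text \<open>By continuity of the paths the process is a pointwise limit of processes that are
  piecewise constant in \<open>u\<close>, each built from finitely many measurable sections.\<close>

lemma measurable_continuous_paths:
  fixes B :: "real \<Rightarrow> 'b \<Rightarrow> real"
  assumes B: "\<And>u. u \<in> {0<..<1} \<Longrightarrow> B u \<in> borel_measurable N"
    and cont: "\<And>w. w \<in> space N \<Longrightarrow> continuous_on {0<..<1} (\<lambda>u. B u w)"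
  shows "case_prod B \<in> borel_measurable (unit_lborel \<Otimes>\<^sub>M N)"
proof (rule borel_measurable_LIMSEQ_real)
  (* the nodes stay in the open interval, where alone the paths are continuous *)
  let ?r = "\<lambda>i u. (of_int \<lfloor>u * real (Suc i)\<rfloor> + 1) / (real (Suc i) + 1)"
  \<comment> \<open>Other values of \<open>k\<close> do not occur for \<open>u\<close> in (0,1); the
    default 0 makes the expression measurable for every integer \<open>k\<close>.\<close>
  let ?B = "\<lambda>i (k::int) w. if 0 \<le> k \<and> k < int (Suc i) then B ((of_int k + 1) / (real (Suc i) + 1)) w else 0"
  have r01: "?r i u \<in> {0<..<1}" and k: "0 \<le> \<lfloor>u * real (Suc i)\<rfloor>" "\<lfloor>u * real (Suc i)\<rfloor> < int (Suc i)"
    if "u \<in> {0<..<1}" for u i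
  proof -
    have k0: "0 \<le> \<lfloor>u * real (Suc i)\<rfloor>" using that by simp
    then show "0 \<le> \<lfloor>u * real (Suc i)\<rfloor>" .
    have "u * real (Suc i) < 1 * real (Suc i)" using that by (intro mult_strict_right_mono) auto
    then have k1: "\<lfloor>u * real (Suc i)\<rfloor> < int (Suc i)" by (simp add: floor_less_iff)
    from k1 have "of_int \<lfloor>u * real (Suc i)\<rfloor> + 1 < real (Suc i) + 1" by linarith
    moreover have "(0::real) < of_int \<lfloor>u * real (Suc i)\<rfloor> + 1" using k0 by linarith
    ultimately show "?r i u \<in> {0<..<1}" by (simp add: divide_less_eq)
    show "\<lfloor>u * real (Suc i)\<rfloor> < int (Suc i)" by (rule k1)
  qed
  show "(\<lambda>z. ?B i \<lfloor>fst z * real (Suc i)\<rfloor> (snd z)) \<in> borel_measurable (unit_lborel \<Otimes>\<^sub>M N)" for i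
  proof (rule measurable_compose_countable [where f="\<lambda>k z. ?B i k (snd z)" and g="\<lambda>z. \<lfloor>fst z * real (Suc i)\<rfloor>"])
    show "(\<lambda>z. \<lfloor>fst z * real (Suc i)\<rfloor>) \<in> measurable (unit_lborel \<Otimes>\<^sub>M N) (count_space UNIV)"
      by measurable
    show "(\<lambda>z. ?B i k (snd z)) \<in> borel_measurable (unit_lborel \<Otimes>\<^sub>M N)" for k
    proof (cases "0 \<le> k \<and> k < int (Suc i)")
      case True
      then have "(of_int k + 1) / (real (Suc i) + 1) \<in> {0<..<1}"
        by (auto simp: divide_less_eq)
      from measurable_compose [OF measurable_snd B [OF this]] True show ?thesis by simp
    qed auto
  qed
  fix z assume "z \<in> space (unit_lborel \<Otimes>\<^sub>M N)"
  then obtain u w where z: "z = (u, w)" and u: "u \<in> {0<..<1}" and w: "w \<in> space N"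
    by (auto simp: space_pair_measure)
  have "(\<lambda>i. ?r i u) \<longlonglongrightarrow> u"
  proof (rule tendsto_sandwich)
    have up: "?r i u \<le> u + 1 / real (Suc i)" and lo: "u - 1 / real (Suc i) \<le> ?r i u" for i
    proof -
      let ?n = "real (Suc i)"
      have fl: "of_int \<lfloor>u * ?n\<rfloor> \<le> u * ?n" "u * ?n < of_int \<lfloor>u * ?n\<rfloor> + 1"
        using floor_correct [of "u * ?n"] by auto
      have n: "0 < ?n" by simp
      have "of_int \<lfloor>u * ?n\<rfloor> + 1 \<le> u * ?n + 1" using fl by simp
      also have "\<dots> \<le> (u + 1 / ?n) * (?n + 1)"
        using u n by (simp add: distrib_left distrib_right del: of_nat_Suc)
      finally show "?r i u \<le> u + 1 / ?n" by (simp add: divide_le_eq del: of_nat_Suc)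
      have "(u - 1 / ?n) * (?n + 1) = u * ?n + u - 1 - 1 / ?n"
        using n by (simp add: distrib_left left_diff_distrib del: of_nat_Suc)
      also have "\<dots> \<le> u * ?n" using u n by (simp add: add_increasing2 algebra_simps del: of_nat_Suc)
      also have "\<dots> \<le> of_int \<lfloor>u * ?n\<rfloor> + 1" using fl by simp
      finally show "u - 1 / ?n \<le> ?r i u" by (simp add: le_divide_eq del: of_nat_Suc)
    qed
    show "\<forall>\<^sub>F i in sequentially. ?r i u \<le> u + 1 / real (Suc i)"
      "\<forall>\<^sub>F i in sequentially. u - 1 / real (Suc i) \<le> ?r i u"
      using up lo by (auto simp del: of_nat_Suc)
    have inv: "(\<lambda>i. 1 / real (Suc i)) \<longlonglongrightarrow> 0"
      using LIMSEQ_inverse_real_of_nat by (simp add: inverse_eq_divide)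
    from tendsto_add [OF tendsto_const inv, of u] show "(\<lambda>i. u + 1 / real (Suc i)) \<longlonglongrightarrow> u" by simp
    from tendsto_diff [OF tendsto_const inv, of u] show "(\<lambda>i. u - 1 / real (Suc i)) \<longlonglongrightarrow> u" by simp
  qed
  then have "(\<lambda>i. B (?r i u) w) \<longlonglongrightarrow> B u w"
    by (intro continuous_on_tendsto_compose [OF cont [OF w] _ u] always_eventually allI r01 [OF u])
  then show "(\<lambda>i. ?B i \<lfloor>fst z * real (Suc i)\<rfloor> (snd z)) \<longlonglongrightarrow> case_prod B z"
    using k [OF u] by (simp add: z del: of_nat_Suc)
qed

lemma integrable_mult_of_squares:
  fixes f g :: "'a \<Rightarrow> real"
  assumes "integrable M (\<lambda>x. (f x)\<^sup>2)" "integrable M (\<lambda>x. (g x)\<^sup>2)"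
    and [measurable]: "f \<in> borel_measurable M" "g \<in> borel_measurable M"
  shows "integrable M (\<lambda>x. f x * g x)"
proof (rule Bochner_Integration.integrable_bound)
  show "integrable M (\<lambda>x. (f x)\<^sup>2 + (g x)\<^sup>2)" using assms by simp
  have "norm (a * b) \<le> norm (a\<^sup>2 + b\<^sup>2)" for a b :: real
  proof -
    have "\<bar>a\<bar> * \<bar>b\<bar> \<le> \<bar>a\<bar>\<^sup>2 + \<bar>b\<bar>\<^sup>2"
      using sum_squares_bound [of "\<bar>a\<bar>" "\<bar>b\<bar>"] mult_nonneg_nonneg [of "\<bar>a\<bar>" "\<bar>b\<bar>"] by linarith
    then show ?thesis by (simp add: abs_mult)
  qed
  then show "AE x in M. norm (f x * g x) \<le> norm ((f x)\<^sup>2 + (g x)\<^sup>2)" by simp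
qed measurable

text \<open>Continuity keeps \<open>z\<close> away from 0 on a whole ball around \<open>u\<close>,
  which has positive length.\<close>

lemma nn_integral_unit_pos:
  fixes z :: "real \<Rightarrow> real"
  assumes cont: "continuous_on {0<..<1} z" and u: "u \<in> {0<..<1}" "z u \<noteq> 0"
    and [measurable]: "z \<in> borel_measurable unit_lborel"
  shows "0 < (\<integral>\<^sup>+v. ennreal (\<bar>z v\<bar> powr p) \<partial>unit_lborel)"
proof (rule ccontr)
  assume "\<not> 0 < (\<integral>\<^sup>+v. ennreal (\<bar>z v\<bar> powr p) \<partial>unit_lborel)"
  then have "AE v in unit_lborel. ennreal (\<bar>z v\<bar> powr p) = 0"
    by (subst nn_integral_0_iff_AE [symmetric]) auto
  then have ae: "AE v in lborel. v \<in> {0<..<1} \<longrightarrow> z v = 0"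
    by (subst (asm) AE_restrict_space_iff) auto
  have "open ({v \<in> {0<..<1}. z v \<in> - {0}})"
    using continuous_open_preimage [OF cont, of "- {0}"] open_Compl [of "{0::real}"]
    by (simp add: vimage_def Int_def conj_commute)
  moreover have "u \<in> {v \<in> {0<..<1}. z v \<in> - {0}}" using u by simp
  ultimately obtain e where e: "0 < e" "ball u e \<subseteq> {v \<in> {0<..<1}. z v \<in> - {0}}"
    by (meson open_contains_ball)
  have "AE v in lborel. v \<notin> ball u e"
    using ae by eventually_elim (use e in auto)
  then have "ball u e \<in> null_sets lborel" by (subst AE_iff_null_sets) auto
  then have "emeasure lborel {u - e<..<u + e} = 0" by (auto simp: ball_eq_greaterThanLessThan)
  then show False using e by simp
qed

section \<open>The Gaussian limit process\<close>

locale gaussian_limit = prob_space N + dist: density_cdf \<mu> f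
  for N :: "'b measure" and \<mu> :: "real measure" and f :: "real \<Rightarrow> real" +
  fixes BX BY :: "real \<Rightarrow> 'b \<Rightarrow> real" and H :: "real \<Rightarrow> real \<Rightarrow> real"
  assumes gauss: "centered_gaussian_process N ({0<..<1} <+> {0<..<1}) (case_sum BX BY)"
    and bridges: "brownian_bridge N BX" "brownian_bridge N BY"
    and cross_cov: "\<And>u v. u \<in> {0<..<1} \<Longrightarrow> v \<in> {0<..<1} \<Longrightarrow>
      covariance N (BX u) (BY v) = H (quantile (cdf \<mu>) u) (quantile (cdf \<mu>) v) - u * v"
begin

abbreviation Q :: "real \<Rightarrow> real" where "Q \<equiv> quantile (cdf \<mu>)"

text \<open>This is \<open>limit_process\<close> for two equal marginals, where one density and one
  quantile function serve both bridges.\<close>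

definition bridge :: "real \<Rightarrow> 'b \<Rightarrow> real" where
  "bridge u w = BX u w / f (Q u) - BY u w / f (Q u)"

lemma gaussian_law:
  assumes "finite J" "J \<subseteq> {0<..<1} <+> {0<..<1}"
  shows "centered_gaussian_law (distr N borel (\<lambda>w. \<Sum>t\<in>J. c t * case_sum BX BY t w))"
  using gauss assms unfolding centered_gaussian_process_def by blast

lemma joint_measurable: "t \<in> {0<..<1} <+> {0<..<1} \<Longrightarrow> case_sum BX BY t \<in> borel_measurable N"
  using gauss unfolding centered_gaussian_process_def by blast

lemma bridge_components_measurable [measurable]:
  assumes "u \<in> {0<..<1}"
  shows "BX u \<in> borel_measurable N" "BY u \<in> borel_measurable N"
  using joint_measurable [OF InlI [OF assms]] joint_measurable [OF InrI [OF assms]] by simp_all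

lemma components_centered_gaussian:
  assumes "u \<in> {0<..<1}"
  shows "centered_gaussian_law (distr N borel (BX u))" "centered_gaussian_law (distr N borel (BY u))"
  using gaussian_law [of "{Inl u}" "\<lambda>_. 1"] gaussian_law [of "{Inr u}" "\<lambda>_. 1"]
    InlI [OF assms, of "{0<..<1}"] InrI [OF assms, of "{0<..<1}"] by simp_all

lemma components_square_integrable:
  assumes u: "u \<in> {0<..<1}"
  shows "integrable N (\<lambda>w. (BX u w)\<^sup>2)" "integrable N (\<lambda>w. (BY u w)\<^sup>2)"
  using components_centered_gaussian [OF u] bridge_components_measurable [OF u]
  by (auto intro: centered_gaussian_properties)

lemma components_centered:
  assumes u: "u \<in> {0<..<1}"
  shows "expectation (BX u) = 0" "expectation (BY u) = 0"
  using components_centered_gaussian [OF u] bridge_components_measurable [OF u]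
  by (auto intro: centered_gaussian_properties)

lemma components_mult_integrable:
  assumes "u \<in> {0<..<1}" "v \<in> {0<..<1}"
  shows "integrable N (\<lambda>w. BX u w * BX v w)" "integrable N (\<lambda>w. BX u w * BY v w)"
    "integrable N (\<lambda>w. BY u w * BX v w)" "integrable N (\<lambda>w. BY u w * BY v w)"
  using assms
  by (auto intro!: integrable_mult_of_squares components_square_integrable bridge_components_measurable)

lemma components_covariance:
  assumes "u \<in> {0<..<1}" "v \<in> {0<..<1}"
  shows "expectation (\<lambda>w. BX u w * BX v w) = min u v - u * v"
    "expectation (\<lambda>w. BY u w * BY v w) = min u v - u * v"
    "expectation (\<lambda>w. BX u w * BY v w) = H (Q u) (Q v) - u * v"
    "expectation (\<lambda>w. BY u w * BX v w) = H (Q v) (Q u) - u * v"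
proof -
  have "covariance N (BX u) (BX v) = min u v - u * v" "covariance N (BY u) (BY v) = min u v - u * v"
    using bridges assms by (auto simp: brownian_bridge_def)
  then show "expectation (\<lambda>w. BX u w * BX v w) = min u v - u * v"
    "expectation (\<lambda>w. BY u w * BY v w) = min u v - u * v"
    using assms by (simp_all add: covariance_def components_centered)
  show "expectation (\<lambda>w. BX u w * BY v w) = H (Q u) (Q v) - u * v"
    using cross_cov [OF assms] assms by (simp add: covariance_def components_centered)
  show "expectation (\<lambda>w. BY u w * BX v w) = H (Q v) (Q u) - u * v"
    using cross_cov [OF assms(2,1)] assms by (simp add: covariance_def components_centered mult.commute)
qed

lemma bridge_mult_eq: "bridge u w * bridge v w =
  (BX u w * BX v w - BX u w * BY v w - BY u w * BX v w + BY u w * BY v w) / (f (Q u) * f (Q v))"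
  by (simp add: bridge_def diff_divide_distrib [symmetric] algebra_simps)

lemma bridge_mult_integrable:
  assumes "u \<in> {0<..<1}" "v \<in> {0<..<1}"
  shows "integrable N (\<lambda>w. bridge u w * bridge v w)"
  unfolding bridge_mult_eq using components_mult_integrable [OF assms] by simp

lemma bridge_covariance:
  assumes "u \<in> {0<..<1}" "v \<in> {0<..<1}"
  shows "expectation (\<lambda>w. bridge u w * bridge v w) = (2 * min u v - H (Q u) (Q v) - H (Q v) (Q u)) / (f (Q u) * f (Q v))"
  unfolding bridge_mult_eq using components_mult_integrable [OF assms] by (simp add: components_covariance [OF assms])

lemma bridge_measurable: "u \<in> {0<..<1} \<Longrightarrow> bridge u \<in> borel_measurable N"
  unfolding bridge_def [abs_def] using bridge_components_measurable by simp

text \<open>Joint Gaussianity over the disjoint union of the two index sets is essential here, as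
  every value of \<open>bridge\<close> mixes both components.\<close>

lemma lin_comb_bridge_gaussian:
  assumes l: "set l \<subseteq> UNIV \<times> {0<..<1}"
  shows "centered_gaussian_law (distr N borel (lin_comb bridge l))"
proof -
  \<comment> \<open>Each entry splits into one entry for each component, with opposite
    coefficients.\<close>
  define l' where "l' = concat (map (\<lambda>(s, u). [(s / f (Q u), Inl u), (- (s / f (Q u)), Inr u)]) l)"
  have eq: "lin_comb bridge l w = lin_comb (case_sum BX BY) l' w" for w
    unfolding l'_def
  proof (induction l)
    case (Cons x l)
    then show ?case by (cases x) (simp add: bridge_def algebra_simps)
  qed simp
  have "snd ` set l' \<subseteq> {0<..<1} <+> {0<..<1}"
    using l by (auto simp: l'_def)
  from gaussian_law [OF _ this]
  show ?thesis
    by (simp add: lin_comb_eq_sum [of "snd ` set l'" l'] eq [abs_def])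
qed

lemma char_lin_comb_bridge:
  assumes l: "set l \<subseteq> UNIV \<times> {0<..<1}"
  shows "(CLINT w|N. iexp (lin_comb bridge l w))
    = complex_of_real (exp (- expectation (\<lambda>w. (lin_comb bridge l w)\<^sup>2) / 2))"
  by (rule centered_gaussian_properties(3) [OF lin_comb_bridge_gaussian [OF l]
        lin_comb_measurable_set [OF bridge_measurable l]])

lemma bridge_paths_continuous:
  assumes "w \<in> space N" shows "continuous_on {0<..<1} (\<lambda>u. bridge u w)"
proof -
  have B: "continuous_on {0<..<1} (\<lambda>u. BX u w)" "continuous_on {0<..<1} (\<lambda>u. BY u w)"
    using bridges assms by (auto simp: brownian_bridge_def)
  have "continuous_on {0<..<1} Q"
  proof (rule continuous_on_eq_continuous_within [THEN iffD2], rule ballI)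
    fix u :: real assume u: "u \<in> {0<..<1}"
    have "isCont Q (cdf \<mu> (Q u))"
      by (rule isCont_inverse_function [where d=1 and x="Q u" and f="cdf \<mu>"]) (simp_all add: dist.F_continuous)
    then have "isCont Q u" using u dist.F_Q [of u] by simp
    then show "continuous (at u within {0<..<1}) Q" by (rule continuous_at_imp_continuous_at_within)
  qed
  then have "continuous_on {0<..<1} (\<lambda>u. f (Q u))"
    by (rule continuous_on_compose2 [OF dist.density_continuous]) simp
  then show ?thesis
    unfolding bridge_def using B dist.density_pos by (intro continuous_intros) (auto simp: less_imp_neq [symmetric])
qed

lemma bridge_jointly_measurable [measurable]: "case_prod bridge \<in> borel_measurable (unit_lborel \<Otimes>\<^sub>M N)"
  by (intro measurable_continuous_paths bridge_measurable bridge_paths_continuous)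

text \<open>From \<open>(a - b)^2 \<le> 2 (a^2 + b^2)\<close> the variance at \<open>u\<close> is at
  most \<open>4 u (1 - u) / f (Q u)^2\<close>, whatever the cross covariance. The substitution
  \<open>u = F x\<close> turns \<open>f^(-q)\<close> into \<open>f^(1-q)\<close> and yields
  \<open>J_integral q\<close>.\<close>

lemma bridge_moment_bound:
  assumes q: "0 < q" "q \<le> 2"
  shows "(\<integral>\<^sup>+w. \<integral>\<^sup>+u. ennreal (\<bar>bridge u w\<bar> powr q) \<partial>unit_lborel \<partial>N) \<le> ennreal (2 * 2 powr q) * dist.J_integral q"
proof -
  interpret unit: prob_space unit_lborel by (rule prob_space_unit_lborel)
  interpret P: pair_sigma_finite unit_lborel N ..
  have [measurable]: "(\<lambda>u. u) \<in> borel_measurable unit_lborel"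
    by (rule measurable_restrict_space1) simp
  let ?g = "\<lambda>u. ennreal ((u * (1 - u)) powr (q / 2) / f (Q u) powr q)"
  have "(\<integral>\<^sup>+w. \<integral>\<^sup>+u. ennreal (\<bar>bridge u w\<bar> powr q) \<partial>unit_lborel \<partial>N)
     = (\<integral>\<^sup>+u. \<integral>\<^sup>+w. ennreal (\<bar>bridge u w\<bar> powr q) \<partial>N \<partial>unit_lborel)"
    by (rule P.Fubini') measurable
  also have "\<dots> \<le> (\<integral>\<^sup>+u. ennreal (2 * 2 powr q) * ?g u \<partial>unit_lborel)"
  proof (rule nn_integral_mono)
    fix u assume "u \<in> space unit_lborel"
    then have u: "u \<in> {0<..<1}" by simp
    then have h: "0 < f (Q u)" and uu: "0 < u * (1 - u)" using dist.density_pos by auto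
    let ?s = "4 * (u * (1 - u)) / (f (Q u))\<^sup>2"
    have "(\<integral>\<^sup>+w. ennreal (\<bar>bridge u w\<bar> powr q) \<partial>N) \<le> ennreal (2 * ?s powr (q / 2))"
    proof (rule nn_integral_powr_le_second_moment)
      show "integrable N (\<lambda>w. (bridge u w)\<^sup>2)"
        using bridge_mult_integrable [OF u u] by (simp add: power2_eq_square)
      then have "expectation (\<lambda>w. (bridge u w)\<^sup>2) \<le> expectation (\<lambda>w. 2 / (f (Q u))\<^sup>2 * ((BX u w)\<^sup>2 + (BY u w)\<^sup>2))"
      proof (rule integral_mono)
        show "integrable N (\<lambda>w. 2 / (f (Q u))\<^sup>2 * ((BX u w)\<^sup>2 + (BY u w)\<^sup>2))"
          using components_square_integrable [OF u] by simp
        show "(bridge u w)\<^sup>2 \<le> 2 / (f (Q u))\<^sup>2 * ((BX u w)\<^sup>2 + (BY u w)\<^sup>2)" for w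
        proof -
          have "(a - b)\<^sup>2 \<le> 2 * (a\<^sup>2 + b\<^sup>2)" for a b :: real
            using zero_le_power2 [of "a + b"] by (simp add: power2_eq_square algebra_simps)
          from this [of "BX u w / f (Q u)" "BY u w / f (Q u)"] show ?thesis
            by (simp add: bridge_def power_divide add_divide_distrib [symmetric])
        qed
      qed
      also have "\<dots> = 2 / (f (Q u))\<^sup>2 * (expectation (\<lambda>w. BX u w * BX u w) + expectation (\<lambda>w. BY u w * BY u w))"
        using components_square_integrable [OF u] by (simp add: power2_eq_square)
      also have "\<dots> = ?s"
        by (simp add: components_covariance [OF u u] algebra_simps)
      finally show "expectation (\<lambda>w. (bridge u w)\<^sup>2) \<le> ?s" .
    qed (use q h uu bridge_measurable u in auto)
    also have "?s powr (q / 2) = 2 powr q * ((u * (1 - u)) powr (q / 2) / f (Q u) powr q)"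
    proof -
      have "(4::real) powr (q / 2) = (2 powr 2) powr (q / 2)" by simp
      then have "(4::real) powr (q / 2) = 2 powr q" unfolding powr_powr by simp
      moreover have "(f (Q u))\<^sup>2 powr (q / 2) = f (Q u) powr q"
        using h by (simp add: powr_powr powr_numeral [symmetric] del: powr_numeral)
      ultimately show ?thesis
        using h uu by (simp add: powr_divide powr_mult [of 4])
    qed
    finally show "(\<integral>\<^sup>+w. ennreal (\<bar>bridge u w\<bar> powr q) \<partial>N) \<le> ennreal (2 * 2 powr q) * ?g u"
      by (subst ennreal_mult' [symmetric]) (simp_all add: mult.assoc)
  qed
  also have "\<dots> = ennreal (2 * 2 powr q) * (\<integral>\<^sup>+u. ?g u \<partial>unit_lborel)"
    by (rule nn_integral_cmult) measurable
  also have "(\<integral>\<^sup>+u. ?g u \<partial>unit_lborel) = (\<integral>\<^sup>+x. ennreal (f x) * ?g (cdf \<mu> x) \<partial>lborel)"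
    by (rule dist.nn_integral_unit_eq) measurable
  also have "\<dots> = dist.J_integral q"
    unfolding dist.J_integral_def
  proof (rule nn_integral_cong)
    fix x
    have h: "0 < f x" by (rule dist.density_pos)
    have "f x powr q = f x * f x powr (q - 1)" using h by (simp add: powr_mult_base)
    then show "ennreal (f x) * ?g (cdf \<mu> x) =
      ennreal ((cdf \<mu> x * (1 - cdf \<mu> x)) powr (q / 2) / f x powr (q - 1))"
      using h by (simp add: ennreal_mult [symmetric])
  qed
  finally show ?thesis .
qed

text \<open>The variance of the process at \<open>u\<close> is
  \<open>2 (u - H (Q u) (Q u)) / f (Q u)^2\<close>, which is positive here, so its value there is
  almost surely nonzero; continuous paths do the rest.\<close>

lemma AE_power_integral_pos:
  assumes u: "u \<in> {0<..<1}" and less: "H (Q u) (Q u) < u"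
  shows "AE w in N. 0 < (\<integral>\<^sup>+v. ennreal (\<bar>bridge v w\<bar> powr p) \<partial>unit_lborel)"
proof -
  have law: "centered_gaussian_law (distr N borel (bridge u))"
    using lin_comb_bridge_gaussian [of "[(1, u)]"] u by (simp add: lin_comb_def [abs_def])
  have "0 < expectation (\<lambda>w. (bridge u w)\<^sup>2)"
    using bridge_covariance [OF u u] less dist.density_pos [of "Q u"] by (simp add: power2_eq_square)
  with centered_gaussian_properties(4) [OF law bridge_measurable [OF u]]
  have "AE w in N. bridge u w \<noteq> 0" by simp
  then show ?thesis
    using AE_space
  proof eventually_elim
    case (elim w)
    have "(\<lambda>v. bridge v w) \<in> borel_measurable unit_lborel"
      using measurable_compose [OF measurable_Pair2' [OF elim(2), of unit_lborel] bridge_jointly_measurable] by simp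
    then show ?case
      using bridge_paths_continuous [OF elim(2)] u elim(1) by (intro nn_integral_unit_pos) auto
  qed
qed

end

section \<open>Two coupled samples with a common marginal law\<close>

lemma powr_abs_diff_le:
  fixes a b q :: real
  assumes "0 \<le> q"
  shows "\<bar>a - b\<bar> powr q \<le> 2 powr q * (\<bar>a\<bar> powr q + \<bar>b\<bar> powr q)"
proof -
  have "\<bar>a - b\<bar> powr q \<le> (2 * max \<bar>a\<bar> \<bar>b\<bar>) powr q"
    using assms by (intro powr_mono2) auto
  also have "\<dots> = 2 powr q * max \<bar>a\<bar> \<bar>b\<bar> powr q" by (simp add: powr_mult)
  also have "max \<bar>a\<bar> \<bar>b\<bar> powr q \<le> \<bar>a\<bar> powr q + \<bar>b\<bar> powr q" by (simp add: max_def)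
  finally show ?thesis by simp
qed

text \<open>Independence is assumed between different pairs only; the two coordinates of one pair
  may depend on each other in any way.\<close>

locale coupled_sample = iid_sequence M "\<lambda>i w. (X i w, Y i w)" + dist: density_cdf "distr M borel (X 0)" f
  for M :: "'a measure" and X Y :: "nat \<Rightarrow> 'a \<Rightarrow> real" and f :: "real \<Rightarrow> real" +
  assumes same_law: "distr M borel (Y 0) = distr M borel (X 0)"
begin

sublocale SX: density_sample M X f
proof -
  have "iid_sequence M (\<lambda>i w. fst (X i w, Y i w))"
    by (rule iid_sequence_compose [OF iid_sequence_axioms])
       (intro borel_measurable_continuous_onI continuous_intros)
  then show "density_sample M X f"
    by (simp add: density_sample_def dist.density_cdf_axioms)
qed

sublocale SY: density_sample M Y f
proof -
  have "iid_sequence M (\<lambda>i w. snd (X i w, Y i w))"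
    by (rule iid_sequence_compose [OF iid_sequence_axioms])
       (intro borel_measurable_continuous_onI continuous_intros)
  then show "density_sample M Y f"
    by (simp add: density_sample_def same_law dist.density_cdf_axioms)
qed

abbreviation F :: "real \<Rightarrow> real" where "F \<equiv> cdf (distr M borel (X 0))"
abbreviation Q :: "real \<Rightarrow> real" where "Q \<equiv> quantile F"

text \<open>The common quantile \<open>Q\<close> cancels, so this is the difference of the two
  centered quantile processes.\<close>

definition quantile_diff :: "nat \<Rightarrow> real \<Rightarrow> 'a \<Rightarrow> real" where
  "quantile_diff n u w = sqrt (real n) * (quantile (SX.K n w) u - quantile (SY.K n w) u)"

text \<open>The influence function of the quantile difference: contribution of one pair to the
  difference of the linear errors. The order of the coordinates is reversed because a quantile falls
  when the distribution function rises.\<close>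

definition score :: "real \<Rightarrow> real \<times> real \<Rightarrow> real" where
  "score u z = (of_bool (snd z \<le> Q u) - of_bool (fst z \<le> Q u)) / f (Q u)"

lemma quantile_diff_measurable [measurable]: "case_prod (quantile_diff n) \<in> borel_measurable (unit_lborel \<Otimes>\<^sub>M M)"
proof (cases "n = 0")
  case False
  then have [measurable]:
    "(\<lambda>z. quantile (SX.K n (snd z)) (fst z)) \<in> borel_measurable (unit_lborel \<Otimes>\<^sub>M M)"
    "(\<lambda>z. quantile (SY.K n (snd z)) (fst z)) \<in> borel_measurable (unit_lborel \<Otimes>\<^sub>M M)"
    using quantile_empirical_measurable [of X M n] quantile_empirical_measurable [of Y M n]
    by (simp_all add: case_prod_beta)
  show ?thesis unfolding quantile_diff_def case_prod_beta by measurable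
next
  case True
  then have "quantile_diff n = (\<lambda>u w. 0)" by (simp add: quantile_diff_def fun_eq_iff)
  then show ?thesis by simp
qed

lemma quantile_diff_moment_bound:
  assumes q: "1 < q" "q < 2"
  shows "(\<integral>\<^sup>+w. \<integral>\<^sup>+u. ennreal (\<bar>quantile_diff n u w\<bar> powr q) \<partial>unit_lborel \<partial>M)
    \<le> ennreal (2 powr q) * (2 * (ennreal (4 * q * (2 * q) powr (q - 1)) * dist.J_integral q))"
proof (cases "n = 0")
  case False
  then have n: "0 < n" by simp
  interpret unit: prob_space unit_lborel by (rule prob_space_unit_lborel)
  let ?a = "\<lambda>w u. sqrt (real n) * (quantile (SX.K n w) u - Q u)"
  let ?b = "\<lambda>w u. sqrt (real n) * (quantile (SY.K n w) u - Q u)"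
  let ?A = "\<lambda>w u. ennreal (\<bar>?a w u\<bar> powr q)"
  let ?B = "\<lambda>w u. ennreal (\<bar>?b w u\<bar> powr q)"
  have "(\<integral>\<^sup>+w. \<integral>\<^sup>+u. ennreal (\<bar>quantile_diff n u w\<bar> powr q) \<partial>unit_lborel \<partial>M)
    \<le> (\<integral>\<^sup>+w. \<integral>\<^sup>+u. ennreal (2 powr q) * (?A w u + ?B w u) \<partial>unit_lborel \<partial>M)"
  proof (intro nn_integral_mono)
    fix w u
    have "quantile_diff n u w = ?a w u - ?b w u" by (simp add: quantile_diff_def algebra_simps)
    then show "ennreal (\<bar>quantile_diff n u w\<bar> powr q)
      \<le> ennreal (2 powr q) * (?A w u + ?B w u)"
      using powr_abs_diff_le [of q "?a w u" "?b w u"] q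
      by (simp add: ennreal_plus [symmetric] ennreal_mult [symmetric] ennreal_leI del: ennreal_plus)
  qed
  also have "\<dots> = ennreal (2 powr q) * ((\<integral>\<^sup>+w. \<integral>\<^sup>+u. ?A w u \<partial>unit_lborel \<partial>M)
      + (\<integral>\<^sup>+w. \<integral>\<^sup>+u. ?B w u \<partial>unit_lborel \<partial>M))"
  proof -
    have "(\<lambda>z. Q (snd z)) \<in> borel_measurable (M \<Otimes>\<^sub>M unit_lborel)"
      by (rule measurable_compose [OF measurable_snd dist.Q_measurable])
    moreover have "(\<lambda>z. quantile (SX.K n (fst z)) (snd z)) \<in> borel_measurable (M \<Otimes>\<^sub>M unit_lborel)"
      "(\<lambda>z. quantile (SY.K n (fst z)) (snd z)) \<in> borel_measurable (M \<Otimes>\<^sub>M unit_lborel)"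
      using measurable_pair_swap [OF quantile_empirical_measurable [of X M n]]
        measurable_pair_swap [OF quantile_empirical_measurable [of Y M n]] n
      by (simp_all add: case_prod_beta)
    ultimately have [measurable]: "(\<lambda>(w, u). ?a w u) \<in> borel_measurable (M \<Otimes>\<^sub>M unit_lborel)"
      "(\<lambda>(w, u). ?b w u) \<in> borel_measurable (M \<Otimes>\<^sub>M unit_lborel)"
      by (simp_all add: case_prod_beta)
    have [measurable]: "?a w \<in> borel_measurable unit_lborel" "?b w \<in> borel_measurable unit_lborel" for w
      using quantile_measurable [OF right_continuous_mono_empirical_cdf [OF n]] by measurable
    have "(\<integral>\<^sup>+u. ennreal (2 powr q) * (?A w u + ?B w u) \<partial>unit_lborel)
      = ennreal (2 powr q) * ((\<integral>\<^sup>+u. ?A w u \<partial>unit_lborel) + (\<integral>\<^sup>+u. ?B w u \<partial>unit_lborel))" for w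
      by (simp add: nn_integral_cmult nn_integral_add)
    moreover have "(\<lambda>w. \<integral>\<^sup>+u. ?A w u \<partial>unit_lborel) \<in> borel_measurable M"
      "(\<lambda>w. \<integral>\<^sup>+u. ?B w u \<partial>unit_lborel) \<in> borel_measurable M"
      by measurable
    ultimately show ?thesis by (simp add: nn_integral_cmult nn_integral_add)
  qed
  also have "\<dots> \<le> ennreal (2 powr q) * (ennreal (4 * q * (2 * q) powr (q - 1)) * dist.J_integral q
      + ennreal (4 * q * (2 * q) powr (q - 1)) * dist.J_integral q)"
    using SX.moment_bound_empirical_quantile [OF n q] SY.moment_bound_empirical_quantile [OF n q]
    unfolding same_law by (intro mult_left_mono add_mono) auto
  finally show ?thesis by (simp only: mult_2)
next
  case True
  then have "quantile_diff n u w = 0" for u w by (simp add: quantile_diff_def)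
  then have "(\<integral>\<^sup>+w. \<integral>\<^sup>+u. ennreal (\<bar>quantile_diff n u w\<bar> powr q) \<partial>unit_lborel \<partial>M) = 0"
    by simp
  then show ?thesis by (simp only: zero_le)
qed

lemma score_measurable [measurable]: "score u \<in> borel_measurable borel"
  unfolding score_def [abs_def] by (simp add: borel_prod [symmetric])

lemma expectation_score: "expectation (\<lambda>w. score u (X 0 w, Y 0 w)) = 0"
  using SX.integrable_of_bool [of 0 "Q u"] SY.integrable_of_bool [of 0 "Q u"]
    SX.expectation_indicator [of 0 "Q u"] SY.expectation_indicator [of 0 "Q u"]
  by (simp add: score_def same_law)

lemma score_bounded: "\<bar>score u z\<bar> \<le> 1 / f (Q u)"
proof -
  have "\<bar>of_bool (snd z \<le> Q u) - of_bool (fst z \<le> Q u) :: real\<bar> \<le> 1" by simp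
  then show ?thesis
    using dist.density_pos [of "Q u"] by (simp only: score_def abs_divide abs_of_pos divide_right_mono less_imp_le)
qed

lemma lin_comb_score_bounded: "\<exists>c. \<forall>z. \<bar>lin_comb score l z\<bar> \<le> c"
proof (induction l)
  case (Cons x l)
  then obtain c where c: "\<And>z. \<bar>lin_comb score l z\<bar> \<le> c" by blast
  obtain s u where x: "x = (s, u)" by (cases x)
  have "\<bar>lin_comb score (x # l) z\<bar> \<le> \<bar>s\<bar> * (1 / f (Q u)) + c" for z
    unfolding x lin_comb_Cons
    by (rule order_trans [OF abs_triangle_ineq]) (simp only: abs_mult add_mono mult_left_mono score_bounded c abs_ge_zero)
  then show ?case by blast
qed (auto simp: lin_comb_def)

lemma lin_comb_score_measurable [measurable]: "lin_comb score l \<in> borel_measurable borel"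
  by (rule lin_comb_measurable_set [where S=UNIV]) auto

lemma integrable_score: "integrable M (\<lambda>w. score u (X i w, Y i w))"
  using V_measurable [of i] by (intro integrable_bounded [OF _ score_bounded]) measurable

lemma expectation_lin_comb_score:
  "integrable M (\<lambda>w. lin_comb score l (X 0 w, Y 0 w)) \<and> expectation (\<lambda>w. lin_comb score l (X 0 w, Y 0 w)) = 0"
proof (induction l)
  case (Cons x l)
  then show ?case using integrable_score [of _ 0] by (cases x) (simp add: expectation_score)
qed simp

text \<open>The level \<open>u\<close> cancels between the two samples, leaving a normalised sum of
  scores to which the central limit theorem applies.\<close>

lemma lin_comb_linear_eq:
  "lin_comb (\<lambda>u w. SX.linear_error u n w - SY.linear_error u n w) l w
    = (\<Sum>i<n. lin_comb score l (X i w, Y i w)) / sqrt (real n)"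
proof (induction l)
  case (Cons x l)
  obtain s u where x: "x = (s, u)" by (cases x)
  have "SX.linear_error u n w - SY.linear_error u n w = (\<Sum>i<n. score u (X i w, Y i w)) / sqrt (real n)"
  proof (cases "n = 0")
    case False
    have "(\<Sum>i<n. score u (X i w, Y i w)) = real n * (SY.K n w (Q u) - SX.K n w (Q u)) / f (Q u)"
      using False by (simp add: score_def empirical_cdf_eq_sum sum_subtractf sum_divide_distrib [symmetric] diff_divide_distrib
          right_diff_distrib)
    moreover have "real n / sqrt (real n) = sqrt (real n)" by (rule real_div_sqrt) simp
    moreover have "real n * d / h / sqrt (real n) = real n / sqrt (real n) * d / h" for d h
      by simp
    ultimately have "(\<Sum>i<n. score u (X i w, Y i w)) / sqrt (real n)
       = sqrt (real n) * (SY.K n w (Q u) - SX.K n w (Q u)) / f (Q u)"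
      by (simp only:)
    then show ?thesis unfolding same_law by (simp add: diff_divide_distrib [symmetric] algebra_simps)
  qed simp
  then show ?case
    unfolding x lin_comb_Cons Cons by (simp add: sum.distrib sum_distrib_left add_divide_distrib)
qed simp

text \<open>The quantile difference is the difference of the linear errors plus two Bahadur
  remainders, which are negligible at each fixed level; the central limit theorem for scores and
  \<open>char_add_negligible\<close> finish.\<close>

lemma char_quantile_diff_tendsto:
  assumes l: "set l \<subseteq> UNIV \<times> {0<..<1}"
  shows "(\<lambda>n. CLINT w|M. iexp (lin_comb (quantile_diff n) l w))
    \<longlonglongrightarrow> complex_of_real (exp (- expectation (\<lambda>w. (lin_comb score l (X 0 w, Y 0 w))\<^sup>2) / 2))"
proof -
  let ?v = "complex_of_real (exp (- expectation (\<lambda>w. (lin_comb score l (X 0 w, Y 0 w))\<^sup>2) / 2))"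
  let ?L = "\<lambda>n u w. SX.linear_error u n w - SY.linear_error u n w"
  let ?DX = "\<lambda>n u w. SX.quantile_error u n w - SX.linear_error u n w"
  let ?DY = "\<lambda>n u w. SY.quantile_error u n w - SY.linear_error u n w"
  have D: "negligible (\<lambda>n. lin_comb (\<lambda>u w. ?DX n u w + - 1 * ?DY n u w) l)"
  proof (rule negligible_lin_comb [OF _ l], intro negligible_add negligible_cmult)
    fix u :: real assume u: "u \<in> {0<..<1}"
    show "negligible (\<lambda>n. ?DX n u)"
      unfolding negligible_def using SX.bahadur_representation [OF u]
      by (auto intro!: borel_measurable_diff SX.quantile_error_measurable u)
    show "negligible (\<lambda>n. ?DY n u)"
      unfolding negligible_def using SY.bahadur_representation [OF u]
      by (auto intro!: borel_measurable_diff SY.quantile_error_measurable u)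
  qed
  obtain c where c: "\<And>z. \<bar>lin_comb score l z\<bar> \<le> c" using lin_comb_score_bounded by blast
  have "(\<lambda>n. CLINT w|M. iexp (lin_comb (?L n) l w))
    \<longlonglongrightarrow> ?v"
    unfolding lin_comb_linear_eq
    by (rule char_normalized_sum_tendsto [OF _ c]) (use expectation_lin_comb_score [of l] in auto)
  then have "(\<lambda>n. CLINT w|M. iexp (lin_comb (?L n) l w + lin_comb (\<lambda>u w. ?DX n u w + - 1 * ?DY n u w) l w))
    \<longlonglongrightarrow> ?v"
    by (rule char_add_negligible [OF D, rotated]) (rule lin_comb_measurable_set [where S=UNIV], auto)
  moreover have "lin_comb (?L n) l w + lin_comb (\<lambda>u w. ?DX n u w + - 1 * ?DY n u w) l w
    = lin_comb (quantile_diff n) l w" for n w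
    unfolding lin_comb_add [symmetric]
  proof (rule lin_comb_cong)
    fix u
    have "(a - b) + ((c - a) + - 1 * (d - b)) = c - d" for a b c d :: real by simp
    then show "?L n u w + (?DX n u w + - 1 * ?DY n u w) = quantile_diff n u w"
      by (simp only:) (simp add: quantile_diff_def same_law right_diff_distrib)
  qed
  ultimately show ?thesis by (simp only:)
qed

text \<open>Agrees with \<open>bridge_covariance\<close>, where the four products
  \<open>u * v\<close> cancel. This identity is what identifies the limit.\<close>

lemma expectation_score_mult:
  assumes u: "u \<in> {0<..<1}" and v: "v \<in> {0<..<1}"
  defines "H \<equiv> joint_cdf (distr M borel (\<lambda>w. (X 0 w, Y 0 w)))"
  shows "expectation (\<lambda>w. score u (X 0 w, Y 0 w) * score v (X 0 w, Y 0 w))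
    = (2 * min u v - H (Q u) (Q v) - H (Q v) (Q u)) / (f (Q u) * f (Q v))"
proof -
  have H: "H s t = expectation (\<lambda>w. of_bool (X 0 w \<le> s) * of_bool (Y 0 w \<le> t))" for s t
  proof -
    have "H s t = prob {w \<in> space M. X 0 w \<le> s \<and> Y 0 w \<le> t}"
      unfolding H_def joint_cdf_def using V_measurable [of 0]
      by (subst measure_distr) (auto simp: closed_Times intro!: arg_cong [where f=prob] borel_closed)
    also have "\<dots> = expectation (indicator {w \<in> space M. X 0 w \<le> s \<and> Y 0 w \<le> t})" by simp
    also have "\<dots> = expectation (\<lambda>w. of_bool (X 0 w \<le> s) * of_bool (Y 0 w \<le> t))"
      by (intro Bochner_Integration.integral_cong) (auto simp: indicator_def)
    finally show ?thesis .
  qed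
  have "F (min (Q u) (Q v)) = min u v"
    using dist.F_Q [of u] dist.F_Q [of v] u v
      quantile_mono [OF dist.cdf_right_continuous_mono, of u v] quantile_mono [OF dist.cdf_right_continuous_mono, of v u]
    by (cases "u \<le> v") (auto simp: min_absorb1 min_absorb2)
  moreover have "score u (X 0 w, Y 0 w) * score v (X 0 w, Y 0 w) =
    (of_bool (Y 0 w \<le> Q u) * of_bool (Y 0 w \<le> Q v) - of_bool (X 0 w \<le> Q v) * of_bool (Y 0 w \<le> Q u)
     - of_bool (X 0 w \<le> Q u) * of_bool (Y 0 w \<le> Q v) + of_bool (X 0 w \<le> Q u) * of_bool (X 0 w \<le> Q v)) / (f (Q u) * f (Q v))" for w
    unfolding score_def fst_conv snd_conv times_divide_times_eq by (rule arg_cong2 [where f="(/)"]) (auto simp: algebra_simps)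
  moreover have "integrable M (\<lambda>w. of_bool (A w \<le> s) * of_bool (B w \<le> t) :: real)"
    if [measurable]: "A \<in> borel_measurable M" "B \<in> borel_measurable M" for A B :: "'a \<Rightarrow> real" and s t
    by (rule integrable_bounded [where c=1]) auto
  ultimately show ?thesis
    by (simp add: H SX.expectation_of_bool_mult SY.expectation_of_bool_mult same_law)
qed

text \<open>Otherwise, at every \<open>x\<close>, the probability that both coordinates are at most
  \<open>x\<close> would be at least \<open>F x\<close>. Then \<open>X 0 \<le> x\<close> and
  \<open>Y 0 \<le> x\<close> agree almost surely, simultaneously for all rational \<open>x\<close>,
  which forces \<open>X 0 = Y 0\<close>.\<close>

lemma joint_cdf_diagonal_less:
  assumes "\<not> (AE w in M. X 0 w = Y 0 w)"
  obtains u where "u \<in> {0<..<1}" "joint_cdf (distr M borel (\<lambda>w. (X 0 w, Y 0 w))) (Q u) (Q u) < u"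
proof (rule ccontr)
  let ?H = "\<lambda>x. prob {w \<in> space M. X 0 w \<le> x \<and> Y 0 w \<le> x}"
  have H: "joint_cdf (distr M borel (\<lambda>w. (X 0 w, Y 0 w))) x x = ?H x" for x
    unfolding joint_cdf_def using V_measurable [of 0]
    by (subst measure_distr) (auto simp: closed_Times intro!: arg_cong [where f=prob] borel_closed)
  assume "\<not> thesis"
  then have ge: "u \<le> ?H (Q u)" if "u \<in> {0<..<1}" for u
    using that \<open>\<not> thesis\<close> H \<open>\<And>u. u \<in> {0<..<1} \<Longrightarrow> joint_cdf (distr M borel (\<lambda>w. (X 0 w, Y 0 w))) (Q u) (Q u) < u \<Longrightarrow> thesis\<close>
    by (metis not_le)
  have FH: "F x \<le> ?H x" for x
    using ge [of "F x"] dist.F_bounds [of x] by simp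
  have cX: "prob {w \<in> space M. X 0 w \<le> x} = F x" and cY: "prob {w \<in> space M. Y 0 w \<le> x} = F x" for x
  proof -
    show "prob {w \<in> space M. X 0 w \<le> x} = F x"
      by (simp add: cdf_def measure_distr vimage_def Int_def conj_commute)
    have "prob {w \<in> space M. Y 0 w \<le> x} = cdf (distr M borel (Y 0)) x"
      by (simp add: cdf_def measure_distr vimage_def Int_def conj_commute)
    then show "prob {w \<in> space M. Y 0 w \<le> x} = F x" by (simp add: same_law)
  qed
  have null: "AE w in M. A w \<le> x \<longrightarrow> X 0 w \<le> x \<and> Y 0 w \<le> x"
    if "A \<in> {X 0, Y 0}" for A x
  proof -
    have [measurable]: "A \<in> borel_measurable M" using that by auto
    let ?N = "{w \<in> space M. A w \<le> x} - {w \<in> space M. X 0 w \<le> x \<and> Y 0 w \<le> x}"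
    have "prob {w \<in> space M. A w \<le> x} = F x" using that cX cY by auto
    then have "prob (?N) = F x - ?H x"
      using that by (subst finite_measure_Diff) auto
    then have "prob (?N) = 0"
      using FH [of x] measure_nonneg [of M "?N"] by linarith
    then have "?N \<in> null_sets M"
      by (subst null_sets_def) (simp add: emeasure_eq_measure)
    then have "AE w in M. w \<notin> ?N"
      by (rule AE_not_in)
    then show ?thesis using AE_space by eventually_elim auto
  qed
  have "AE w in M. \<forall>x\<in>\<rat>. (X 0 w \<le> x \<longrightarrow> Y 0 w \<le> x) \<and> (Y 0 w \<le> x \<longrightarrow> X 0 w \<le> x)"
    unfolding AE_ball_countable [OF countable_rat]
  proof
    fix x :: real
    from null [of "X 0" x] null [of "Y 0" x]
    show "AE w in M. (X 0 w \<le> x \<longrightarrow> Y 0 w \<le> x) \<and> (Y 0 w \<le> x \<longrightarrow> X 0 w \<le> x)"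
      by simp
  qed
  then have "AE w in M. X 0 w = Y 0 w"
  proof eventually_elim
    case (elim w)
    show ?case
    proof (rule ccontr)
      assume "X 0 w \<noteq> Y 0 w"
      then consider "X 0 w < Y 0 w" | "Y 0 w < X 0 w" by linarith
      then show False
      proof cases
        case 1
        then obtain r where "r \<in> \<rat>" "X 0 w < r" "r < Y 0 w" using Rats_dense_in_real by blast
        with elim show False by force
      next
        case 2
        then obtain r where "r \<in> \<rat>" "Y 0 w < r" "r < X 0 w" using Rats_dense_in_real by blast
        with elim show False by force
      qed
    qed
  qed
  with assms show False by simp
qed

end

section \<open>Verification of the assumptions and conclusion\<close>

lemma C2_on_UNIV:
  assumes "C2_on UNIV F"
  shows "(F has_real_derivative deriv F x) (at x)" "continuous_on UNIV (deriv F)"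
proof -
  show "(F has_real_derivative deriv F x) (at x)"
    using assms by (simp add: C2_on_def DERIV_deriv_iff_field_differentiable)
  show "continuous_on UNIV (deriv F)"
    using assms by (intro continuous_at_imp_continuous_on ballI field_differentiable_imp_continuous_at) (simp add: C2_on_def)
qed

context density_cdf
begin

lemma F_neq: "F x \<noteq> 0" "F x \<noteq> 1"
  using F_bounds [of x] by auto

text \<open>The derivative of \<open>- ln (1 - F x)\<close> is the hazard rate
  \<open>f x / (1 - F x)\<close>, and the function tends to infinity, so
  \<open>regularly_varying_deriv_ge\<close> applies.\<close>

lemma hazard_right:
  assumes "regularly_varying (\<lambda>x. - ln (1 - F x))"
  shows "\<forall>\<^sub>F x in at_top. 1 - F x \<le> f x * x"
proof -
  have "((\<lambda>x. 1 - F x) \<longlongrightarrow> 1 - 1) at_top"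
    by (intro tendsto_intros cdf_lim_at_top_prob)
  then have "filterlim (\<lambda>x. 1 - F x) (at_right 0) at_top"
    unfolding filterlim_at by (auto intro!: always_eventually simp: F_bounds F_neq)
  then have "filterlim (\<lambda>x. - ln (1 - F x)) at_top at_top"
    by (intro filterlim_compose [OF filterlim_uminus_at_top_at_bot] filterlim_compose [OF ln_at_0])
  from regularly_varying_deriv_ge [OF assms this] eventually_gt_at_top [of 0]
  show ?thesis
  proof eventually_elim
    case (elim x)
    have "((\<lambda>x. - ln (1 - F x)) has_real_derivative f x / (1 - F x)) (at x)"
      using F_bounds [of x] by (auto intro!: derivative_eq_intros deriv_cdf)
    then have "1 / x \<le> f x / (1 - F x)" using elim(1) by (simp add: DERIV_imp_deriv)
    then show ?case using elim(2) F_bounds [of x] by (simp add: field_simps)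
  qed
qed

lemma hazard_left:
  assumes "regularly_varying (\<lambda>x. - ln (F (- x)))"
  shows "\<forall>\<^sub>F x in at_top. F (- x) \<le> f (- x) * x"
proof -
  have "((\<lambda>x. F (- x)) \<longlongrightarrow> 0) at_top"
    by (rule filterlim_compose [OF cdf_lim_at_bot filterlim_uminus_at_bot_at_top])
  then have "filterlim (\<lambda>x. F (- x)) (at_right 0) at_top"
    unfolding filterlim_at by (auto intro!: always_eventually simp: F_bounds F_neq)
  then have "filterlim (\<lambda>x. - ln (F (- x))) at_top at_top"
    by (intro filterlim_compose [OF filterlim_uminus_at_top_at_bot] filterlim_compose [OF ln_at_0])
  from regularly_varying_deriv_ge [OF assms this] eventually_gt_at_top [of 0]
  show ?thesis
  proof eventually_elim
    case (elim x)
    have "((\<lambda>x. F (- x)) has_real_derivative f (- x) * - 1) (at x)"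
      by (rule DERIV_chain2 [OF deriv_cdf]) (auto intro!: derivative_eq_intros)
    then have "((\<lambda>x. - ln (F (- x))) has_real_derivative f (- x) / F (- x)) (at x)"
      using F_bounds [of "- x"] by (auto intro!: derivative_eq_intros)
    then have "1 / x \<le> f (- x) / F (- x)" using elim(1) by (simp add: DERIV_imp_deriv)
    then show ?case using elim(2) F_bounds [of "- x"] by (simp add: field_simps)
  qed
qed

end

text \<open>The factor \<open>n^(p/2)\<close> enters the power as \<open>sqrt n\<close>. For
  \<open>n = 0\<close> both sides are 0, since \<open>0 powr x\<close> is 0.\<close>

lemma (in coupled_sample) wasserstein_eq:
  "real n powr (p / 2) * wasserstein_pow p (SX.K n w) (SY.K n w)
     = enn2real (\<integral>\<^sup>+u. ennreal (\<bar>quantile_diff n u w\<bar> powr p) \<partial>unit_lborel)"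
proof (cases "n = 0")
  case True
  then show ?thesis by (simp add: quantile_diff_def)
next
  case False
  then have n: "0 < n" by simp
  let ?d = "\<lambda>u. \<bar>quantile (SX.K n w) u - quantile (SY.K n w) u\<bar>"
  have [measurable]: "quantile (SX.K n w) \<in> borel_measurable unit_lborel"
    "quantile (SY.K n w) \<in> borel_measurable unit_lborel"
    by (intro quantile_measurable right_continuous_mono_empirical_cdf n)+
  have "wasserstein_pow p (SX.K n w) (SY.K n w) = (LINT u|unit_lborel. ?d u powr p)"
    unfolding wasserstein_pow_def set_lebesgue_integral_def
    by (subst integral_restrict_space) simp_all
  then have "real n powr (p / 2) * wasserstein_pow p (SX.K n w) (SY.K n w)
    = (LINT u|unit_lborel. real n powr (p / 2) * ?d u powr p)"
    by simp
  also have "\<dots> = enn2real (\<integral>\<^sup>+u. ennreal (real n powr (p / 2) * ?d u powr p) \<partial>unit_lborel)"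
    by (rule integral_eq_nn_integral) auto
  also have "(\<lambda>u. real n powr (p / 2) * ?d u powr p) = (\<lambda>u. \<bar>quantile_diff n u w\<bar> powr p)"
    by (simp add: quantile_diff_def abs_mult powr_mult powr_half_sqrt [symmetric] powr_powr)
  finally show ?thesis .
qed

lemma power_integral_eq:
  "power_integral p B w = (\<integral>\<^sup>+u. ennreal (\<bar>B u w\<bar> powr p) \<partial>unit_lborel)"
  unfolding power_integral_def by (subst nn_integral_restrict_space) simp_all

text \<open>Positivity is claimed only if \<open>X 0\<close> and \<open>Y 0\<close> do not agree
  almost surely: otherwise \<open>H x x = F x\<close>, the variance of the limit process is 0 at
  every level, and its power integral vanishes almost surely.\<close>

theorem proposition2:
  fixes M :: "'a measure" and N :: "'b measure"
    and X Y :: "nat \<Rightarrow> 'a \<Rightarrow> real" and BX BY :: "real \<Rightarrow> 'b \<Rightarrow> real"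
    and F G :: "real \<Rightarrow> real" and H :: "real \<Rightarrow> real \<Rightarrow> real"
    and p C \<epsilon> :: real
  assumes p: "1 < p" "p < 2"
    and M: "prob_space M"
    and indep: "prob_space.indep_vars M (\<lambda>_. borel) (\<lambda>i \<omega>. (X i \<omega>, Y i \<omega>)) UNIV"
    and ident: "\<And>i. distr M borel (\<lambda>\<omega>. (X i \<omega>, Y i \<omega>)) = distr M borel (\<lambda>\<omega>. (X 0 \<omega>, Y 0 \<omega>))"
    and H: "H = joint_cdf (distr M borel (\<lambda>\<omega>. (X 0 \<omega>, Y 0 \<omega>)))"
    and F: "F = cdf (distr M borel (X 0))"
    and G: "G = cdf (distr M borel (Y 0))"
    and FG: "F = G"
    and support: "measure_support (distr M borel (X 0)) = UNIV"
    and C2: "C2_on UNIV F"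
    and density_pos: "\<And>x. 0 < deriv F x"
    and rv_right: "regularly_varying (\<lambda>x. - ln (1 - F x))"
    and rv_left: "regularly_varying (\<lambda>x. - ln (F (- x)))"
    and tail: "0 < \<epsilon>" "0 < C"
      "\<forall>\<^sub>F x in at_infinity. F x * (1 - F x) \<le> C * \<bar>x\<bar> powr (- (2 * (p + 2) / (2 - p) + \<epsilon>))"
    and N: "prob_space N"
    and gauss: "centered_gaussian_process N ({0<..<1} <+> {0<..<1}) (case_sum BX BY)"
    and bridges: "brownian_bridge N BX" "brownian_bridge N BY"
    and cross_cov: "\<And>u v. u \<in> {0<..<1} \<Longrightarrow> v \<in> {0<..<1} \<Longrightarrow>
      covariance N (BX u) (BY v) = H (quantile F u) (quantile G v) - u * v"
  shows "converges_in_distribution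
           M (\<lambda>n \<omega>. real n powr (p / 2) *
                wasserstein_pow p (empirical_cdf n (\<lambda>i. X i \<omega>)) (empirical_cdf n (\<lambda>i. Y i \<omega>)))
           N (\<lambda>\<omega>. enn2real (power_integral p (limit_process F G BX BY) \<omega>)) \<and>
         (AE \<omega> in N. power_integral p (limit_process F G BX BY) \<omega> < \<infinity>) \<and>
         (\<not> (AE \<omega> in M. X 0 \<omega> = Y 0 \<omega>) \<longrightarrow>
            (AE \<omega> in N. 0 < power_integral p (limit_process F G BX BY) \<omega>))"
proof -
  interpret M: prob_space M by (rule M)
  define f where "f = deriv F"
  define \<mu> where "\<mu> = distr M borel (X 0)"
  have pair: "(\<lambda>w. (X i w, Y i w)) \<in> borel_measurable M" for i
    using indep unfolding M.indep_vars_def2 by simp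
  have X0: "X 0 \<in> borel_measurable M" and Y0: "Y 0 \<in> borel_measurable M"
    using measurable_compose [OF pair [of 0] borel_measurable_continuous_onI [OF continuous_on_fst [OF continuous_on_id]]]
      measurable_compose [OF pair [of 0] borel_measurable_continuous_onI [OF continuous_on_snd [OF continuous_on_id]]]
    by simp_all
  have F\<mu>: "F = cdf \<mu>" using F by (simp add: \<mu>_def)
  have dens: "density_cdf \<mu> f"
  proof (intro density_cdf.intro density_cdf_axioms.intro)
    show "real_distribution \<mu>" unfolding \<mu>_def by (rule M.real_distribution_distr [OF X0])
    show "(cdf \<mu> has_real_derivative f x) (at x)" for x
      using C2_on_UNIV(1) [OF C2] by (simp add: f_def F\<mu>)
    show "0 < f x" for x using density_pos by (simp add: f_def)
    show "continuous_on UNIV f" using C2_on_UNIV(2) [OF C2] by (simp add: f_def)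
  qed
  have same: "distr M borel (Y 0) = distr M borel (X 0)"
    by (rule cdf_unique) (use M.real_distribution_distr X0 Y0 F G FG in auto)
  interpret S: coupled_sample M X Y f
  proof (intro coupled_sample.intro iid_sequence.intro iid_sequence_axioms.intro coupled_sample_axioms.intro)
    show "density_cdf (distr M borel (X 0)) f" using dens by (simp add: \<mu>_def)
  qed (use M indep ident same in auto)
  interpret N: gaussian_limit N \<mu> f BX BY H
  proof (intro gaussian_limit.intro gaussian_limit_axioms.intro)
    show "covariance N (BX u) (BY v) = H (quantile (cdf \<mu>) u) (quantile (cdf \<mu>) v) - u * v"
      if "u \<in> {0<..<1}" "v \<in> {0<..<1}" for u v
      using cross_cov [OF that] FG F\<mu> by simp
  qed (use N dens gauss bridges in auto)
  have bridge_eq: "limit_process F G BX BY = N.bridge"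
    unfolding fun_eq_iff limit_process_def N.bridge_def FG [symmetric] by (simp add: F\<mu> f_def)

  (* the tail exponent makes the integral finite for q < (p + 2) / 2; take the midpoint of p and that bound *)
  define q where "q = (3 * p + 2) / 4"
  define a where "a = 2 * (p + 2) / (2 - p) + \<epsilon>"
  have q: "1 < q" "p < q" "q < 2" using p by (auto simp: q_def)
  have a: "q < a * (1 - q / 2)"
  proof -
    \<comment> \<open>Equality holds at \<open>q = (p + 2) / 2\<close>; the left side increases and
      the right side decreases in \<open>q\<close>, and the chosen \<open>q\<close> is
      smaller.\<close>
    have "q < (p + 2) * (2 - q) / (2 - p)"
      using p by (simp add: q_def field_simps)
    also have "\<dots> = 2 * (p + 2) / (2 - p) * (1 - q / 2)"
    proof -
      have "(p + 2) * (2 - q) = 2 * (p + 2) * (1 - q / 2)" by (simp add: algebra_simps)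
      then show ?thesis by (simp only: times_divide_eq_left)
    qed
    also have "\<dots> \<le> a * (1 - q / 2)"
      using q tail(1) by (intro mult_right_mono) (auto simp: a_def)
    finally show ?thesis .
  qed
  have J: "S.dist.J_integral q < \<infinity>"
  proof (rule S.dist.J_integral_finite [OF q(1,3) a tail(2)])
    show "\<forall>\<^sub>F x in at_top. 1 - S.F x \<le> f x * x"
      using rv_right by (intro S.dist.hazard_right) (simp add: F)
    show "\<forall>\<^sub>F x in at_top. S.F (- x) \<le> f (- x) * x"
      using rv_left by (intro S.dist.hazard_left) (simp add: F)
    show "\<forall>\<^sub>F x in at_infinity. S.F x * (1 - S.F x) \<le> C * \<bar>x\<bar> powr (- a)"
      using tail(3) by (simp add: a_def F)
  qed
  \<comment> \<open>The maximum of the two moment bounds, because \<open>weak_conv_powint\<close>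
    asks for one constant for the sequence and the limit.\<close>
  define b where "b = max (ennreal (2 powr q) * (2 * (ennreal (4 * q * (2 * q) powr (q - 1)) * S.dist.J_integral q)))
    (ennreal (2 * 2 powr q) * S.dist.J_integral q)"
  have "b < \<infinity>" using J by (simp add: b_def ennreal_mult_less_top)
  then have b: "b = ennreal (enn2real b)" by simp
  have PM: "bounded_power_process M unit_lborel (S.quantile_diff n) p q (enn2real b)" for n
  proof (intro bounded_power_process.intro bounded_power_process_axioms.intro)
    show "finite_measure unit_lborel"
      using prob_space_unit_lborel by (rule prob_space.finite_measure)
    show "(\<integral>\<^sup>+w. \<integral>\<^sup>+u. ennreal (\<bar>S.quantile_diff n u w\<bar> powr q) \<partial>unit_lborel \<partial>M) \<le> ennreal (enn2real b)"
      unfolding b [symmetric] unfolding b_def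
      by (rule order_trans [OF S.quantile_diff_moment_bound [OF q(1,3)] max.cobounded1])
  qed (use M p q S.quantile_diff_measurable in auto)
  have PN: "bounded_power_process N unit_lborel N.bridge p q (enn2real b)"
  proof (intro bounded_power_process.intro bounded_power_process_axioms.intro)
    show "finite_measure unit_lborel"
      using prob_space_unit_lborel by (rule prob_space.finite_measure)
    have "N.dist.J_integral q = S.dist.J_integral q" by (simp add: \<mu>_def)
    then have "ennreal (2 * 2 powr q) * N.dist.J_integral q \<le> ennreal (enn2real b)"
      unfolding b [symmetric] unfolding b_def by simp
    then show "(\<integral>\<^sup>+w. \<integral>\<^sup>+u. ennreal (\<bar>N.bridge u w\<bar> powr q) \<partial>unit_lborel \<partial>N) \<le> ennreal (enn2real b)"
      by (rule order_trans [OF N.bridge_moment_bound, rotated 2]) (use q in auto)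
  qed (use N p q N.bridge_jointly_measurable in auto)
  interpret PM: bounded_power_process M unit_lborel "S.quantile_diff n" p q "enn2real b" for n by (rule PM)
  interpret PN: bounded_power_process N unit_lborel N.bridge p q "enn2real b" by (rule PN)

  have fidi: "(\<lambda>n. CLINT w|M. iexp (lin_comb (S.quantile_diff n) l w)) \<longlonglongrightarrow> (CLINT w|N. iexp (lin_comb N.bridge l w))"
    if "set l \<subseteq> UNIV \<times> space unit_lborel" for l
  proof -
    have l: "set l \<subseteq> UNIV \<times> {0<..<1}" using that by simp
    \<comment> \<open>Both limits have the form \<open>exp (- v / 2)\<close>, so it suffices that
      the second moments \<open>v\<close> agree, and these depend only on pairwise
      covariances.\<close>
    have "(LINT w|M. (lin_comb (\<lambda>u w. S.score u (X 0 w, Y 0 w)) l w)\<^sup>2) = (LINT w|N. (lin_comb N.bridge l w)\<^sup>2)"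
    proof (rule second_moment_lin_comb_cong [OF _ _ _ l])
      fix u v :: real assume uv: "u \<in> {0<..<1}" "v \<in> {0<..<1}"
      show "integrable N (\<lambda>w. N.bridge u w * N.bridge v w)" by (rule N.bridge_mult_integrable [OF uv])
      show "integrable M (\<lambda>w. S.score u (X 0 w, Y 0 w) * S.score v (X 0 w, Y 0 w))"
      proof (rule M.integrable_bounded [where c="1 / f (S.Q u) * (1 / f (S.Q v))"])
        show "(\<lambda>w. S.score u (X 0 w, Y 0 w) * S.score v (X 0 w, Y 0 w)) \<in> borel_measurable M"
          by (intro borel_measurable_times measurable_compose [OF pair S.score_measurable])
        show "\<bar>S.score u (X 0 w, Y 0 w) * S.score v (X 0 w, Y 0 w)\<bar> \<le> 1 / f (S.Q u) * (1 / f (S.Q v))" for w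
          unfolding abs_mult by (intro mult_mono' S.score_bounded) auto
      qed
      show "(LINT w|M. S.score u (X 0 w, Y 0 w) * S.score v (X 0 w, Y 0 w)) = (LINT w|N. N.bridge u w * N.bridge v w)"
        unfolding S.expectation_score_mult [OF uv] N.bridge_covariance [OF uv] by (simp add: H \<mu>_def)
    qed
    moreover have "lin_comb (\<lambda>u w. S.score u (X 0 w, Y 0 w)) l w = lin_comb S.score l (X 0 w, Y 0 w)" for w
      by (rule lin_comb_cong) simp
    ultimately show ?thesis
      using S.char_quantile_diff_tendsto [OF l] N.char_lin_comb_bridge [OF l] by simp
  qed
  have W: "enn2real (power_integral p (limit_process F G BX BY) w) = enn2real (PN.powint p w)" for w
    by (simp add: power_integral_eq bridge_eq PN.powint_def)
  have Z: "real n powr (p / 2) * wasserstein_pow p (empirical_cdf n (\<lambda>i. X i w)) (empirical_cdf n (\<lambda>i. Y i w))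
      = enn2real (PM.powint n p w)" for n w
    by (simp add: S.wasserstein_eq PM.powint_def)
  have "converges_in_distribution M (\<lambda>n w. enn2real (PM.powint n p w)) N (\<lambda>w. enn2real (PN.powint p w))"
    unfolding converges_in_distribution_def
    using weak_conv_powint [OF PM PN fidi] by (simp add: PM.powint_def PN.powint_def)
  moreover have "AE w in N. power_integral p (limit_process F G BX BY) w < \<infinity>"
    using PN.AE_powint_finite AE_space
    by eventually_elim (use PN.powint_p_finite in \<open>simp add: power_integral_eq bridge_eq PN.powint_def\<close>)
  moreover have "AE w in N. 0 < power_integral p (limit_process F G BX BY) w" if ne: "\<not> (AE w in M. X 0 w = Y 0 w)"
  proof -
    obtain u where "u \<in> {0<..<1}" "H (N.Q u) (N.Q u) < u"
      using S.joint_cdf_diagonal_less [OF ne] by (auto simp: H \<mu>_def)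
    then show ?thesis
      unfolding power_integral_eq bridge_eq by (rule N.AE_power_integral_pos)
  qed
  ultimately show ?thesis unfolding W Z by blast
qed

end
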